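(* For every real number $\alpha<1$ there is a constant $c_\alpha>0$ such that the following holds. If $P$ is a set of $n$ points in $\mathbb R^3$ such that every plane in $\mathbb R^3$ contains at most $\alpha n$ points of $P$, then $P$ spans at least $c_\alpha n^2$ ordinary lines.
   Context: A line is spanned by a finite point set $P$ if it contains at least two points of $P$. An ordinary line for $P$ is a line containing exactly two points of $P$. *)

theory Defs
  imports "HOL-Analysis.Analysis"
begin

definition is_line :: "'a::euclidean_space set \<Rightarrow> bool" where
  "is_line L \<longleftrightarrow> affine L \<and> aff_dim L = 1"

definition is_plane :: "'a::euclidean_space set \<Rightarrow> bool" where
  "is_plane H \<longleftrightarrow> affine H \<and> aff_dim H = 2"

definition ordinary_lines :: "'a::euclidean_space set \<Rightarrow> 'a set set" where
  "ordinary_lines P = {L. is_line L \<and> card (P \<inter> L) = 2}"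

text \<open>A finite set has only finitely many ordinary lines, so counting them with \<^const>\<open>card\<close>
  is meaningful.\<close>

lemma finite_ordinary_lines:
  assumes "finite P"
  shows "finite (ordinary_lines P)"
proof (rule finite_subset)
  show "ordinary_lines P \<subseteq> (\<lambda>S. affine hull S) ` Pow P"
  proof
    fix L assume "L \<in> ordinary_lines P"
    then have L: "affine L" "aff_dim L = 1" and c: "card (P \<inter> L) = 2"
      by (auto simp: ordinary_lines_def is_line_def)
    then obtain a b where ab: "P \<inter> L = {a, b}" "a \<noteq> b"
      by (auto simp: card_2_iff)
    have sub: "affine hull {a, b} \<subseteq> L"
      using ab L(1) by (intro hull_minimal) auto
    have "aff_dim (affine hull {a, b}) = 1"
      using ab(2) by (simp add: aff_dim_affine_hull aff_dim_2)
    then have "affine hull {a, b} = L"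
      using sub L by (intro affine_dim_equal) auto
    then show "L \<in> (\<lambda>S. affine hull S) ` Pow P"
      using ab(1) by (metis Int_lower1 PowI image_eqI)
  qed
qed (use assms in simp)

end

theory Submission
  imports Defs
begin

text \<open>
  Every plane spanned by the set contains an ordinary line by the Sylvester--Gallai theorem, and an ordinary line
  lies in fewer than \<open>n\<close> spanned planes. Hence a cubic number of spanned planes yields a quadratic
  number of ordinary lines.

  If no line contains \<open>\<delta> n\<close> points, then most pairs of points lie on lines with boundedly many points,
  by the Szemeredi--Trotter bound obtained from the crossing lemma. Projecting from a point \<open>p\<close>,
  the same bound shows that for most pairs \<open>q\<close>, \<open>r\<close> the plane \<open>pqr\<close> either has boundedly many points or is
  one of boundedly many rich planes through \<open>p\<close>; the latter share few points and each contain at most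
  \<open>\<alpha> n\<close> points, so they account for at most about \<open>\<alpha> n\<^sup>2\<close> pairs. This leaves a cubic number
  of triples spanning planes with boundedly many points.

  If some line \<open>l\<close> contains at least \<open>\<delta> n\<close> points, consider the planes through \<open>l\<close>. Where such a plane has at
  most half as many points off \<open>l\<close> as there are on \<open>l\<close>, each point off \<open>l\<close> is joined to at least half of the points
  on \<open>l\<close> by ordinary lines. Otherwise there are two planes through \<open>l\<close> with linearly many points, and the
  planes through a point of \<open>l\<close> and one point in each of them are cubic in number.
\<close>

section \<open>The crossing lemma\<close>

text \<open>Central projection from \<open>p\<close> is not injective: all points on a line through
  \<open>p\<close> share one image, so the planar incidence bounds meet a set with multiplicities.
  This is why pairs on lines with more than a constant number of points are discarded before
  projecting. The pairs inside the few rich planes through \<open>p\<close> are the one loss that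
  cannot be made small; it stays a proper fraction of all pairs because \<alpha> is less than 1, and
  every other loss is held to a small multiple of 1 - \<alpha>. A line with linearly many points
  already carries a positive proportion of all pairs, beyond what the incidence bound can discard as
  negligible, and this forces the separate treatment of a rich line.\<close>

text \<open>An edge is the pair of its end points, the left one first. Throughout, the point sets in the plane have
  distinct first coordinates, so edges are graphs of functions and no spanned line is vertical.\<close>

definition slope :: "(real \<times> real) \<times> (real \<times> real) \<Rightarrow> real" where
  "slope e = (snd (snd e) - snd (fst e)) / (fst (snd e) - fst (fst e))"

definition height :: "(real \<times> real) \<times> (real \<times> real) \<Rightarrow> real \<Rightarrow> real" where
  "height e x = snd (fst e) + slope e * (x - fst (fst e))"

definition over :: "(real \<times> real) \<times> (real \<times> real) \<Rightarrow> real \<Rightarrow> bool" where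
  "over e x \<longleftrightarrow> fst (fst e) < x \<and> x < fst (snd e)"

text \<open>Since \<open>over\<close> is strict, edges that share only an end point do not cross,
  whereas two overlapping edges on one line do.\<close>

definition crossing where
  "crossing e f \<longleftrightarrow> e \<noteq> f \<and> (\<exists>x. over e x \<and> over f x \<and> height e x = height f x)"

definition geom_graph where
  "geom_graph V E \<longleftrightarrow> finite V \<and> inj_on fst V \<and> E \<subseteq> V \<times> V \<and> (\<forall>e\<in>E. fst (fst e) < fst (snd e)) \<and>
    (\<forall>e\<in>E. \<forall>v\<in>V. over e (fst v) \<longrightarrow> snd v \<noteq> height e (fst v))"

lemma finite_has_max_by:
  fixes f :: "'a \<Rightarrow> 'b::linorder"
  assumes "finite S" "S \<noteq> {}"
  obtains x where "x \<in> S" "\<And>y. y \<in> S \<Longrightarrow> f y \<le> f x"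
proof -
  have "Max (f ` S) \<in> f ` S" using assms by simp
  then obtain x where "x \<in> S" "f x = Max (f ` S)" by auto
  then show ?thesis using that assms by (metis Max_ge finite_imageI imageI)
qed

lemma height_left: "height (a, b) (fst a) = snd a"
  by (simp add: height_def)

lemma height_right: "fst a < fst b \<Longrightarrow> height (a, b) (fst b) = snd b"
  by (simp add: height_def slope_def)

lemma height_diff: "height e y = height e x + slope e * (y - x)"
  by (simp add: height_def algebra_simps)

lemma height_meet:
  assumes "height e x < height f x" "height f y < height e y" "x < y"
  obtains z where "x < z" "z < y" "height e z = height f z"
proof -
  define d where "d = (\<lambda>z. height f z - height e z)"
  have "continuous_on {x..y} d"
    unfolding d_def height_def by (intro continuous_intros)
  then obtain z where z: "x \<le> z" "z \<le> y" "d z = 0"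
    using IVT2'[of d y 0 x] assms by (force simp: d_def)
  have "z \<noteq> x" "z \<noteq> y" using z assms by (auto simp: d_def)
  then have "x < z" "z < y" "height e z = height f z" using z by (auto simp: d_def)
  then show ?thesis by (rule that)
qed

lemma finite_geom_graph: "geom_graph V E \<Longrightarrow> finite E"
  unfolding geom_graph_def by (meson finite_SigmaI finite_subset)

text \<open>Edges of equal slope that leave the same point overlap next to it. Hence in a
  crossing-free graph the edges starting at a vertex are told apart by their slopes, and the topmost
  one is unique.\<close>

lemma crossing_same_left:
  assumes "a \<noteq> a' \<or> b \<noteq> b'" "slope (a, b) = slope (a', b')" "a = a'" "fst a < fst b" "fst a' < fst b'"
  shows "crossing (a, b) (a', b')"
proof -
  define x where "x = (fst a + min (fst b) (fst b')) / 2"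
  have "over (a, b) x" "over (a', b') x"
    using assms by (auto simp: over_def x_def min_def)
  then show ?thesis using assms unfolding crossing_def by (auto simp: height_def)
qed

lemma crossing_same_right:
  assumes "a \<noteq> a'" "slope (a, b) = slope (a', b)" "fst a < fst b" "fst a' < fst b"
  shows "crossing (a, b) (a', b)"
proof -
  define x where "x = (fst b + max (fst a) (fst a')) / 2"
  have o: "over (a, b) x" "over (a', b) x"
    using assms by (auto simp: over_def x_def max_def)
  have "height (a, b) x = height (a', b) x"
    using assms height_diff[of "(a,b)" x "fst b"] height_diff[of "(a',b)" x "fst b"]
    by (simp add: height_right)
  then show ?thesis using assms o unfolding crossing_def by auto
qed

text \<open>Take the lowest edge at \<open>b\<close> above \<open>(a, b)\<close>. Among the vertices in the wedge between these two edges, the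
  rightmost one sees \<open>(a, b)\<close> directly below it: an edge in between would have to end inside the wedge
  further to the right, or reach \<open>b\<close>.\<close>

lemma ex_vertex_just_above:
  assumes G: "geom_graph V E" and nc: "\<And>e f. e \<in> E \<Longrightarrow> f \<in> E \<Longrightarrow> \<not> crossing e f"
    and e: "(a, b) \<in> E"
    and f: "(a, c) \<in> E" "slope (a, b) < slope (a, c)"
    and g0: "(d0, b) \<in> E" "slope (d0, b) < slope (a, b)"
  shows "\<exists>v\<in>V. over (a, b) (fst v) \<and> height (a, b) (fst v) < snd v \<and>
     (\<forall>h\<in>E. over h (fst v) \<longrightarrow> height (a, b) (fst v) < height h (fst v) \<longrightarrow> snd v \<le> height h (fst v))"
proof -
  have finE: "finite E" using G by (rule finite_geom_graph)
  have inV: "u \<in> V" "v \<in> V" "fst u < fst v" if "(u, v) \<in> E" for u v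
    using G that unfolding geom_graph_def by auto
  have inj: "u = v" if "u \<in> V" "v \<in> V" "fst u = fst v" for u v
    using G that unfolding geom_graph_def by (auto dest: inj_onD)
  have nv: "snd v \<noteq> height h (fst v)" if "h \<in> E" "v \<in> V" "over h (fst v)" for h v
    using G that unfolding geom_graph_def by auto
  have nm: "height h x \<noteq> height k x" if "h \<in> E" "k \<in> E" "h \<noteq> k" "over h x" "over k x" for h k x
    using nc that unfolding crossing_def by blast
  \<comment> \<open>To the left of \<open>b\<close>, an edge ending at \<open>b\<close> with smaller
    slope runs above \<open>(a, b)\<close>; the lowest of these is the one of largest slope.\<close>
  define D where "D = {d. (d, b) \<in> E \<and> slope (d, b) < slope (a, b)}"
  have "finite D"
    by (rule finite_subset[of _ "fst ` E"]) (force simp: D_def finE)+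
  moreover have "D \<noteq> {}" using g0 unfolding D_def by blast
  ultimately obtain d where dD: "d \<in> D" and dmax: "\<And>d'. d' \<in> D \<Longrightarrow> slope (d', b) \<le> slope (d, b)"
    using finite_has_max_by[of D "\<lambda>d. slope (d, b)"] by blast
  have g: "(d, b) \<in> E" "slope (d, b) < slope (a, b)" using dD by (auto simp: D_def)
  have e_right: "height (a, b) (fst b) = snd b" using inV[OF e] by (simp add: height_right)
  have g_right: "height (d, b) (fst b) = snd b" using inV[OF g(1)] by (simp add: height_right)
  have ge: "height (a, b) x < height (d, b) x" if "x < fst b" for x
    using height_diff[of "(a,b)" x "fst b"] height_diff[of "(d,b)" x "fst b"] e_right g_right that g(2)
    by (smt (verit) mult_less_cancel_right)
  have fe: "height (a, b) x < height (a, c) x" if "fst a < x" for x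
    using that f(2) by (simp add: height_def)
  define S where "S = {v\<in>V. fst a < fst v \<and> fst v < fst b \<and> fst d \<le> fst v \<and>
      height (a, b) (fst v) < snd v \<and> snd v \<le> height (d, b) (fst v)}"
  \<comment> \<open>If \<open>d\<close> lies to the right of \<open>a\<close>, then \<open>d\<close>
    itself is in the wedge. Otherwise \<open>(d, b)\<close> passes above \<open>a\<close>, and the
    edge \<open>(a, c)\<close> starts inside the wedge and cannot leave it without a crossing, so
    \<open>c\<close> is in the wedge.\<close>
  have "S \<noteq> {}"
  proof (cases "fst a < fst d")
    case True
    then have "d \<in> S"
      using inV[OF g(1)] ge[of "fst d"] by (simp add: S_def height_left)
    then show ?thesis by auto
  next
    case False
    have "d \<noteq> a" using g(2) by auto
    then have da: "fst d < fst a"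
      using False inj[of d a] inV[OF g(1)] inV[OF e] by force
    have below_a: "height (a, c) (fst a) < height (d, b) (fst a)"
      using ge[of "fst a"] inV[OF e] by (simp add: height_left)
    have fg: "(a, c) \<noteq> (d, b)" using da by auto
    have cb: "fst c < fst b"
    proof (rule ccontr)
      assume "\<not> fst c < fst b"
      have "height (d, b) (fst b) < height (a, c) (fst b)"
        using fe[of "fst b"] inV[OF e] e_right g_right by simp
      then obtain z where z: "fst a < z" "z < fst b" "height (a, c) z = height (d, b) z"
        using below_a inV[OF e] height_meet by metis
      then show False
        using nm[OF f(1) g(1) fg, of z] \<open>\<not> fst c < fst b\<close> da by (auto simp: over_def)
    qed
    have "snd c \<le> height (d, b) (fst c)"
    proof (rule ccontr)
      assume "\<not> ?thesis"
      then have "height (d, b) (fst c) < height (a, c) (fst c)"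
        using inV[OF f(1)] by (simp add: height_right)
      then obtain z where z: "fst a < z" "z < fst c" "height (a, c) z = height (d, b) z"
        using below_a inV[OF f(1)] height_meet by metis
      then show False
        using nm[OF f(1) g(1) fg, of z] cb da by (auto simp: over_def)
    qed
    moreover have "height (a, b) (fst c) < snd c"
      using fe[of "fst c"] inV[OF f(1)] by (simp add: height_right)
    ultimately have "c \<in> S"
      using inV[OF f(1)] cb da by (simp add: S_def)
    then show ?thesis by auto
  qed
  moreover have "finite S" using G by (auto simp: S_def geom_graph_def)
  ultimately obtain v where v: "v \<in> S" and vmax: "\<And>w. w \<in> S \<Longrightarrow> fst w \<le> fst v"
    using finite_has_max_by[of S fst] by blast
  have vV: "v \<in> V" "fst a < fst v" "fst v < fst b" "fst d \<le> fst v"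
      "height (a, b) (fst v) < snd v" "snd v \<le> height (d, b) (fst v)"
    using v by (auto simp: S_def)
  have "snd v \<le> height h (fst v)"
    if h: "h \<in> E" "over h (fst v)" "height (a, b) (fst v) < height h (fst v)" for h
  proof (rule ccontr)
    assume "\<not> ?thesis"
    then have hg: "height h (fst v) < height (d, b) (fst v)" "height h (fst v) < snd v" using vV by auto
    obtain u w where uw: "h = (u, w)" by (cases h)
    have vw: "fst u < fst v" "fst v < fst w" using h(2) uw by (auto simp: over_def)
    have wV: "w \<in> V" using inV h(1) uw by auto
    have hw: "height h (fst w) = snd w" using uw vw by (simp add: height_right)
    have he: "h \<noteq> (a, b)" using h(3) by auto
    have hng: "h \<noteq> (d, b)" using hg by auto
    have not_e: False if y: "height h y < height (a, b) y" "fst v < y" "y \<le> fst w" "y \<le> fst b" for y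
    proof -
      obtain z where "fst v < z" "z < y" "height (a, b) z = height h z"
        using height_meet[OF h(3) y(1,2)] by blast
      then show False
        using nm[OF h(1) e he, of z] y vV vw uw by (auto simp: over_def)
    qed
    have not_g: False if y: "height (d, b) y < height h y" "fst v < y" "y \<le> fst w" "y \<le> fst b" for y
    proof -
      obtain z where "fst v < z" "z < y" "height h z = height (d, b) z"
        using height_meet[OF hg(1) y(1,2)] by blast
      then show False
        using nm[OF h(1) g(1) hng, of z] y vV vw uw by (auto simp: over_def)
    qed
    consider "fst w < fst b" | "w = b" | "fst w > fst b"
      using inj[OF wV, of b] inV[OF e] by force
    then show False
    proof cases
      case 1
      have "snd w \<noteq> height (a, b) (fst w)"
        using nv[OF e wV] 1 vw vV by (auto simp: over_def)
      then have "height (a, b) (fst w) < snd w"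
        using not_e[of "fst w"] 1 vw hw by force
      moreover have "snd w \<le> height (d, b) (fst w)"
        using not_g[of "fst w"] 1 vw hw by force
      ultimately have "w \<in> S" using wV 1 vw vV by (auto simp: S_def)
      then show False using vmax[of w] vw by simp
    next
      case 2
      have hb: "height h (fst b) = snd b" using hw 2 by simp
      have "slope h < slope (a, b)"
        using height_diff[of h "fst v" "fst b"] height_diff[of "(a,b)" "fst v" "fst b"] hb e_right h(3) vV
        by (smt (verit) mult_right_mono_neg)
      moreover have "slope (d, b) < slope h"
        using height_diff[of h "fst v" "fst b"] height_diff[of "(d,b)" "fst v" "fst b"] hb g_right hg vV
        by (smt (verit) mult_right_mono_neg)
      ultimately show False
        using dmax[of u] h(1) uw 2 by (auto simp: D_def)
    next
      \<comment> \<open>The two sides of the wedge meet at \<open>b\<close>, so an edge continuing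
        beyond \<open>b\<close> would cross one of them or pass through the vertex
        \<open>b\<close>.\<close>
      case 3
      have "snd b \<noteq> height h (fst b)"
        using nv[OF h(1), of b] inV[OF e] 3 vw vV uw by (auto simp: over_def)
      then show False
        using not_e[of "fst b"] not_g[of "fst b"] 3 vV e_right g_right by force
    qed
  qed
  then show ?thesis
    using vV by (intro bexI[of _ v]) (auto simp: over_def)
qed

text \<open>Each edge is charged to a vertex: it is the topmost edge at its left end point, or the topmost edge at its
  right end point, or the edge directly below some vertex. Every vertex is charged at most once in each way.\<close>

theorem noncrossing_card_le:
  assumes G: "geom_graph V E" and nc: "\<And>e f. e \<in> E \<Longrightarrow> f \<in> E \<Longrightarrow> \<not> crossing e f"
  shows "card E \<le> 3 * card V"
proof -
  have finE: "finite E" using G by (rule finite_geom_graph)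
  have finV: "finite V" using G by (auto simp: geom_graph_def)
  have inV: "u \<in> V" "v \<in> V" "fst u < fst v" if "(u, v) \<in> E" for u v
    using G that unfolding geom_graph_def by auto
  define E1 where "E1 = {e\<in>E. \<forall>f\<in>E. fst f = fst e \<longrightarrow> slope f \<le> slope e}"
  define E2 where "E2 = {e\<in>E. \<forall>f\<in>E. snd f = snd e \<longrightarrow> slope e \<le> slope f}"
  define above where "above = (\<lambda>e v. v \<in> V \<and> over e (fst v) \<and> height e (fst v) < snd v \<and>
     (\<forall>h\<in>E. over h (fst v) \<longrightarrow> height e (fst v) < height h (fst v) \<longrightarrow> snd v \<le> height h (fst v)))"
  define E3 where "E3 = {e\<in>E. \<exists>v. above e v}"
  have "E \<subseteq> E1 \<union> E2 \<union> E3"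
  proof
    fix e assume "e \<in> E"
    obtain a b where ab: "e = (a, b)" by (cases e)
    show "e \<in> E1 \<union> E2 \<union> E3"
    proof (rule ccontr)
      assume n: "e \<notin> E1 \<union> E2 \<union> E3"
      then obtain c where "(a, c) \<in> E" "slope (a, b) < slope (a, c)"
        using \<open>e \<in> E\<close> ab by (force simp: E1_def)
      moreover obtain d where "(d, b) \<in> E" "slope (d, b) < slope (a, b)"
        using n \<open>e \<in> E\<close> ab by (force simp: E2_def)
      ultimately have "\<exists>v. above e v"
        using ex_vertex_just_above[OF G nc, of a b c d] \<open>e \<in> E\<close> ab unfolding above_def by blast
      then show False using n \<open>e \<in> E\<close> by (auto simp: E3_def)
    qed
  qed
  then have "card E \<le> card (E1 \<union> E2 \<union> E3)"
    using finE by (intro card_mono) (auto simp: E1_def E2_def E3_def)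
  also have "\<dots> \<le> card E1 + card E2 + card E3"
    by (meson add_le_mono card_Un_le le_refl order_trans)
  also have "card E1 \<le> card V"
  proof (rule card_inj_on_le[of fst])
    show "inj_on fst E1"
    proof (rule inj_onI)
      fix e f assume ef: "e \<in> E1" "f \<in> E1" "fst e = fst f"
      then have "slope e = slope f" by (auto simp: E1_def intro: order_antisym)
      then show "e = f"
        using crossing_same_left[of "fst e" "fst f" "snd e" "snd f"] nc[of e f] ef inV
        by (metis (no_types, lifting) E1_def mem_Collect_eq prod.collapse)
    qed
  qed (use inV finV in \<open>auto simp: E1_def\<close>)
  also have "card E2 \<le> card V"
  proof (rule card_inj_on_le[of snd])
    show "inj_on snd E2"
    proof (rule inj_onI)
      fix e f assume ef: "e \<in> E2" "f \<in> E2" "snd e = snd f"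
      then have "slope e = slope f" by (auto simp: E2_def intro: order_antisym)
      then show "e = f"
        using crossing_same_right[of "fst e" "fst f" "snd e"] nc[of e f] ef inV
        by (metis (no_types, lifting) E2_def mem_Collect_eq prod.collapse)
    qed
  qed (use inV finV in \<open>auto simp: E2_def\<close>)
  also have "card E3 \<le> card V"
  proof (rule card_inj_on_le[of "\<lambda>e. SOME v. above e v"])
    have ab: "above e (SOME v. above e v)" if "e \<in> E3" for e
      using that by (auto simp: E3_def intro: someI)
    show "inj_on (\<lambda>e. SOME v. above e v) E3"
    proof (rule inj_onI)
      fix e f assume ef: "e \<in> E3" "f \<in> E3" and eq: "(SOME v. above e v) = (SOME v. above f v)"
      obtain v where v: "above e v" "above f v" using ab[OF ef(1)] ab[OF ef(2)] eq by auto
      have E: "e \<in> E" "f \<in> E" using ef by (auto simp: E3_def)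
      \<comment> \<open>If one of the two edges were higher at \<open>v\<close>, it would separate
        \<open>v\<close> from the other one.\<close>
      have "height e (fst v) = height f (fst v)"
        using v E unfolding above_def by (metis linorder_neqE_linordered_idom not_le)
      then show "e = f"
        using v nc[OF E] unfolding above_def crossing_def by blast
    qed
    show "(\<lambda>e. SOME v. above e v) ` E3 \<subseteq> V"
      using ab by (auto simp: above_def)
  qed (use finV in auto)
  finally show ?thesis by simp
qed

section \<open>Random sampling of vertices\<close>

text \<open>The left side is the probability that a random subset of \<open>V\<close>, with every
  element kept independently with probability \<open>p\<close>, contains \<open>T\<close>. It arises
  by expanding a product in which the elements outside \<open>T\<close> contribute the factor
  \<open>p + (1 - p)\<close>.\<close>

lemma sum_subset_weights:
  fixes p :: real
  assumes "finite V" "T \<subseteq> V"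
  shows "(\<Sum>S\<in>Pow V. if T \<subseteq> S then p ^ card S * (1 - p) ^ card (V - S) else 0) = p ^ card T"
proof -
  have "p ^ card T = (\<Prod>x\<in>V. if x \<in> T then p else 1)"
    using assms by (simp add: prod.If_cases Int_absorb1)
  also have "\<dots> = (\<Prod>x\<in>V. p + (if x \<in> T then 0 else 1 - p))"
    by (rule prod.cong) auto
  also have "\<dots> = (\<Sum>S\<in>Pow V. (\<Prod>x\<in>S. p) * (\<Prod>x\<in>V - S. if x \<in> T then 0 else 1 - p))"
    using assms(1) by (rule prod_add)
  also have "\<dots> = (\<Sum>S\<in>Pow V. if T \<subseteq> S then p ^ card S * (1 - p) ^ card (V - S) else 0)"
  proof (rule sum.cong)
    fix S assume S: "S \<in> Pow V"
    have fin: "finite (V - S)" using assms by auto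
    show "(\<Prod>x\<in>S. p) * (\<Prod>x\<in>V - S. if x \<in> T then 0 else 1 - p) =
      (if T \<subseteq> S then p ^ card S * (1 - p) ^ card (V - S) else 0)"
    proof (cases "T \<subseteq> S")
      case True
      then have "(\<Prod>x\<in>V - S. if x \<in> T then 0 else 1 - p) = (\<Prod>x\<in>V - S. 1 - p)"
        by (intro prod.cong) auto
      then show ?thesis using True by simp
    next
      case False
      then have "\<exists>x\<in>V - S. (if x \<in> T then 0 else 1 - p) = 0" using assms(2) by auto
      then show ?thesis using False fin by (auto simp: prod_zero_iff)
    qed
  qed simp
  finally show ?thesis by simp
qed

text \<open>Linearity of expectation: every \<open>x\<close> survives, that is, has
  \<open>t x\<close> inside the sample, with probability \<open>p ^ k\<close>.\<close>

lemma sum_sampled_card: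
  fixes p :: real
  assumes V: "finite V" and A: "finite A" and t: "\<And>x. x \<in> A \<Longrightarrow> t x \<subseteq> V \<and> card (t x) = k"
  shows "(\<Sum>S\<in>Pow V. p ^ card S * (1 - p) ^ card (V - S) * real (card {x\<in>A. t x \<subseteq> S})) =
    real (card A) * p ^ k"
proof -
  have "(\<Sum>S\<in>Pow V. p ^ card S * (1 - p) ^ card (V - S) * real (card {x\<in>A. t x \<subseteq> S})) =
     (\<Sum>S\<in>Pow V. \<Sum>x\<in>A. if t x \<subseteq> S then p ^ card S * (1 - p) ^ card (V - S) else 0)"
  proof (rule sum.cong)
    fix S
    have "real (card {x\<in>A. t x \<subseteq> S}) = (\<Sum>x\<in>A. if t x \<subseteq> S then 1 else 0)"
      using A by (simp add: sum.If_cases Int_def)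
    then show "p ^ card S * (1 - p) ^ card (V - S) * real (card {x\<in>A. t x \<subseteq> S}) =
      (\<Sum>x\<in>A. if t x \<subseteq> S then p ^ card S * (1 - p) ^ card (V - S) else 0)"
      by (simp add: sum_distrib_left if_distrib cong: if_cong)
  qed simp
  also have "\<dots> = (\<Sum>x\<in>A. \<Sum>S\<in>Pow V. if t x \<subseteq> S then p ^ card S * (1 - p) ^ card (V - S) else 0)"
    by (rule sum.swap)
  also have "\<dots> = (\<Sum>x\<in>A. p ^ k)"
    using V t by (intro sum.cong) (auto simp: sum_subset_weights)
  finally show ?thesis by simp
qed

lemma geom_graph_subset:
  assumes "geom_graph V E" "S \<subseteq> V" "F \<subseteq> E" "F \<subseteq> S \<times> S"
  shows "geom_graph S F"
  using assms unfolding geom_graph_def by (blast intro: finite_subset inj_on_subset)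

text \<open>Removing every edge that takes part in a crossing leaves a crossing-free graph.
  Crossings are counted as ordered pairs, so the number of removed edges is at most the number of
  crossings.\<close>

lemma card_edges_le_crossings:
  assumes G: "geom_graph V E"
  shows "card E \<le> 3 * card V + card {(e, f) \<in> E \<times> E. crossing e f}"
proof -
  have finE: "finite E" using G by (rule finite_geom_graph)
  define X where "X = {(e, f) \<in> E \<times> E. crossing e f}"
  have finX: "finite X" unfolding X_def by (rule finite_subset[of _ "E \<times> E"]) (use finE in auto)
  have "geom_graph V (E - fst ` X)"
    using G by (rule geom_graph_subset) (use G in \<open>auto simp: geom_graph_def\<close>)
  then have "card (E - fst ` X) \<le> 3 * card V"
    by (rule noncrossing_card_le) (force simp: X_def)
  moreover have "card E \<le> card (E - fst ` X) + card (fst ` X)"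
    using card_mono[of "(E - fst ` X) \<union> fst ` X" E] card_Un_le[of "E - fst ` X" "fst ` X"] finE finX
    by force
  moreover have "card (fst ` X) \<le> card X" using finX by (rule card_image_le)
  ultimately show ?thesis unfolding X_def by linarith
qed

text \<open>Needed so that a crossing survives the sampling with probability exactly
  \<open>p ^ 4\<close>. Edges of equal slope that meet lie on one line, and then either an end point
  of one is interior to the other or the edges coincide; edges of different slopes with a common
  left or right end meet only there.\<close>

lemma crossing_vertices_distinct:
  assumes G: "geom_graph V E" and E: "(a, b) \<in> E" "(c, d) \<in> E" and cr: "crossing (a, b) (c, d)"
  shows "card {a, b, c, d} = 4"
proof -
  have V: "a \<in> V" "b \<in> V" "c \<in> V" "d \<in> V" "fst a < fst b" "fst c < fst d"
    using G E unfolding geom_graph_def by auto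
  have nv: "snd v \<noteq> height h (fst v)" if "h \<in> E" "v \<in> V" "over h (fst v)" for h v
    using G that unfolding geom_graph_def by auto
  have inj: "u = v" if "u \<in> V" "v \<in> V" "fst u = fst v" for u v
    using G that unfolding geom_graph_def by (auto dest: inj_onD)
  obtain x where x: "over (a, b) x" "over (c, d) x" "height (a, b) x = height (c, d) x" and ne: "(a, b) \<noteq> (c, d)"
    using cr unfolding crossing_def by blast
  have same: "slope (a, b) = slope (c, d) \<Longrightarrow> False"
  proof -
    assume s: "slope (a, b) = slope (c, d)"
    then have h: "height (a, b) y = height (c, d) y" for y
      using height_diff[of "(a,b)" y x] height_diff[of "(c,d)" y x] x(3) by simp
    have "\<not> over (a, b) (fst c)" "\<not> over (c, d) (fst a)"
      using nv[OF E(1) V(3)] nv[OF E(2) V(1)] h[of "fst a"] h[of "fst c"] height_left[of a b] height_left[of c d]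
      by auto
    moreover have "\<not> over (a, b) (fst d)" "\<not> over (c, d) (fst b)"
      using nv[OF E(1) V(4)] nv[OF E(2) V(2)] h[of "fst b"] h[of "fst d"] height_right[of a b] height_right[of c d] V
      by auto
    ultimately have "fst a = fst c" "fst b = fst d"
      using x V unfolding over_def by auto
    then show False using inj V ne by blast
  qed
  have "a \<noteq> c"
  proof
    assume "a = c"
    then have "slope (a, b) * (x - fst a) = slope (c, d) * (x - fst a)"
      using x(3) by (simp add: height_def)
    then show False using same x(1) by (auto simp: over_def)
  qed
  moreover have "b \<noteq> d"
  proof
    assume "b = d"
    then have "slope (a, b) * (fst b - x) = slope (c, d) * (fst b - x)"
      using x(3) V height_diff[of "(a,b)" "fst b" x] height_diff[of "(c,d)" "fst b" x]
      by (simp add: height_right)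
    then show False using same x(1) by (auto simp: over_def)
  qed
  moreover have "a \<noteq> b" "c \<noteq> d" "a \<noteq> d" "b \<noteq> c" using V x by (auto simp: over_def)
  ultimately show ?thesis by (simp add: card_insert_if)
qed

text \<open>Keep every vertex independently with probability \<open>p = 6 |V| / |E|\<close>: an edge survives with probability
  \<open>p\<^sup>2\<close>, a crossing with probability \<open>p\<^sup>4\<close>.\<close>

theorem crossing_lemma:
  assumes G: "geom_graph V E" and e: "6 * card V \<le> card E" and pos: "E \<noteq> {}"
  shows "real (card E) ^ 3 \<le> 72 * (real (card V))\<^sup>2 * real (card {(e, f) \<in> E \<times> E. crossing e f})"
proof -
  have finE: "finite E" using G by (rule finite_geom_graph)
  have finV: "finite V" using G by (auto simp: geom_graph_def)
  define X where "X = {(e, f) \<in> E \<times> E. crossing e f}"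
  have finX: "finite X" unfolding X_def by (rule finite_subset[of _ "E \<times> E"]) (use finE in auto)
  define ends where "ends = (\<lambda>e :: (real \<times> real) \<times> (real \<times> real). {fst e, snd e})"
  define ends2 where "ends2 = (\<lambda>(e, f). ends e \<union> ends f)"
  have e_pos: "0 < real (card E)" using pos finE by (simp add: card_gt_0_iff)
  have "V \<noteq> {}" using pos G by (auto simp: geom_graph_def)
  then have v_pos: "0 < real (card V)" using finV by (simp add: card_gt_0_iff)
  define p where "p = 6 * real (card V) / real (card E)"
  have p: "0 < p" "p \<le> 1" using e e_pos v_pos by (auto simp: p_def field_simps)
  define w where "w = (\<lambda>S. p ^ card S * (1 - p) ^ card (V - S))"
  have w: "0 \<le> w S" for S using p by (simp add: w_def)
  have sample: "real (card {e\<in>E. ends e \<subseteq> S}) \<le>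
      3 * real (card {v\<in>V. {v} \<subseteq> S}) + real (card {x\<in>X. ends2 x \<subseteq> S})" if "S \<in> Pow V" for S
  proof -
    have "geom_graph S {e\<in>E. ends e \<subseteq> S}"
      using G by (rule geom_graph_subset) (use that in \<open>auto simp: ends_def\<close>)
    from card_edges_le_crossings[OF this]
    have "card {e\<in>E. ends e \<subseteq> S} \<le> 3 * card S +
        card {(e', f). (e', f) \<in> {e\<in>E. ends e \<subseteq> S} \<times> {e\<in>E. ends e \<subseteq> S} \<and> crossing e' f}" .
    also have "{(e', f). (e', f) \<in> {e\<in>E. ends e \<subseteq> S} \<times> {e\<in>E. ends e \<subseteq> S} \<and> crossing e' f}
        = {x\<in>X. ends2 x \<subseteq> S}"
      by (auto simp: X_def ends2_def)
    finally have "card {e\<in>E. ends e \<subseteq> S} \<le> 3 * card S + card {x\<in>X. ends2 x \<subseteq> S}" .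
    moreover have "{v\<in>V. {v} \<subseteq> S} = S" using that by auto
    ultimately show ?thesis by simp
  qed
  have "(\<Sum>S\<in>Pow V. w S * real (card {e\<in>E. ends e \<subseteq> S})) \<le>
      (\<Sum>S\<in>Pow V. w S * (3 * real (card {v\<in>V. {v} \<subseteq> S}) + real (card {x\<in>X. ends2 x \<subseteq> S})))"
    using sample w by (intro sum_mono mult_left_mono) auto
  also have "\<dots> = 3 * (\<Sum>S\<in>Pow V. w S * real (card {v\<in>V. {v} \<subseteq> S})) +
      (\<Sum>S\<in>Pow V. w S * real (card {x\<in>X. ends2 x \<subseteq> S}))"
    by (simp add: sum.distrib sum_distrib_left algebra_simps)
  also have "(\<Sum>S\<in>Pow V. w S * real (card {v\<in>V. {v} \<subseteq> S})) = real (card V) * p ^ 1"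
    unfolding w_def by (rule sum_sampled_card) (use finV in auto)
  also have "(\<Sum>S\<in>Pow V. w S * real (card {x\<in>X. ends2 x \<subseteq> S})) = real (card X) * p ^ 4"
    unfolding w_def
  proof (rule sum_sampled_card)
    fix x assume "x \<in> X"
    then obtain a b c d where x: "x = ((a, b), (c, d))" "(a, b) \<in> E" "(c, d) \<in> E" "crossing (a, b) (c, d)"
      unfolding X_def by (cases x) auto
    have "ends2 x = {a, b, c, d}" using x(1) by (auto simp: ends2_def ends_def)
    moreover have "{a, b, c, d} \<subseteq> V" using G x(2,3) unfolding geom_graph_def by auto
    ultimately show "ends2 x \<subseteq> V \<and> card (ends2 x) = 4"
      using crossing_vertices_distinct[OF G x(2-4)] by simp
  qed (use finV finX in auto)
  also have "(\<Sum>S\<in>Pow V. w S * real (card {e\<in>E. ends e \<subseteq> S})) = real (card E) * p ^ 2"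
    unfolding w_def
  proof (rule sum_sampled_card)
    fix x assume "x \<in> E"
    moreover obtain a b where "x = (a, b)" by (cases x)
    ultimately show "ends x \<subseteq> V \<and> card (ends x) = 2"
      using G unfolding geom_graph_def ends_def by (auto simp: card_insert_if)
  qed (use finV finE in auto)
  finally have "p * (real (card E) * p) \<le> p * (3 * real (card V) + real (card X) * p ^ 3)"
    by (simp add: distrib_left mult_ac power2_eq_square power3_eq_cube power4_eq_xxxx)
  then have "real (card E) * p \<le> 3 * real (card V) + real (card X) * p ^ 3"
    using p(1) by simp
  \<comment> \<open>The value of \<open>p\<close> makes \<open>real (card E) * p\<close> equal to
    \<open>6 * real (card V)\<close>, twice the vertex term, so half of it must be paid for by
    crossings. The constant 72 is 216 / 3, with 216 the cube of 6.\<close>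
  then have "3 * real (card V) \<le> real (card X) * p ^ 3"
    using e_pos by (simp add: p_def)
  also have "p ^ 3 = 216 * real (card V) ^ 3 / real (card E) ^ 3"
    by (simp add: p_def power_divide power_mult_distrib)
  finally have "3 * real (card V) * real (card E) ^ 3 \<le> real (card X) * (216 * real (card V) ^ 3)"
    using e_pos by (simp add: field_simps)
  then have "real (card V) * (3 * real (card E) ^ 3) \<le> real (card V) * (216 * (real (card V))\<^sup>2 * real (card X))"
    by (simp add: mult_ac power2_eq_square power3_eq_cube)
  then show ?thesis using v_pos unfolding X_def by simp
qed

section \<open>Rich lines in the plane\<close>

text \<open>The pair \<open>(s, t)\<close> encodes the line \<open>y = s x + t\<close>.\<close>

definition on_line :: "real \<times> real \<Rightarrow> real \<times> real \<Rightarrow> bool" where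
  "on_line l v \<longleftrightarrow> snd v = fst l * fst v + snd l"

lemma on_line_unique:
  assumes "on_line l u" "on_line l v" "on_line m u" "on_line m v" "fst u \<noteq> fst v"
  shows "l = m"
proof -
  have "fst l * (fst u - fst v) = fst m * (fst u - fst v)"
    using assms unfolding on_line_def by (simp add: algebra_simps)
  then have "fst l = fst m" using assms by simp
  then show ?thesis using assms unfolding on_line_def by (intro prod_eqI) auto
qed

lemma height_on_line:
  assumes "on_line l a" "on_line l b" "fst a < fst b"
  shows "height (a, b) x = fst l * x + snd l"
proof -
  have "snd b - snd a = fst l * (fst b - fst a)"
    using assms by (simp add: on_line_def algebra_simps)
  then have "slope (a, b) = fst l" using assms by (simp add: slope_def)
  then show ?thesis using assms by (simp add: height_def on_line_def algebra_simps)
qed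

text \<open>The segments between consecutive points of \<open>V\<close> on the line, as in Szekely's
  proof of the Szemeredi--Trotter theorem. Taking only consecutive points keeps vertices out of the
  interior of edges and prevents overlaps within a line.\<close>

definition line_edges where
  "line_edges V l = {(a, b) \<in> V \<times> V. fst a < fst b \<and> on_line l a \<and> on_line l b \<and>
      (\<forall>v\<in>V. on_line l v \<longrightarrow> \<not> (fst a < fst v \<and> fst v < fst b))}"

text \<open>Every point of the line other than the rightmost one is the left end of an edge.\<close>

lemma card_line_edges:
  assumes V: "finite V" "inj_on fst V"
  shows "card {v\<in>V. on_line l v} \<le> card (line_edges V l) + 1"
proof (cases "{v\<in>V. on_line l v} = {}")
  case False
  define W where "W = {v\<in>V. on_line l v}"
  have W: "finite W" "W \<noteq> {}" using False V by (auto simp: W_def)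
  then obtain m where m: "m \<in> W" "\<And>w. w \<in> W \<Longrightarrow> fst w \<le> fst m"
    using finite_has_max_by[of W fst] by blast
  have fin: "finite (line_edges V l)"
    by (rule finite_subset[of _ "V \<times> V"]) (use V in \<open>auto simp: line_edges_def\<close>)
  have "W - {m} \<subseteq> fst ` line_edges V l"
  proof
    fix u assume u: "u \<in> W - {m}"
    have "fst u \<noteq> fst m" using u m V(2) by (auto simp: W_def dest: inj_onD)
    then have "fst u < fst m" using u m(2)[of u] by simp
    then have "{w\<in>W. fst u < fst w} \<noteq> {}" using m(1) by blast
    moreover have "finite {w\<in>W. fst u < fst w}" using W(1) by simp
    ultimately obtain b where b: "b \<in> {w\<in>W. fst u < fst w}"
        "\<And>w. w \<in> {w\<in>W. fst u < fst w} \<Longrightarrow> - fst w \<le> - fst b"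
      using finite_has_max_by[of "{w\<in>W. fst u < fst w}" "\<lambda>w. - fst w"] by blast
    have "\<not> (fst u < fst v \<and> fst v < fst b)" if "v \<in> W" for v
      using b(2)[of v] that by auto
    then have "(u, b) \<in> line_edges V l"
      using u b(1) by (auto simp: line_edges_def W_def)
    then show "u \<in> fst ` line_edges V l" by force
  qed
  then have "card (W - {m}) \<le> card (line_edges V l)"
    using fin surj_card_le by blast
  then show ?thesis using m(1) W(1) unfolding W_def by (simp add: card_Diff_singleton)
next
  case True
  then show ?thesis by (simp only: card.empty)
qed

text \<open>Every line contributes at least \<open>j - 1\<close>, hence at least
  \<open>j / 2\<close>, edges, and two lines cross at most once, so there are at most
  \<open>(card L)\<^sup>2\<close> ordered crossings. If the second summand does not suffice, the
  edges number at least \<open>6 * card V\<close>, and the crossing lemma bounds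
  \<open>(card L * j / 2) ^ 3\<close> by \<open>72 * (card V)\<^sup>2 * (card L)\<^sup>2\<close>.
  Thus 576 is 8 times 72 and 12 is 2 times 6.\<close>

theorem card_rich_lines_le:
  assumes V: "finite V" "inj_on fst V" and L: "finite L" and j: "2 \<le> j"
    and rich: "\<And>l. l \<in> L \<Longrightarrow> j \<le> card {v\<in>V. on_line l v}"
  shows "real (card L) \<le> 576 * (real (card V))\<^sup>2 / real j ^ 3 + 12 * real (card V) / real j"
proof (cases "real (card L) \<le> 12 * real (card V) / real j")
  case True
  then show ?thesis by (simp add: add_increasing)
next
  case big: False
  define E where "E = (\<Union>l\<in>L. line_edges V l)"
  have fin: "finite (line_edges V l)" for l
    by (rule finite_subset[of _ "V \<times> V"]) (use V in \<open>auto simp: line_edges_def\<close>)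
  have uniq: "l = m" if "e \<in> line_edges V l" "e \<in> line_edges V m" for e l m
    using that on_line_unique[of l "fst e" "snd e" m] by (auto simp: line_edges_def)
  have "card E = (\<Sum>l\<in>L. card (line_edges V l))"
    unfolding E_def by (rule card_UN_disjoint) (use L fin uniq in blast)+
  moreover have "real j / 2 \<le> real (card (line_edges V l))" if "l \<in> L" for l
    using card_line_edges[OF V, of l] rich[OF that] j by linarith
  ultimately have E_ge: "real (card L) * (real j / 2) \<le> real (card E)"
    using sum_bounded_below[of L "real j / 2" "\<lambda>l. real (card (line_edges V l))"] by simp
  have G: "geom_graph V E"
    unfolding geom_graph_def
  proof (intro conjI ballI impI)
    fix e v assume "e \<in> E" "v \<in> V" "over e (fst v)"
    then obtain l a b where l: "e = (a, b)" "(a, b) \<in> line_edges V l" by (cases e) (auto simp: E_def)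
    then have "height e (fst v) = fst l * fst v + snd l"
      by (simp add: line_edges_def height_on_line)
    then show "snd v \<noteq> height e (fst v)"
      using l \<open>v \<in> V\<close> \<open>over e (fst v)\<close> by (auto simp: line_edges_def on_line_def over_def)
  qed (use V in \<open>auto simp: E_def line_edges_def\<close>)
  define X where "X = {(e, f) \<in> E \<times> E. crossing e f}"
  define line where "line = (\<lambda>e. SOME l. l \<in> L \<and> e \<in> line_edges V l)"
  have line: "line e \<in> L \<and> e \<in> line_edges V (line e)" if "e \<in> E" for e
  proof -
    obtain l where "l \<in> L \<and> e \<in> line_edges V l" using \<open>e \<in> E\<close> unfolding E_def by auto
    then show ?thesis unfolding line_def by (rule someI)
  qed
  have same_line: "e = f" if "e \<in> line_edges V l" "f \<in> line_edges V l" "over e x" "over f x" for e f l x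
  proof -
    obtain a b c d where ab: "e = (a, b)" "f = (c, d)" by (cases e, cases f) auto
    have "\<not> (fst a < fst c \<and> fst c < fst b)" "\<not> (fst a < fst d \<and> fst d < fst b)"
       "\<not> (fst c < fst a \<and> fst a < fst d)" "\<not> (fst c < fst b \<and> fst b < fst d)"
      using that unfolding ab line_edges_def by auto
    moreover have "fst a < x" "x < fst b" "fst c < x" "x < fst d"
      using that unfolding ab over_def by auto
    ultimately have "fst a = fst c" "fst b = fst d" by auto
    moreover have "a \<in> V" "b \<in> V" "c \<in> V" "d \<in> V" using that unfolding ab line_edges_def by auto
    ultimately show ?thesis using V(2) ab by (auto dest: inj_onD)
  qed
  have ht: "height e x = fst (line e) * x + snd (line e)" if "e \<in> E" for e x
    using line[OF that] height_on_line[of "line e" "fst e" "snd e"] by (auto simp: line_edges_def)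
  have cr: "\<exists>x. over e x \<and> over f x \<and> fst (line e) * x + snd (line e) = fst (line f) * x + snd (line f)
       \<and> line e \<noteq> line f" if "(e, f) \<in> X" for e f
  proof -
    obtain x where x: "over e x" "over f x" "height e x = height f x" "e \<noteq> f" "e \<in> E" "f \<in> E"
      using \<open>(e, f) \<in> X\<close> by (auto simp: X_def crossing_def)
    have "line e \<noteq> line f"
      using same_line[of e "line e" f x] line[OF x(5)] line[OF x(6)] x(1,2,4) by metis
    then show ?thesis
      using x(1-3) ht[OF x(5), of x] ht[OF x(6), of x] by auto
  qed
  \<comment> \<open>The two lines of a crossing determine its abscissa, and at that abscissa each
    line has only one edge.\<close>
  have "card X \<le> card (L \<times> L)"
  proof (rule card_inj_on_le)
    show "inj_on (\<lambda>(e, f). (line e, line f)) X"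
    proof (rule inj_onI, clarify)
      fix e f e' f' assume X: "(e, f) \<in> X" "(e', f') \<in> X" and eq: "line e = line e'" "line f = line f'"
      obtain x where x: "over e x" "over f x" "fst (line e) * x + snd (line e) = fst (line f) * x + snd (line f)"
        and ne: "line e \<noteq> line f" using cr[OF X(1)] by blast
      obtain x' where x': "over e' x'" "over f' x'" "fst (line e) * x' + snd (line e) = fst (line f) * x' + snd (line f)"
        using cr[OF X(2)] eq by auto
      have "fst (line e) * (x - x') = fst (line f) * (x - x')"
        using x(3) x'(3) by (simp add: algebra_simps)
      then have xx: "x = x'" using ne x(3) by (auto intro: prod_eqI)
      have E: "e \<in> E" "f \<in> E" "e' \<in> E" "f' \<in> E" using X unfolding X_def by blast+
      have "e = e'"
        using same_line[of e "line e" e' x] line[OF E(1)] line[OF E(3)] x(1) x'(1) xx eq(1) by metis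
      moreover have "f = f'"
        using same_line[of f "line f" f' x] line[OF E(2)] line[OF E(4)] x(2) x'(2) xx eq(2) by metis
      ultimately show "e = e' \<and> f = f'" by blast
    qed
    show "(\<lambda>(e, f). (line e, line f)) ` X \<subseteq> L \<times> L" using line by (auto simp: X_def)
  qed (use L in simp)
  then have X_le: "real (card X) \<le> (real (card L))\<^sup>2"
    by (simp add: card_cartesian_product power2_eq_square flip: of_nat_mult)
  have jpos: "0 < real j" using j by simp
  have L_big: "12 * real (card V) < real (card L) * real j"
    using big jpos by (simp add: field_simps)
  then have "6 * card V \<le> card E" using E_ge by linarith
  moreover have "E \<noteq> {}" using L_big E_ge by auto
  ultimately have "real (card E) ^ 3 \<le> 72 * (real (card V))\<^sup>2 * real (card X)"
    using crossing_lemma[OF G] unfolding X_def by blast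
  also have "\<dots> \<le> 72 * (real (card V))\<^sup>2 * (real (card L))\<^sup>2"
    using X_le by (intro mult_left_mono) auto
  finally have "real (card E) ^ 3 \<le> 72 * (real (card V))\<^sup>2 * (real (card L))\<^sup>2" .
  moreover have "(real (card L) * (real j / 2)) ^ 3 \<le> real (card E) ^ 3"
    by (rule power_mono[OF E_ge]) simp
  ultimately have "8 * (real (card L) * (real j / 2)) ^ 3 \<le> 8 * (72 * (real (card V))\<^sup>2 * (real (card L))\<^sup>2)"
    by (simp only: mult_left_mono)
  moreover have "8 * (real (card L) * (real j / 2)) ^ 3 = (real (card L))\<^sup>2 * (real (card L) * real j ^ 3)"
    by (simp add: power_mult_distrib power_divide power2_eq_square power3_eq_cube)
  moreover have "8 * (72 * (real (card V))\<^sup>2 * (real (card L))\<^sup>2) = (real (card L))\<^sup>2 * (576 * (real (card V))\<^sup>2)"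
    by simp
  ultimately have "(real (card L))\<^sup>2 * (real (card L) * real j ^ 3) \<le> (real (card L))\<^sup>2 * (576 * (real (card V))\<^sup>2)"
    by metis
  moreover have "0 < real (card L)" using L_big by (cases "card L = 0") auto
  ultimately have "real (card L) * real j ^ 3 \<le> 576 * (real (card V))\<^sup>2" by simp
  then have "real (card L) \<le> 576 * (real (card V))\<^sup>2 / real j ^ 3" using jpos by (simp add: field_simps)
  then show ?thesis by (simp add: add_increasing2)
qed

section \<open>Pairs of points on lines of medium richness\<close>

text \<open>Vanishing of the determinant of \<open>v - u\<close> and \<open>w - u\<close>. A
  polynomial condition transfers well under projections; it holds for every \<open>w\<close> when
  \<open>u = v\<close>, so distinctness of \<open>u\<close> and \<open>v\<close> is recorded
  separately where it matters.\<close>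

definition pcoll :: "real \<times> real \<Rightarrow> real \<times> real \<Rightarrow> real \<times> real \<Rightarrow> bool" where
  "pcoll u v w \<longleftrightarrow> (fst v - fst u) * (snd w - snd u) = (fst w - fst u) * (snd v - snd u)"

definition line_through :: "real \<times> real \<Rightarrow> real \<times> real \<Rightarrow> real \<times> real" where
  "line_through u v = (slope (u, v), snd u - slope (u, v) * fst u)"

lemma on_line_through:
  assumes "fst u \<noteq> fst v"
  shows "on_line (line_through u v) w \<longleftrightarrow> pcoll u v w"
proof -
  define s where "s = slope (u, v)"
  have d: "fst v - fst u \<noteq> 0" using assms by simp
  have s: "s * (fst v - fst u) = snd v - snd u" using assms by (simp add: s_def slope_def)
  have "on_line (line_through u v) w \<longleftrightarrow> snd w - snd u = s * (fst w - fst u)"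
    by (auto simp: on_line_def line_through_def s_def[symmetric] algebra_simps)
  also have "\<dots> \<longleftrightarrow> (fst v - fst u) * (snd w - snd u) = (fst v - fst u) * (s * (fst w - fst u))"
    using d by simp
  also have "(fst v - fst u) * (s * (fst w - fst u)) = (fst w - fst u) * (snd v - snd u)"
    using s by (simp add: mult.commute mult.left_commute)
  finally show ?thesis by (simp add: pcoll_def)
qed

lemma sum_telescope_inverse:
  assumes "1 \<le> k" "k \<le> m"
  shows "(\<Sum>j\<in>{k<..m}. 1 / (real j)\<^sup>2) \<le> 1 / real k - 1 / real m"
  using assms(2)
proof (induction m rule: dec_induct)
  case (step m)
  have "{k<..Suc m} = insert (Suc m) {k<..m}" using step by auto
  then have "(\<Sum>j\<in>{k<..Suc m}. 1 / (real j)\<^sup>2) = 1 / (real (Suc m))\<^sup>2 + (\<Sum>j\<in>{k<..m}. 1 / (real j)\<^sup>2)"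
    by simp
  also have "\<dots> \<le> 1 / (real (Suc m))\<^sup>2 + (1 / real k - 1 / real m)" using step by simp
  also have "1 / (real (Suc m))\<^sup>2 \<le> 1 / real m - 1 / real (Suc m)"
  proof -
    have m: "0 < real m" using step assms by simp
    have "1 / real m - 1 / real (Suc m) = 1 / (real m * real (Suc m))" using m by (simp add: field_simps)
    moreover have "real m * real (Suc m) \<le> (real (Suc m))\<^sup>2" by (simp add: power2_eq_square)
    ultimately show ?thesis using m by (simp add: frac_le)
  qed
  finally show ?case by simp
qed simp

text \<open>Each square satisfies \<open>(c l)\<^sup>2 \<le> c l * (c l + 1)\<close>, and the right
  side is the sum of \<open>2 * j\<close> over all \<open>j\<close> up to \<open>c l\<close>; then
  the summations are exchanged.\<close>

lemma sum_squares_by_levels: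
  fixes c :: "'a \<Rightarrow> nat"
  assumes "finite L" "\<And>l. l \<in> L \<Longrightarrow> c l \<le> m"
  shows "(\<Sum>l\<in>L. (c l)\<^sup>2) \<le> (\<Sum>j\<in>{1..m}. 2 * j * card {l\<in>L. j \<le> c l})"
proof -
  have "(c l)\<^sup>2 \<le> (\<Sum>j\<in>{1..m}. if j \<le> c l then 2 * j else 0)" if "l \<in> L" for l
  proof -
    have "(\<Sum>j\<in>{1..m}. if j \<le> c l then 2 * j else 0) = (\<Sum>j\<in>{1..c l}. 2 * j)"
      using assms(2)[OF that] by (intro sum.mono_neutral_cong_right) auto
    also have "\<dots> = c l * (c l + 1)"
    proof -
      have "(\<Sum>j\<in>{1..n}. 2 * j) = n * (n + 1)" for n :: nat by (induction n) auto
      then show ?thesis .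
    qed
    finally show ?thesis by (simp add: power2_eq_square)
  qed
  then have "(\<Sum>l\<in>L. (c l)\<^sup>2) \<le> (\<Sum>l\<in>L. \<Sum>j\<in>{1..m}. if j \<le> c l then 2 * j else 0)"
    by (rule sum_mono)
  also have "\<dots> = (\<Sum>j\<in>{1..m}. \<Sum>l\<in>L. if j \<le> c l then 2 * j else 0)" by (rule sum.swap)
  also have "\<dots> = (\<Sum>j\<in>{1..m}. 2 * j * card {l\<in>L. j \<le> c l})"
    using assms(1) by (intro sum.cong) (auto simp: sum.If_cases Int_def)
  finally show ?thesis .
qed

text \<open>A line with \<open>c\<close> points accounts for at most \<open>c\<^sup>2\<close> pairs.
  Summing the bound for \<open>j\<close>-rich lines against \<open>2 * j\<close>, the cubic term
  leaves a tail of the sum of \<open>1 / j\<^sup>2\<close>, of size \<open>1 / k\<close>, and the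
  linear term contributes a constant multiple of \<open>card V\<close> for each of at most
  \<open>D\<close> levels.\<close>

theorem card_medium_pairs_le:
  fixes D :: real
  assumes V: "finite V" "inj_on fst V" and k: "2 \<le> k" and D: "0 \<le> D"
  shows "real (card {(u, v) \<in> V \<times> V. u \<noteq> v \<and> k \<le> card {w\<in>V. pcoll u v w} \<and> real (card {w\<in>V. pcoll u v w}) \<le> D})
    \<le> 2304 * ((real (card V))\<^sup>2 / real k + real (card V) * D)"
proof -
  define A where "A = {(u, v) \<in> V \<times> V. u \<noteq> v \<and> k \<le> card {w\<in>V. pcoll u v w} \<and> real (card {w\<in>V. pcoll u v w}) \<le> D}"
  define c where "c = (\<lambda>l. card {v\<in>V. on_line l v})"
  define L where "L = (\<lambda>(u, v). line_through u v) ` A"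
  define N where "N = real (card V)"
  define m where "m = nat \<lfloor>D\<rfloor>"
  have finA: "finite A" unfolding A_def by (rule finite_subset[of _ "V \<times> V"]) (use V in auto)
  have finL: "finite L" unfolding L_def using finA by simp
  have c: "{w\<in>V. on_line (line_through u v) w} = {w\<in>V. pcoll u v w}" if "(u, v) \<in> A" for u v
  proof -
    have "fst u \<noteq> fst v" using that V(2) by (auto simp: A_def dest: inj_onD)
    then show ?thesis using on_line_through by auto
  qed
  have cL: "k \<le> c l" "real (c l) \<le> D" if "l \<in> L" for l
  proof -
    obtain u v where uv: "(u, v) \<in> A" "l = line_through u v" using \<open>l \<in> L\<close> unfolding L_def by auto
    then show "k \<le> c l" "real (c l) \<le> D" using c[OF uv(1)] by (simp_all add: c_def A_def)
  qed
  show ?thesis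
  proof (cases "A = {}")
    case True
    then show ?thesis using D unfolding A_def[symmetric] by simp
  next
    case False
    then have "L \<noteq> {}" unfolding L_def by simp
    then obtain l0 where "l0 \<in> L" by blast
    then have kD: "real k \<le> D" using cL[of l0] by linarith
    have km: "k \<le> m" using kD unfolding m_def by linarith
    have cm: "c l \<le> m" if "l \<in> L" for l using cL(2)[OF that] unfolding m_def by linarith
    have mD: "real m \<le> D" using D unfolding m_def by linarith
    define F where "F = (\<lambda>j. 576 * N\<^sup>2 / real j ^ 3 + 12 * N / real j)"
    have F: "real (card {l\<in>L. j \<le> c l}) \<le> F j" if "2 \<le> j" for j
      unfolding F_def N_def by (rule card_rich_lines_le[OF V _ that]) (use finL in \<open>auto simp: c_def\<close>)
    have "A \<subseteq> (\<Union>l\<in>L. {v\<in>V. on_line l v} \<times> {v\<in>V. on_line l v})"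
    proof
      fix x assume "x \<in> A"
      then obtain u v where x: "x = (u, v)" "(u, v) \<in> A" by (cases x) auto
      have "u \<in> {w\<in>V. pcoll u v w}" "v \<in> {w\<in>V. pcoll u v w}"
        using x(2) by (auto simp: A_def pcoll_def)
      then have "x \<in> {w\<in>V. on_line (line_through u v) w} \<times> {w\<in>V. on_line (line_through u v) w}"
        using c[OF x(2)] x(1) by simp
      moreover have "line_through u v \<in> L" using x(2) unfolding L_def by force
      ultimately show "x \<in> (\<Union>l\<in>L. {v\<in>V. on_line l v} \<times> {v\<in>V. on_line l v})" by blast
    qed
    then have "card A \<le> card (\<Union>l\<in>L. {v\<in>V. on_line l v} \<times> {v\<in>V. on_line l v})"
      using V finL by (intro card_mono) auto
    also have "\<dots> \<le> (\<Sum>l\<in>L. card ({v\<in>V. on_line l v} \<times> {v\<in>V. on_line l v}))"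
      using finL by (rule card_UN_le)
    also have "\<dots> = (\<Sum>l\<in>L. (c l)\<^sup>2)" by (simp add: card_cartesian_product c_def power2_eq_square)
    also have "\<dots> \<le> (\<Sum>j\<in>{1..m}. 2 * j * card {l\<in>L. j \<le> c l})"
      using finL cm by (rule sum_squares_by_levels)
    finally have "real (card A) \<le> real (\<Sum>j\<in>{1..m}. 2 * j * card {l\<in>L. j \<le> c l})"
      by (rule of_nat_mono)
    also have "\<dots> = (\<Sum>j\<in>{1..m}. 2 * real j * real (card {l\<in>L. j \<le> c l}))" by simp
    also have "{1..m} = {1..k} \<union> {k<..m}" using km by auto
    also have "(\<Sum>j\<in>{1..k} \<union> {k<..m}. 2 * real j * real (card {l\<in>L. j \<le> c l})) =
       (\<Sum>j\<in>{1..k}. 2 * real j * real (card {l\<in>L. j \<le> c l})) + (\<Sum>j\<in>{k<..m}. 2 * real j * real (card {l\<in>L. j \<le> c l}))"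
      by (rule sum.union_disjoint) auto
    also have "(\<Sum>j\<in>{1..k}. 2 * real j * real (card {l\<in>L. j \<le> c l})) \<le> (\<Sum>j\<in>{1..k}. 2 * real k * F k)"
    proof (rule sum_mono)
      fix j assume j: "j \<in> {1..k}"
      \<comment> \<open>All lines of \<open>L\<close> have at least \<open>k\<close> points, so the
        levels below \<open>k\<close> are no larger than level \<open>k\<close>, where the bound is
        much better than at small \<open>j\<close>.\<close>
      have "{l\<in>L. j \<le> c l} = {l\<in>L. k \<le> c l}" using cL(1) j by force
      then have "real (card {l\<in>L. j \<le> c l}) \<le> F k" using F[OF k] by simp
      then show "2 * real j * real (card {l\<in>L. j \<le> c l}) \<le> 2 * real k * F k"
        using j by (intro mult_mono) auto
    qed
    also have "\<dots> = 1152 * N\<^sup>2 / real k + 24 * N * real k"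
      using k by (simp add: F_def field_simps power2_eq_square power3_eq_cube)
    also have "24 * N * real k \<le> 24 * N * D" using kD by (intro mult_left_mono) (auto simp: N_def)
    also have "(\<Sum>j\<in>{k<..m}. 2 * real j * real (card {l\<in>L. j \<le> c l})) \<le>
      (\<Sum>j\<in>{k<..m}. 1152 * N\<^sup>2 * (1 / (real j)\<^sup>2) + 24 * N)"
    proof (rule sum_mono)
      fix j assume j: "j \<in> {k<..m}"
      have "2 * real j * real (card {l\<in>L. j \<le> c l}) \<le> 2 * real j * F j"
        using F[of j] j k by (intro mult_left_mono) auto
      also have "\<dots> = 1152 * N\<^sup>2 * (1 / (real j)\<^sup>2) + 24 * N"
        using j by (simp add: F_def field_simps power2_eq_square power3_eq_cube)
      finally show "2 * real j * real (card {l\<in>L. j \<le> c l}) \<le> 1152 * N\<^sup>2 * (1 / (real j)\<^sup>2) + 24 * N" .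
    qed
    also have "\<dots> = 1152 * N\<^sup>2 * (\<Sum>j\<in>{k<..m}. 1 / (real j)\<^sup>2) + 24 * N * real (m - k)"
      by (simp add: sum.distrib sum_distrib_left)
    also have "(\<Sum>j\<in>{k<..m}. 1 / (real j)\<^sup>2) \<le> 1 / real k"
      using sum_telescope_inverse[of k m] k km by (smt (verit) of_nat_0_le_iff divide_nonneg_nonneg One_nat_def Suc_1 Suc_leD)
    also have "24 * N * real (m - k) \<le> 24 * N * D"
      using mD by (intro mult_left_mono) (auto simp: N_def)
    finally have "real (card A) \<le> 1152 * N\<^sup>2 / real k + 24 * N * D + (1152 * N\<^sup>2 * (1 / real k) + 24 * N * D)"
      by (simp add: mult_left_mono)
    moreover have "0 \<le> N * D" using D by (simp add: N_def)
    ultimately show ?thesis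
      unfolding A_def[symmetric] N_def[symmetric] by (simp add: algebra_simps)
  qed
qed

section \<open>Weighted point sets in the plane\<close>

lemma card_pairs_eq:
  assumes "finite A" "finite B"
  shows "card {(x, y) \<in> A \<times> B. R x y} = (\<Sum>x\<in>A. card {y\<in>B. R x y})"
proof -
  have "{(x, y) \<in> A \<times> B. R x y} = (SIGMA x:A. {y\<in>B. R x y})" by auto
  then show ?thesis using assms by (simp add: card_SigmaI)
qed

lemma card_pairs_le:
  fixes c :: real
  assumes "finite A" "finite B" "\<And>x. x \<in> A \<Longrightarrow> real (card {y\<in>B. R x y}) \<le> c"
  shows "real (card {(x, y) \<in> A \<times> B. R x y}) \<le> real (card A) * c"
  unfolding card_pairs_eq[OF assms(1,2)]
  using assms(3) sum_bounded_above[of A "\<lambda>x. real (card {y\<in>B. R x y})" c] by simp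

lemma card_pairs_ge:
  fixes c :: real
  assumes "finite A" "finite B" "\<And>x. x \<in> A \<Longrightarrow> c \<le> real (card {y\<in>B. R x y})"
  shows "real (card A) * c \<le> real (card {(x, y) \<in> A \<times> B. R x y})"
  unfolding card_pairs_eq[OF assms(1,2)]
  using assms(3) sum_bounded_below[of A c "\<lambda>x. real (card {y\<in>B. R x y})"] by simp

lemma card_UN_le_mult:
  fixes c :: real
  assumes "finite I" "\<And>i. i \<in> I \<Longrightarrow> real (card (A i)) \<le> c"
  shows "real (card (\<Union>i\<in>I. A i)) \<le> real (card I) * c"
proof -
  have "real (card (\<Union>i\<in>I. A i)) \<le> real (\<Sum>i\<in>I. card (A i))"
    using card_UN_le[OF assms(1)] by (intro of_nat_mono)
  also have "\<dots> \<le> real (card I) * c" using assms sum_bounded_above[of I "\<lambda>i. real (card (A i))" c] by simp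
  finally show ?thesis .
qed

lemma pcoll_exchange:
  assumes "fst u \<noteq> fst v" "fst u \<noteq> fst w" "pcoll u v w"
  shows "pcoll u v x \<longleftrightarrow> pcoll u w x"
proof -
  have "on_line (line_through u v) u" "on_line (line_through u v) w"
    using assms on_line_through[OF assms(1)] by (auto simp: pcoll_def)
  moreover have "on_line (line_through u w) u" "on_line (line_through u w) w"
    using on_line_through[OF assms(2)] by (auto simp: pcoll_def)
  ultimately have "line_through u v = line_through u w" using assms(2) by (rule on_line_unique)
  then show ?thesis using on_line_through[OF assms(1), of x] on_line_through[OF assms(2), of x] by simp
qed

text \<open>Applied to the central projection from a point \<open>p\<close>, \<open>light\<close> selects the points lying on
  a line through \<open>p\<close> with few points of the set.\<close>

definition light :: "('a \<Rightarrow> real \<times> real) \<Rightarrow> 'a set \<Rightarrow> nat \<Rightarrow> 'a set" where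
  "light \<phi> Q K = {q\<in>Q. card {r\<in>Q. \<phi> r = \<phi> q} \<le> K}"

definition on_join :: "('a \<Rightarrow> real \<times> real) \<Rightarrow> 'a set \<Rightarrow> 'a \<Rightarrow> 'a \<Rightarrow> 'a set" where
  "on_join \<phi> Q q q' = {r\<in>Q. pcoll (\<phi> q) (\<phi> q') (\<phi> r)}"

context
  fixes \<phi> :: "'a \<Rightarrow> real \<times> real" and Q :: "'a set" and V :: "(real \<times> real) set" and n K k :: nat
  assumes Q: "finite Q" and n: "card Q \<le> n" and V: "V = \<phi> ` Q" and inj: "inj_on fst V"
    and k: "2 \<le> k"
begin

text \<open>Counts distinct images on the line, whereas \<open>on_join\<close> collects the points
  of \<open>Q\<close> above them. Incidence bounds control the former; the number of points in a
  plane is given by the latter.\<close>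

definition join_count where
  "join_count q q' = card {w\<in>V. pcoll (\<phi> q) (\<phi> q') w}"

lemma finite_projection: "finite V" using Q V by simp
lemma card_projection_le: "card V \<le> n" using card_image_le[OF Q, of \<phi>] n V by simp

lemma light_subset: "light \<phi> Q K \<subseteq> Q" by (auto simp: light_def)

lemma card_light: "card (light \<phi> Q K) \<le> n"
  using card_mono[OF Q light_subset] n by linarith

lemma finite_light: "finite (light \<phi> Q K)" using finite_subset[OF light_subset Q] .

lemma card_light_fiber: "card {q\<in>light \<phi> Q K. \<phi> q = u} \<le> K"
proof (cases "{q\<in>light \<phi> Q K. \<phi> q = u} = {}")
  case False
  then obtain q where q: "q \<in> light \<phi> Q K" "\<phi> q = u" by auto
  have "card {q\<in>light \<phi> Q K. \<phi> q = u} \<le> card {r\<in>Q. \<phi> r = \<phi> q}"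
    using Q q light_subset by (intro card_mono) auto
  then show ?thesis using q by (auto simp: light_def)
qed (simp only: card.empty)

lemma fst_projection_neq: "\<phi> q \<noteq> \<phi> q' \<Longrightarrow> q \<in> Q \<Longrightarrow> q' \<in> Q \<Longrightarrow> fst (\<phi> q) \<noteq> fst (\<phi> q')"
  using inj V by (auto dest: inj_onD)

lemma card_equal_pairs:
  "real (card {(q, q') \<in> light \<phi> Q K \<times> light \<phi> Q K. \<phi> q = \<phi> q'}) \<le> real n * real K"
proof -
  have "real (card {(q, q') \<in> light \<phi> Q K \<times> light \<phi> Q K. \<phi> q = \<phi> q'}) \<le> real (card (light \<phi> Q K)) * real K"
    by (rule card_pairs_le[OF finite_light finite_light]) (use card_light_fiber in \<open>simp add: eq_commute\<close>)
  also have "\<dots> \<le> real n * real K" using card_light by (intro mult_right_mono) auto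
  finally show ?thesis .
qed

text \<open>Every image has at most \<open>K\<close> light preimages, so a pair of images comes from
  at most \<open>K\<^sup>2\<close> pairs of light points.\<close>

lemma card_medium_join_pairs:
  fixes D :: real
  assumes D: "0 \<le> D"
  shows "real (card {(q, q') \<in> light \<phi> Q K \<times> light \<phi> Q K. \<phi> q \<noteq> \<phi> q' \<and> k \<le> join_count q q' \<and> real (join_count q q') \<le> D})
    \<le> (real K)\<^sup>2 * (2304 * ((real n)\<^sup>2 / real k + real n * D))"
proof -
  define M where "M = {(u, v) \<in> V \<times> V. u \<noteq> v \<and> k \<le> card {w\<in>V. pcoll u v w} \<and> real (card {w\<in>V. pcoll u v w}) \<le> D}"
  define F where "F = (\<lambda>u. {q\<in>light \<phi> Q K. \<phi> q = u})"
  have fin: "finite M" unfolding M_def by (rule finite_subset[of _ "V \<times> V"]) (use finite_projection in auto)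
  have finF: "finite (F u)" for u using finite_light by (simp add: F_def)
  have "card {(q, q') \<in> light \<phi> Q K \<times> light \<phi> Q K. \<phi> q \<noteq> \<phi> q' \<and> k \<le> join_count q q' \<and> real (join_count q q') \<le> D}
     \<le> card (\<Union>x\<in>M. F (fst x) \<times> F (snd x))"
  proof (rule card_mono)
    show "{(q, q') \<in> light \<phi> Q K \<times> light \<phi> Q K. \<phi> q \<noteq> \<phi> q' \<and> k \<le> join_count q q' \<and> real (join_count q q') \<le> D}
      \<subseteq> (\<Union>x\<in>M. F (fst x) \<times> F (snd x))"
    proof clarify
      fix q q' assume a: "q \<in> light \<phi> Q K" "q' \<in> light \<phi> Q K" "\<phi> q \<noteq> \<phi> q'" "k \<le> join_count q q'" "real (join_count q q') \<le> D"
      then have "\<phi> q \<in> V" "\<phi> q' \<in> V" using light_subset V by auto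
      then have "(\<phi> q, \<phi> q') \<in> M" using a by (simp add: M_def join_count_def)
      moreover have "(q, q') \<in> F (fst (\<phi> q, \<phi> q')) \<times> F (snd (\<phi> q, \<phi> q'))" using a by (simp add: F_def)
      ultimately show "(q, q') \<in> (\<Union>x\<in>M. F (fst x) \<times> F (snd x))" by blast
    qed
  qed (use fin finF in auto)
  also have "real (card (\<Union>x\<in>M. F (fst x) \<times> F (snd x))) \<le> real (card M) * (real K)\<^sup>2"
  proof (rule card_UN_le_mult[OF fin])
    fix x
    have "card (F (fst x)) * card (F (snd x)) \<le> K * K"
      using card_light_fiber unfolding F_def by (intro mult_mono) auto
    then show "real (card (F (fst x) \<times> F (snd x))) \<le> (real K)\<^sup>2"
      by (simp add: card_cartesian_product power2_eq_square flip: of_nat_mult)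
  qed
  also have "\<dots> \<le> (2304 * ((real (card V))\<^sup>2 / real k + real (card V) * D)) * (real K)\<^sup>2"
    unfolding M_def using card_medium_pairs_le[OF finite_projection inj k D] by (intro mult_right_mono) auto
  also have "\<dots> \<le> (2304 * ((real n)\<^sup>2 / real k + real n * D)) * (real K)\<^sup>2"
    using card_projection_le D by (intro mult_right_mono mult_left_mono add_mono divide_right_mono power_mono) auto
  finally show ?thesis by (simp add: mult.commute)
qed

text \<open>Few lines carry more than \<open>D\<close> images. A light point whose image is on two
  of them is one of at most \<open>K\<close> above each of the few intersection points; any other
  light point sees all its partners on a single rich line, which has at most
  \<open>\<alpha> * n\<close> points of \<open>Q\<close>. The second kind gives the term
  \<open>\<alpha> * n\<^sup>2\<close>, the only one that later choices of parameters cannot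
  shrink.\<close>

lemma card_rich_join_pairs:
  fixes D \<alpha> :: real
  assumes D: "2 \<le> D" and \<alpha>: "0 \<le> \<alpha>"
    and lines: "\<And>q q'. q \<in> Q \<Longrightarrow> q' \<in> Q \<Longrightarrow> \<phi> q \<noteq> \<phi> q' \<Longrightarrow> real (card (on_join \<phi> Q q q')) \<le> \<alpha> * real n"
  shows "real (card {(q, q') \<in> light \<phi> Q K \<times> light \<phi> Q K. \<phi> q \<noteq> \<phi> q' \<and> D < real (join_count q q')})
    \<le> \<alpha> * (real n)\<^sup>2 + real K * (576 * (real n)\<^sup>2 / D ^ 3 + 12 * real n / D)\<^sup>2 * real n"
proof -
  define RL where "RL = {l \<in> (\<lambda>(u, v). line_through u v) ` (V \<times> V). D < real (card {v\<in>V. on_line l v})}"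
  define h where "h = 576 * (real n)\<^sup>2 / D ^ 3 + 12 * real n / D"
  have finRL: "finite RL" using finite_projection by (simp add: RL_def)
  define j where "j = nat \<lceil>D\<rceil>"
  have j: "2 \<le> j" "D \<le> real j" using D unfolding j_def by linarith+
  have "real (card RL) \<le> 576 * (real (card V))\<^sup>2 / real j ^ 3 + 12 * real (card V) / real j"
  proof (rule card_rich_lines_le[OF finite_projection inj finRL j(1)])
    fix l assume "l \<in> RL"
    then show "j \<le> card {v\<in>V. on_line l v}" unfolding RL_def j_def by (simp add: nat_le_iff ceiling_le_iff)
  qed
  also have "\<dots> \<le> h"
    unfolding h_def using card_projection_le j D by (intro add_mono frac_le mult_left_mono power_mono) auto
  finally have h: "real (card RL) \<le> h" .
  \<comment> \<open>The images lying on two different rich lines; \<open>S\<close> will be the light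
    points above them.\<close>
  define Mu where "Mu = (\<Union>x\<in>{x\<in>RL \<times> RL. fst x \<noteq> snd x}. {u\<in>V. on_line (fst x) u \<and> on_line (snd x) u})"
  have "real (card Mu) \<le> real (card {x\<in>RL \<times> RL. fst x \<noteq> snd x}) * 1"
    unfolding Mu_def
  proof (rule card_UN_le_mult)
    fix x assume "x \<in> {x\<in>RL \<times> RL. fst x \<noteq> snd x}"
    then have "u = v" if "u \<in> V" "v \<in> V" "on_line (fst x) u" "on_line (snd x) u" "on_line (fst x) v" "on_line (snd x) v" for u v
      using on_line_unique[of "fst x" u v "snd x"] that inj by (auto dest: inj_onD)
    then have "card {u\<in>V. on_line (fst x) u \<and> on_line (snd x) u} \<le> Suc 0"
      using finite_projection by (subst card_le_Suc0_iff_eq) auto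
    then show "real (card {u\<in>V. on_line (fst x) u \<and> on_line (snd x) u}) \<le> 1" by simp
  qed (use finRL in auto)
  also have "\<dots> \<le> real (card (RL \<times> RL))"
  proof -
    have "card {x\<in>RL \<times> RL. fst x \<noteq> snd x} \<le> card (RL \<times> RL)" using finRL by (intro card_mono) auto
    then show ?thesis by (simp only: of_nat_le_iff mult_1_right)
  qed
  also have "\<dots> \<le> h\<^sup>2" using h by (simp add: card_cartesian_product power2_eq_square mult_mono')
  finally have Mu: "real (card Mu) \<le> h\<^sup>2" .
  have finMu: "finite Mu" using finRL finite_projection by (auto simp: Mu_def)
  define S where "S = (\<Union>u\<in>Mu. {q\<in>light \<phi> Q K. \<phi> q = u})"
  have "real (card S) \<le> real (card Mu) * real K"
    unfolding S_def by (rule card_UN_le_mult[OF finMu]) (use card_light_fiber in simp)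
  also have "\<dots> \<le> h\<^sup>2 * real K" using Mu by (intro mult_right_mono) auto
  finally have S: "real (card S) \<le> h\<^sup>2 * real K" .
  have S_sub: "S \<subseteq> light \<phi> Q K" by (auto simp: S_def)
  define R where "R = (\<lambda>q q'. \<phi> q \<noteq> \<phi> q' \<and> D < real (join_count q q'))"
  have "real (card {(q, q') \<in> S \<times> light \<phi> Q K. R q q'}) \<le> real (card S) * real n"
  proof (rule card_pairs_le)
    fix q
    have "card {y\<in>light \<phi> Q K. R q y} \<le> card (light \<phi> Q K)" using finite_light by (intro card_mono) auto
    then show "real (card {y\<in>light \<phi> Q K. R q y}) \<le> real n" using card_light by linarith
  qed (use finite_light finite_subset[OF S_sub finite_light] in auto)
  also have "\<dots> \<le> h\<^sup>2 * real K * real n" using S by (intro mult_right_mono) auto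
  finally have 1: "real (card {(q, q') \<in> S \<times> light \<phi> Q K. R q q'}) \<le> h\<^sup>2 * real K * real n" .
  have "real (card {(q, q') \<in> (light \<phi> Q K - S) \<times> light \<phi> Q K. R q q'}) \<le> real (card (light \<phi> Q K - S)) * (\<alpha> * real n)"
  proof (rule card_pairs_le)
    fix q assume q: "q \<in> light \<phi> Q K - S"
    have qQ: "q \<in> Q" using q light_subset by auto
    have rl: "line_through (\<phi> q) (\<phi> y) \<in> RL" if "y \<in> light \<phi> Q K" "R q y" for y
    proof -
      have y: "y \<in> Q" "\<phi> q \<noteq> \<phi> y" using that light_subset by (auto simp: R_def)
      have "{v\<in>V. on_line (line_through (\<phi> q) (\<phi> y)) v} = {w\<in>V. pcoll (\<phi> q) (\<phi> y) w}"
        using on_line_through[OF fst_projection_neq[OF y(2) qQ y(1)]] by auto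
      then show ?thesis
        using that qQ y V unfolding RL_def R_def join_count_def by force
    qed
    show "real (card {y\<in>light \<phi> Q K. R q y}) \<le> \<alpha> * real n"
    proof (cases "{y\<in>light \<phi> Q K. R q y} = {}")
      case True
      then show ?thesis using \<alpha> by (simp only: card.empty) simp
    next
      case False
      then obtain y0 where y0: "y0 \<in> light \<phi> Q K" "R q y0" by auto
      have "{y\<in>light \<phi> Q K. R q y} \<subseteq> on_join \<phi> Q q y0"
      proof
        fix y assume y: "y \<in> {y\<in>light \<phi> Q K. R q y}"
        have ne: "fst (\<phi> q) \<noteq> fst (\<phi> y)" "fst (\<phi> q) \<noteq> fst (\<phi> y0)"
          using y y0 light_subset qQ fst_projection_neq[of q y] fst_projection_neq[of q y0] by (auto simp: R_def)
        have o: "on_line (line_through (\<phi> q) (\<phi> y)) (\<phi> q)" "on_line (line_through (\<phi> q) (\<phi> y0)) (\<phi> q)"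
          using ne by (simp_all add: on_line_through pcoll_def)
        have "line_through (\<phi> q) (\<phi> y) = line_through (\<phi> q) (\<phi> y0)"
        proof (rule ccontr)
          assume neq: "line_through (\<phi> q) (\<phi> y) \<noteq> line_through (\<phi> q) (\<phi> y0)"
          have "\<phi> q \<in> Mu"
            unfolding Mu_def using neq o rl[of y] rl[OF y0] y qQ V
            by (intro UN_I[of "(line_through (\<phi> q) (\<phi> y), line_through (\<phi> q) (\<phi> y0))"]) auto
          then show False using q by (auto simp: S_def)
        qed
        then have "on_line (line_through (\<phi> q) (\<phi> y0)) (\<phi> y)"
          using on_line_through[OF ne(1), of "\<phi> y"] by (simp add: pcoll_def)
        then show "y \<in> on_join \<phi> Q q y0"
          using on_line_through[OF ne(2)] y light_subset by (auto simp: on_join_def)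
      qed
      then have "card {y\<in>light \<phi> Q K. R q y} \<le> card (on_join \<phi> Q q y0)"
        using Q by (intro card_mono) (auto simp: on_join_def)
      also have "real (card (on_join \<phi> Q q y0)) \<le> \<alpha> * real n"
        using y0 light_subset qQ by (intro lines) (auto simp: R_def)
      finally show ?thesis by simp
    qed
  qed (use finite_light in auto)
  also have "\<dots> \<le> real n * (\<alpha> * real n)"
  proof (rule mult_right_mono)
    have "card (light \<phi> Q K - S) \<le> card (light \<phi> Q K)" using finite_light by (intro card_mono) auto
    then show "real (card (light \<phi> Q K - S)) \<le> real n" using card_light by linarith
  qed (use \<alpha> in simp)
  finally have 2: "real (card {(q, q') \<in> (light \<phi> Q K - S) \<times> light \<phi> Q K. R q q'}) \<le> real n * (\<alpha> * real n)" .
  have "{(q, q') \<in> light \<phi> Q K \<times> light \<phi> Q K. R q q'} =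
      {(q, q') \<in> S \<times> light \<phi> Q K. R q q'} \<union> {(q, q') \<in> (light \<phi> Q K - S) \<times> light \<phi> Q K. R q q'}"
    using S_sub by auto
  then have "card {(q, q') \<in> light \<phi> Q K \<times> light \<phi> Q K. R q q'} \<le>
      card {(q, q') \<in> S \<times> light \<phi> Q K. R q q'} + card {(q, q') \<in> (light \<phi> Q K - S) \<times> light \<phi> Q K. R q q'}"
    by (simp add: card_Un_le)
  then have "real (card {(q, q') \<in> light \<phi> Q K \<times> light \<phi> Q K. R q q'}) \<le> h\<^sup>2 * real K * real n + real n * (\<alpha> * real n)"
    using 1 2 by linarith
  then show ?thesis unfolding R_def h_def by (simp add: power2_eq_square mult_ac)
qed

text \<open>Double counting of triples \<open>q\<close>, \<open>q'\<close>, \<open>r\<close> with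
  \<open>r\<close> on the join and its image different from that of \<open>q\<close>. A pair
  \<open>q\<close>, \<open>q'\<close> extends in at least \<open>B - K\<close> ways, because at most
  \<open>K\<close> points share the image of \<open>q\<close>. Conversely \<open>q\<close> and
  \<open>r\<close> span the same line, which has fewer than \<open>k\<close> images with at most
  \<open>K\<close> light points above each, leaving at most \<open>k * K\<close> choices of
  \<open>q'\<close>.\<close>

lemma card_poor_join_pairs:
  assumes B: "K < B"
  shows "real (card {(q, q') \<in> light \<phi> Q K \<times> light \<phi> Q K. \<phi> q \<noteq> \<phi> q' \<and> join_count q q' < k \<and> B < card (on_join \<phi> Q q q')})
    \<le> (real n)\<^sup>2 * real (k * K) / real (B - K)"
proof -
  define P where "P = {(q, q') \<in> light \<phi> Q K \<times> light \<phi> Q K. \<phi> q \<noteq> \<phi> q' \<and> join_count q q' < k \<and> B < card (on_join \<phi> Q q q')}"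
  have finP: "finite P" unfolding P_def
    by (rule finite_subset[of _ "light \<phi> Q K \<times> light \<phi> Q K"]) (use finite_light in auto)
  define T where "T = {(x, r) \<in> P \<times> Q. \<phi> r \<noteq> \<phi> (fst x) \<and> pcoll (\<phi> (fst x)) (\<phi> (snd x)) (\<phi> r)}"
  have "real (card P) * real (B - K) \<le> real (card T)"
    unfolding T_def
  proof (rule card_pairs_ge[OF finP Q])
    fix x assume "x \<in> P"
    then obtain q q' where x: "x = (q, q')" "q \<in> light \<phi> Q K" "B < card (on_join \<phi> Q q q')"
      by (cases x) (auto simp: P_def)
    have "on_join \<phi> Q q q' \<subseteq> {r\<in>Q. \<phi> r \<noteq> \<phi> q \<and> pcoll (\<phi> q) (\<phi> q') (\<phi> r)} \<union> {r\<in>Q. \<phi> r = \<phi> q}"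
      by (auto simp: on_join_def)
    then have "card (on_join \<phi> Q q q') \<le> card ({r\<in>Q. \<phi> r \<noteq> \<phi> q \<and> pcoll (\<phi> q) (\<phi> q') (\<phi> r)} \<union> {r\<in>Q. \<phi> r = \<phi> q})"
      using Q by (intro card_mono) auto
    also have "\<dots> \<le> card {r\<in>Q. \<phi> r \<noteq> \<phi> q \<and> pcoll (\<phi> q) (\<phi> q') (\<phi> r)} + card {r\<in>Q. \<phi> r = \<phi> q}"
      by (rule card_Un_le)
    also have "card {r\<in>Q. \<phi> r = \<phi> q} \<le> K" using x by (simp add: light_def)
    finally show "real (B - K) \<le> real (card {y\<in>Q. \<phi> y \<noteq> \<phi> (fst x) \<and> pcoll (\<phi> (fst x)) (\<phi> (snd x)) (\<phi> y)})"
      using x by simp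
  qed
  also have "card T \<le> card {(y, q') \<in> (light \<phi> Q K \<times> Q) \<times> light \<phi> Q K. \<phi> (fst y) \<noteq> \<phi> (snd y) \<and> join_count (fst y) (snd y) < k \<and>
      pcoll (\<phi> (fst y)) (\<phi> (snd y)) (\<phi> q')}"
  proof (rule card_inj_on_le[of "\<lambda>((q, q'), r). ((q, r), q')"])
    show "(\<lambda>((q, q'), r). ((q, r), q')) ` T \<subseteq> {(y, q') \<in> (light \<phi> Q K \<times> Q) \<times> light \<phi> Q K. \<phi> (fst y) \<noteq> \<phi> (snd y) \<and>
        join_count (fst y) (snd y) < k \<and> pcoll (\<phi> (fst y)) (\<phi> (snd y)) (\<phi> q')}"
    proof clarify
      fix q q' r assume t: "((q, q'), r) \<in> T"
      then have a: "q \<in> light \<phi> Q K" "q' \<in> light \<phi> Q K" "r \<in> Q" "\<phi> q \<noteq> \<phi> q'" "join_count q q' < k" "\<phi> r \<noteq> \<phi> q"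
        "pcoll (\<phi> q) (\<phi> q') (\<phi> r)" by (auto simp: T_def P_def)
      have ne: "fst (\<phi> q) \<noteq> fst (\<phi> q')" "fst (\<phi> q) \<noteq> fst (\<phi> r)"
        using a light_subset fst_projection_neq[of q q'] fst_projection_neq[of q r] by auto
      have ex: "pcoll (\<phi> q) (\<phi> q') w \<longleftrightarrow> pcoll (\<phi> q) (\<phi> r) w" for w
        using pcoll_exchange[OF ne a(7)] .
      then have "join_count q r = join_count q q'" by (simp add: join_count_def)
      moreover have "pcoll (\<phi> q) (\<phi> r) (\<phi> q')" using ex[of "\<phi> q'"] by (simp add: pcoll_def)
      ultimately show "((q, r), q') \<in> (light \<phi> Q K \<times> Q) \<times> light \<phi> Q K \<and> \<phi> (fst (q, r)) \<noteq> \<phi> (snd (q, r)) \<and>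
         join_count (fst (q, r)) (snd (q, r)) < k \<and> pcoll (\<phi> (fst (q, r))) (\<phi> (snd (q, r))) (\<phi> q')"
        using a by auto
    qed
    show "finite {(y, q') \<in> (light \<phi> Q K \<times> Q) \<times> light \<phi> Q K. \<phi> (fst y) \<noteq> \<phi> (snd y) \<and>
        join_count (fst y) (snd y) < k \<and> pcoll (\<phi> (fst y)) (\<phi> (snd y)) (\<phi> q')}"
      by (rule finite_subset[of _ "(light \<phi> Q K \<times> Q) \<times> light \<phi> Q K"]) (use finite_light Q in auto)
  qed (auto simp: inj_on_def)
  also have "real (card {(y, q') \<in> (light \<phi> Q K \<times> Q) \<times> light \<phi> Q K. \<phi> (fst y) \<noteq> \<phi> (snd y) \<and> join_count (fst y) (snd y) < k \<and>
      pcoll (\<phi> (fst y)) (\<phi> (snd y)) (\<phi> q')}) \<le> real (card (light \<phi> Q K \<times> Q)) * real (k * K)"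
  proof (rule card_pairs_le)
    fix y
    define W where "W = {w\<in>V. pcoll (\<phi> (fst y)) (\<phi> (snd y)) w}"
    show "real (card {q'\<in>light \<phi> Q K. \<phi> (fst y) \<noteq> \<phi> (snd y) \<and> join_count (fst y) (snd y) < k \<and>
        pcoll (\<phi> (fst y)) (\<phi> (snd y)) (\<phi> q')}) \<le> real (k * K)"
    proof (cases "join_count (fst y) (snd y) < k")
      case True
      have "{q'\<in>light \<phi> Q K. \<phi> (fst y) \<noteq> \<phi> (snd y) \<and> join_count (fst y) (snd y) < k \<and>
        pcoll (\<phi> (fst y)) (\<phi> (snd y)) (\<phi> q')} \<subseteq> (\<Union>u\<in>W. {q\<in>light \<phi> Q K. \<phi> q = u})"
        using light_subset V by (auto simp: W_def)
      then have "card {q'\<in>light \<phi> Q K. \<phi> (fst y) \<noteq> \<phi> (snd y) \<and> join_count (fst y) (snd y) < k \<and>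
        pcoll (\<phi> (fst y)) (\<phi> (snd y)) (\<phi> q')} \<le> card (\<Union>u\<in>W. {q\<in>light \<phi> Q K. \<phi> q = u})"
        using finite_projection finite_light by (intro card_mono) (auto simp: W_def)
      also have "real (card (\<Union>u\<in>W. {q\<in>light \<phi> Q K. \<phi> q = u})) \<le> real (card W) * real K"
        by (rule card_UN_le_mult) (use card_light_fiber finite_projection in \<open>auto simp: W_def\<close>)
      also have "\<dots> \<le> real k * real K" using True by (intro mult_right_mono) (auto simp: W_def join_count_def)
      finally show ?thesis by simp
    qed simp
  qed (use finite_light Q in auto)
  also have "\<dots> \<le> (real n)\<^sup>2 * real (k * K)"
    using card_light n
    by (intro mult_right_mono) (auto simp: card_cartesian_product power2_eq_square intro!: mult_mono)
  finally have "real (card P) * real (B - K) \<le> (real n)\<^sup>2 * real (k * K)" by simp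
  then show ?thesis using B unfolding P_def by (simp add: field_simps)
qed

text \<open>A variant of Beck's theorem for points with multiplicities. The summands of the bound
  account, in order, for pairs with equal images, for joins with between \<open>k\<close> and
  \<open>D\<close> images, for joins with more than \<open>D\<close> images, and for joins with
  fewer than \<open>k\<close> images but more than \<open>B\<close> points.\<close>

theorem weighted_beck:
  fixes D \<alpha> :: real
  assumes "2 \<le> D" "0 \<le> \<alpha>" "K < B"
    and "\<And>q q'. q \<in> Q \<Longrightarrow> q' \<in> Q \<Longrightarrow> \<phi> q \<noteq> \<phi> q' \<Longrightarrow> real (card (on_join \<phi> Q q q')) \<le> \<alpha> * real n"
  shows "real (card {(q, q') \<in> light \<phi> Q K \<times> light \<phi> Q K. \<phi> q = \<phi> q' \<or> B < card (on_join \<phi> Q q q')})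
    \<le> real n * real K + (real K)\<^sup>2 * (2304 * ((real n)\<^sup>2 / real k + real n * D)) +
      (\<alpha> * (real n)\<^sup>2 + real K * (576 * (real n)\<^sup>2 / D ^ 3 + 12 * real n / D)\<^sup>2 * real n) +
      (real n)\<^sup>2 * real (k * K) / real (B - K)"
proof -
  define Y where "Y = light \<phi> Q K \<times> light \<phi> Q K"
  have finY: "finite Y" using finite_light by (simp add: Y_def)
  define Y1 where "Y1 = {(q, q') \<in> Y. \<phi> q = \<phi> q'}"
  define Y2 where "Y2 = {(q, q') \<in> Y. \<phi> q \<noteq> \<phi> q' \<and> k \<le> join_count q q' \<and> real (join_count q q') \<le> D}"
  define Y3 where "Y3 = {(q, q') \<in> Y. \<phi> q \<noteq> \<phi> q' \<and> D < real (join_count q q')}"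
  define Y4 where "Y4 = {(q, q') \<in> Y. \<phi> q \<noteq> \<phi> q' \<and> join_count q q' < k \<and> B < card (on_join \<phi> Q q q')}"
  have "{(q, q') \<in> Y. \<phi> q = \<phi> q' \<or> B < card (on_join \<phi> Q q q')} \<subseteq> Y1 \<union> Y2 \<union> Y3 \<union> Y4"
    by (auto simp: Y1_def Y2_def Y3_def Y4_def)
  moreover have "finite (Y1 \<union> Y2 \<union> Y3 \<union> Y4)"
    by (rule finite_subset[OF _ finY]) (auto simp: Y1_def Y2_def Y3_def Y4_def)
  ultimately have "card {(q, q') \<in> Y. \<phi> q = \<phi> q' \<or> B < card (on_join \<phi> Q q q')} \<le> card (Y1 \<union> Y2 \<union> Y3 \<union> Y4)"
    by (intro card_mono)
  also have "\<dots> \<le> card Y1 + card Y2 + card Y3 + card Y4"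
    by (meson add_le_mono card_Un_le le_refl order_trans)
  finally have le: "real (card {(q, q') \<in> Y. \<phi> q = \<phi> q' \<or> B < card (on_join \<phi> Q q q')}) \<le>
      real (card Y1) + real (card Y2) + real (card Y3) + real (card Y4)" by linarith
  have Y1: "real (card Y1) \<le> real n * real K" using card_equal_pairs unfolding Y1_def Y_def .
  have Y2: "real (card Y2) \<le> (real K)\<^sup>2 * (2304 * ((real n)\<^sup>2 / real k + real n * D))"
    using card_medium_join_pairs[of D] assms(1) unfolding Y2_def Y_def by simp
  have Y3: "real (card Y3) \<le> \<alpha> * (real n)\<^sup>2 + real K * (576 * (real n)\<^sup>2 / D ^ 3 + 12 * real n / D)\<^sup>2 * real n"
    using card_rich_join_pairs[OF assms(1,2,4)] unfolding Y3_def Y_def .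
  have Y4: "real (card Y4) \<le> (real n)\<^sup>2 * real (k * K) / real (B - K)"
    using card_poor_join_pairs[OF assms(3)] unfolding Y4_def Y_def .
  show ?thesis
    using order_trans[OF le add_mono[OF add_mono[OF add_mono[OF Y1 Y2] Y3] Y4]] unfolding Y_def .
qed

end

section \<open>Lines and planes in space\<close>

text \<open>Given by an equation, so that membership is algebraic and matches the determinants of
  the projections. Both \<open>line_of\<close> and \<open>plane_of\<close> degenerate to the whole
  space when their points coincide or are collinear, respectively, which explains the side
  conditions that follow.\<close>

definition line_of :: "real^3 \<Rightarrow> real^3 \<Rightarrow> (real^3) set" where
  "line_of a b = {x. cross3 (b - a) (x - a) = 0}"

definition plane_of :: "real^3 \<Rightarrow> real^3 \<Rightarrow> real^3 \<Rightarrow> (real^3) set" where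
  "plane_of a b c = {x. cross3 (b - a) (c - a) \<bullet> (x - a) = 0}"

lemma cross3_eq_0_iff:
  assumes "u \<noteq> 0"
  shows "cross3 u v = 0 \<longleftrightarrow> (\<exists>t. v = t *\<^sub>R u)"
proof -
  have "cross3 u v = 0 \<longleftrightarrow> v = 0 \<or> (\<exists>t. v = t *\<^sub>R u)"
    using assms by (simp add: cross_eq_0 collinear_lemma)
  then show ?thesis by (metis scaleR_zero_left)
qed

lemma mem_line_of_iff: "a \<noteq> b \<Longrightarrow> x \<in> line_of a b \<longleftrightarrow> (\<exists>t. x = a + t *\<^sub>R (b - a))"
  by (simp add: line_of_def cross3_eq_0_iff) (metis add.commute diff_add_cancel add_diff_cancel_left')

lemma line_of_eq_affine_hull: "a \<noteq> b \<Longrightarrow> line_of a b = affine hull {a, b}"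
  by (auto simp: mem_line_of_iff affine_hull_2_alt)

lemma is_line_line_of: "a \<noteq> b \<Longrightarrow> is_line (line_of a b)"
  by (simp add: is_line_def line_of_eq_affine_hull aff_dim_affine_hull aff_dim_2)

lemma plane_of_eq_hyperplane: "plane_of a b c = {x. cross3 (b - a) (c - a) \<bullet> x = cross3 (b - a) (c - a) \<bullet> a}"
  by (auto simp: plane_of_def inner_diff_right)

lemma is_plane_plane_of: "cross3 (b - a) (c - a) \<noteq> 0 \<Longrightarrow> is_plane (plane_of a b c)"
  by (simp add: is_plane_def plane_of_eq_hyperplane affine_hyperplane aff_dim_hyperplane)

lemma in_line_of [simp]: "a \<in> line_of a b" "b \<in> line_of a b"
  by (simp_all add: line_of_def)

lemma in_plane_of [simp]: "a \<in> plane_of a b c" "b \<in> plane_of a b c" "c \<in> plane_of a b c"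
  by (simp_all add: plane_of_def dot_cross_self)

lemma line_of_eq:
  assumes "x \<in> line_of a b" "y \<in> line_of a b" "a \<noteq> b" "x \<noteq> y"
  shows "line_of x y = line_of a b"
proof -
  obtain s t where s: "x = a + s *\<^sub>R (b - a)" and t: "y = a + t *\<^sub>R (b - a)"
    using assms by (auto simp: mem_line_of_iff)
  have st: "s \<noteq> t" using assms(4) s t by auto
  have yx: "y - x = (t - s) *\<^sub>R (b - a)" unfolding s t by (simp add: algebra_simps)
  have "cross3 (y - x) (z - x) = (t - s) *\<^sub>R cross3 (b - a) (z - a)" for z
  proof -
    have zx: "z - x = (z - a) - s *\<^sub>R (b - a)" using s by simp
    have "cross3 (b - a) (z - x) = cross3 (b - a) (z - a)"
      unfolding zx by (subst Cross3.right_diff_distrib) (simp add: cross_mult_right)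
    then show ?thesis unfolding yx by (simp only: cross_mult_left)
  qed
  then show ?thesis using st by (simp add: line_of_def)
qed

lemma plane_of_eq:
  assumes "x \<in> plane_of a b c" "y \<in> plane_of a b c" "z \<in> plane_of a b c" "cross3 (y - x) (z - x) \<noteq> 0"
    and abc: "cross3 (b - a) (c - a) \<noteq> 0"
  shows "plane_of x y z = plane_of a b c"
proof -
  define N where "N = cross3 (b - a) (c - a)"
  have N: "N \<bullet> (x - a) = 0" "N \<bullet> (y - a) = 0" "N \<bullet> (z - a) = 0" using assms by (auto simp: plane_of_def N_def)
  then have 1: "N \<bullet> (y - x) = 0" "N \<bullet> (z - x) = 0" by (auto simp: inner_diff_right)
  \<comment> \<open>By Lagrange's identity the double cross product is a combination of the two
    vanishing inner products; hence the two normals are parallel.\<close>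
  then have "cross3 N (cross3 (y - x) (z - x)) = 0" by (simp add: Lagrange)
  then obtain t where t: "cross3 (y - x) (z - x) = t *\<^sub>R N"
    using abc unfolding N_def[symmetric] by (auto simp: cross3_eq_0_iff)
  then have "t \<noteq> 0" using assms(4) by auto
  then show ?thesis
    unfolding plane_of_def t N_def[symmetric] using N(1) by (auto simp: inner_diff_right)
qed

lemma line_of_subset_plane_of:
  assumes "x \<in> plane_of a b c" "y \<in> plane_of a b c" "x \<noteq> y"
  shows "line_of x y \<subseteq> plane_of a b c"
proof
  fix z assume "z \<in> line_of x y"
  then obtain t where t: "z = x + t *\<^sub>R (y - x)" using assms by (auto simp: mem_line_of_iff)
  have "z - a = (x - a) + t *\<^sub>R ((y - a) - (x - a))" using t by (simp add: algebra_simps)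
  then show "z \<in> plane_of a b c" using assms by (simp add: plane_of_def inner_add_right inner_diff_right)
qed

section \<open>The Sylvester--Gallai theorem\<close>

text \<open>Two of three distinct numbers lie weakly on one side of \<open>m\<close>:
  \<open>t\<close> is the farther of them from \<open>m\<close> and \<open>s\<close> the nearer.
  Squares express this for both sides at once.\<close>

lemma same_side:
  fixes m :: real
  assumes "t1 \<noteq> t2" "t1 \<noteq> t3" "t2 \<noteq> t3"
  obtains s t where "s \<in> {t1, t2, t3}" "t \<in> {t1, t2, t3}" "s \<noteq> t" "(t - s)\<^sup>2 \<le> (t - m)\<^sup>2"
proof -
  have close: "\<exists>s t. s \<in> {t1, t2, t3} \<and> t \<in> {t1, t2, t3} \<and> s \<noteq> t \<and> (t - s)\<^sup>2 \<le> (t - m)\<^sup>2"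
    if "x \<in> {t1, t2, t3}" "y \<in> {t1, t2, t3}" "x < y" "m \<le> x \<or> y \<le> m" for x y
    using that(4)
  proof
    assume "m \<le> x"
    then have "(y - x)\<^sup>2 \<le> (y - m)\<^sup>2" using that by (intro power_mono) auto
    then show ?thesis using that by (intro exI[of _ x] exI[of _ y]) auto
  next
    assume "y \<le> m"
    then have "(y - x)\<^sup>2 \<le> (m - x)\<^sup>2" using that by (intro power_mono) auto
    then have "(x - y)\<^sup>2 \<le> (x - m)\<^sup>2" by (simp add: power2_commute)
    then show ?thesis using that by (intro exI[of _ y] exI[of _ x]) auto
  qed
  have "\<exists>x y. x \<in> {t1, t2, t3} \<and> y \<in> {t1, t2, t3} \<and> x < y \<and> (m \<le> x \<or> y \<le> m)"
    using assms by (smt (verit) insert_iff)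
  then show ?thesis using close that by blast
qed

lemma cross3_pencil: "cross3 (t *\<^sub>R u - v) (s *\<^sub>R u - v) = (s - t) *\<^sub>R cross3 u v"
proof -
  have "cross3 v u = - cross3 u v" by (rule cross_skew)
  then show ?thesis
    by (simp add: Cross3.left_diff_distrib Cross3.right_diff_distrib cross_mult_left cross_mult_right
        scaleR_left_diff_distrib)
qed

text \<open>Kelly's step: of three points on a line, two lie on the same side of the foot of the perpendicular from a further
  point, and the nearer one of them is closer to the line joining that point and the other one.\<close>

lemma kelly_step:
  fixes u v :: "real^3"
  assumes uv: "cross3 u v \<noteq> 0" and st: "s \<noteq> t" "(t - s)\<^sup>2 \<le> (t - (v \<bullet> u) / (u \<bullet> u))\<^sup>2"
  shows "norm (cross3 (t *\<^sub>R u - v) (s *\<^sub>R u - v)) / norm (t *\<^sub>R u - v) < norm (cross3 u v) / norm u"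
proof -
  \<comment> \<open>The quotients in the claim are distances from a point to a line. Here
    \<open>m\<close> is the parameter of the foot of the perpendicular from \<open>v\<close> to the
    line along \<open>u\<close>, and \<open>w\<close> is the perpendicular part of \<open>v\<close>;
    Pythagoras then makes \<open>t *\<^sub>R u - v\<close> strictly longer than
    \<open>(t - s) *\<^sub>R u\<close>.\<close>
  have u0: "u \<noteq> 0" using uv by auto
  define m where "m = (v \<bullet> u) / (u \<bullet> u)"
  define w where "w = v - m *\<^sub>R u"
  have wu: "w \<bullet> u = 0" using u0 by (simp add: w_def m_def inner_diff_left)
  have w0: "w \<noteq> 0"
  proof
    assume "w = 0"
    then have "v = m *\<^sub>R u" by (simp add: w_def)
    then show False using uv by (simp add: cross_mult_right)
  qed
  have tv: "t *\<^sub>R u - v = (t - m) *\<^sub>R u - w" by (simp add: w_def algebra_simps)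
  have "(norm (t *\<^sub>R u - v))\<^sup>2 = (t - m)\<^sup>2 * (norm u)\<^sup>2 + (norm w)\<^sup>2"
    unfolding tv power2_norm_eq_inner
    by (simp add: inner_diff_left inner_diff_right wu inner_commute[of u w] power2_eq_square)
  moreover have "0 < (norm w)\<^sup>2" using w0 by simp
  ultimately have "(t - m)\<^sup>2 * (norm u)\<^sup>2 < (norm (t *\<^sub>R u - v))\<^sup>2" by linarith
  then have "((t - s) * norm u)\<^sup>2 < (norm (t *\<^sub>R u - v))\<^sup>2"
    using mult_right_mono[OF st(2), of "(norm u)\<^sup>2"] unfolding power_mult_distrib m_def by simp
  then have lt: "\<bar>t - s\<bar> * norm u < norm (t *\<^sub>R u - v)"
    using power2_less_imp_less[of "\<bar>t - s\<bar> * norm u" "norm (t *\<^sub>R u - v)"] by (simp add: power_mult_distrib)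
  have "cross3 (t *\<^sub>R u - v) (s *\<^sub>R u - v) = (s - t) *\<^sub>R cross3 u v"
    by (rule cross3_pencil)
  then have "norm (cross3 (t *\<^sub>R u - v) (s *\<^sub>R u - v)) = \<bar>t - s\<bar> * norm (cross3 u v)"
    by (simp add: abs_minus_commute)
  moreover have "\<bar>t - s\<bar> * norm (cross3 u v) / norm (t *\<^sub>R u - v) < norm (cross3 u v) / norm u"
  proof -
    have p: "0 < norm (t *\<^sub>R u - v)"
      using lt by (rule le_less_trans[rotated]) simp
    have "(\<bar>t - s\<bar> * norm u) * norm (cross3 u v) < norm (t *\<^sub>R u - v) * norm (cross3 u v)"
      using lt uv by (intro mult_strict_right_mono) simp_all
    moreover have "0 < norm u" using u0 by simp
    ultimately show ?thesis using p by (simp add: pos_divide_less_eq pos_less_divide_eq mult_ac)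
  qed
  ultimately show ?thesis by simp
qed

text \<open>Choose a line through two points and a point off it at the smallest positive distance. A
  third point on that line would allow Kelly's step and yield a smaller distance.\<close>

theorem sylvester_gallai:
  assumes S: "finite S" and nc: "a0 \<in> S" "b0 \<in> S" "c0 \<in> S" "cross3 (b0 - a0) (c0 - a0) \<noteq> 0"
  obtains a b where "a \<in> S" "b \<in> S" "a \<noteq> b" "S \<inter> line_of a b = {a, b}"
proof -
  define T where "T = {(a, b, c) \<in> S \<times> S \<times> S. cross3 (b - a) (c - a) \<noteq> 0}"
  define d where "d = (\<lambda>(a, b, c). norm (cross3 (b - a) (c - a)) / norm (b - a))"
  have "finite T" unfolding T_def by (rule finite_subset[of _ "S \<times> S \<times> S"]) (use S in auto)
  moreover have "T \<noteq> {}" using nc by (auto simp: T_def)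
  ultimately obtain x where x: "x \<in> T" "\<And>y. y \<in> T \<Longrightarrow> - d y \<le> - d x"
    using finite_has_max_by[of T "\<lambda>x. - d x"] by blast
  obtain a b c where abc: "x = (a, b, c)" by (cases x)
  have S_abc: "a \<in> S" "b \<in> S" "c \<in> S" and n: "cross3 (b - a) (c - a) \<noteq> 0" using x(1) abc by (auto simp: T_def)
  have ab: "a \<noteq> b" using n by auto
  have min: "d x \<le> d y" if "y \<in> T" for y using x(2)[OF that] by simp
  have "S \<inter> line_of a b = {a, b}"
  proof (rule ccontr)
    assume "S \<inter> line_of a b \<noteq> {a, b}"
    then obtain e where e: "e \<in> S" "e \<in> line_of a b" "e \<noteq> a" "e \<noteq> b" using S_abc by auto
    then obtain r where r: "e = a + r *\<^sub>R (b - a)" using ab by (auto simp: mem_line_of_iff)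
    have r01: "0 \<noteq> r" "1 \<noteq> r" using r e by auto
    define u where "u = b - a"
    define v where "v = c - a"
    \<comment> \<open>The parameters 0, 1 and \<open>r\<close> belong to \<open>a\<close>,
      \<open>b\<close> and the third point \<open>e\<close> on their line.\<close>
    obtain s t where st: "s \<in> {0, 1, r}" "t \<in> {0, 1, r}" "s \<noteq> t" "(t - s)\<^sup>2 \<le> (t - (v \<bullet> u) / (u \<bullet> u))\<^sup>2"
      using same_side[of 0 1 r] r01 by auto
    have inS: "a + q *\<^sub>R u \<in> S" if "q \<in> {0, 1, r}" for q
      using that S_abc e r by (auto simp: u_def)
    have uv: "cross3 u v \<noteq> 0" using n by (simp add: u_def v_def)
    have nz: "cross3 (t *\<^sub>R u - v) (s *\<^sub>R u - v) \<noteq> 0"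
    proof -
      have "cross3 (t *\<^sub>R u - v) (s *\<^sub>R u - v) = (s - t) *\<^sub>R cross3 u v"
        by (rule cross3_pencil)
      then show ?thesis using st uv by simp
    qed
    define y where "y = (c, a + t *\<^sub>R u, a + s *\<^sub>R u)"
    have diffs: "a + t *\<^sub>R u - c = t *\<^sub>R u - v" "a + s *\<^sub>R u - c = s *\<^sub>R u - v" by (simp_all add: v_def)
    have "y \<in> T" using inS st S_abc nz by (simp add: T_def y_def diffs)
    then have "d x \<le> d y" by (rule min)
    moreover have "d y < d x"
      using kelly_step[OF uv st(3,4)] unfolding y_def abc d_def prod.case diffs u_def[symmetric] v_def[symmetric] .
    ultimately show False by simp
  qed
  then show ?thesis using that S_abc ab by blast
qed

section \<open>Spanned planes and ordinary lines\<close>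

definition spanned_planes :: "(real^3) set \<Rightarrow> (real^3) set set" where
  "spanned_planes P = {plane_of a b c | a b c. a \<in> P \<and> b \<in> P \<and> c \<in> P \<and> cross3 (b - a) (c - a) \<noteq> 0}"

lemma finite_spanned_planes: "finite P \<Longrightarrow> finite (spanned_planes P)"
proof -
  assume "finite P"
  moreover have "spanned_planes P \<subseteq> (\<lambda>(a, b, c). plane_of a b c) ` (P \<times> P \<times> P)"
    by (force simp: spanned_planes_def)
  ultimately show ?thesis by (meson finite_SigmaI finite_imageI finite_subset)
qed

text \<open>A line that is ordinary for \<open>P \<inter> H\<close> and lies in \<open>H\<close> is
  ordinary for \<open>P\<close>. Together with one further point of \<open>P\<close> in
  \<open>H\<close> off that line it determines \<open>H\<close>, so spanned planes inject into pairs
  of an ordinary line and a point.\<close>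

theorem card_spanned_planes_le:
  assumes P: "finite P"
  shows "card (spanned_planes P) \<le> card P * card (ordinary_lines P)"
proof -
  define good where "good = (\<lambda>H z. \<exists>a b. fst z = line_of a b \<and> a \<in> P \<and> b \<in> P \<and> P \<inter> line_of a b = {a, b} \<and>
      cross3 (b - a) (snd z - a) \<noteq> 0 \<and> snd z \<in> P \<and> H = plane_of a b (snd z))"
  have ex: "\<exists>z. good H z" if "H \<in> spanned_planes P" for H
  proof -
    obtain a0 b0 c0 where H: "a0 \<in> P" "b0 \<in> P" "c0 \<in> P" "cross3 (b0 - a0) (c0 - a0) \<noteq> 0" "H = plane_of a0 b0 c0"
      using \<open>H \<in> spanned_planes P\<close> unfolding spanned_planes_def by blast
    obtain a b where ab: "a \<in> P \<inter> H" "b \<in> P \<inter> H" "a \<noteq> b" "(P \<inter> H) \<inter> line_of a b = {a, b}"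
    proof (rule sylvester_gallai[of "P \<inter> H" a0 b0 c0])
      show "finite (P \<inter> H)" using P by simp
    qed (use H in auto)
    have "line_of a b \<subseteq> H" using ab H(5) by (auto intro: line_of_subset_plane_of[THEN subsetD])
    then have o: "P \<inter> line_of a b = {a, b}" using ab by blast
    have "\<exists>r\<in>{a0, b0, c0}. r \<notin> line_of a b"
    proof (rule ccontr)
      assume "\<not> ?thesis"
      then have "a0 \<in> line_of a b" "b0 \<in> line_of a b" "c0 \<in> line_of a b" by auto
      moreover have "a0 \<noteq> b0" using H(4) by auto
      ultimately have "c0 \<in> line_of a0 b0" using line_of_eq[of a0 a b b0] ab(3) by auto
      then show False using H(4) by (simp add: line_of_def)
    qed
    then obtain r where r: "r \<in> {a0, b0, c0}" "r \<notin> line_of a b" by blast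
    then have rP: "r \<in> P" "r \<in> H" using H by auto
    have nz: "cross3 (b - a) (r - a) \<noteq> 0" using r(2) by (simp add: line_of_def)
    then have "H = plane_of a b r" using plane_of_eq[of a a0 b0 c0 b r] ab rP H by auto
    then show ?thesis using ab o rP nz unfolding good_def by (intro exI[of _ "(line_of a b, r)"]) auto
  qed
  define z where "z = (\<lambda>H. SOME z. good H z)"
  have z: "good H (z H)" if "H \<in> spanned_planes P" for H
    using ex[OF that] unfolding z_def by (rule someI_ex)
  have "card (spanned_planes P) \<le> card (ordinary_lines P \<times> P)"
  proof (rule card_inj_on_le[of z])
    show "inj_on z (spanned_planes P)"
    proof (rule inj_onI)
      fix H H' assume HH: "H \<in> spanned_planes P" "H' \<in> spanned_planes P" "z H = z H'"
      obtain a b where a: "fst (z H) = line_of a b" "a \<in> P" "P \<inter> line_of a b = {a, b}" "b \<in> P"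
        "cross3 (b - a) (snd (z H) - a) \<noteq> 0" "H = plane_of a b (snd (z H))"
        using z[OF HH(1)] unfolding good_def by blast
      obtain a' b' where a': "fst (z H) = line_of a' b'" "P \<inter> line_of a' b' = {a', b'}"
        "cross3 (b' - a') (snd (z H) - a') \<noteq> 0" "H' = plane_of a' b' (snd (z H))"
        using z[OF HH(2)] unfolding good_def HH(3) by blast
      have "{a, b} = {a', b'}" using a a' by metis
      then have "a \<in> H'" "b \<in> H'" using a'(4) by (metis in_plane_of insertI1 insertI2 insertE singletonD)+
      then show "H = H'" using plane_of_eq[of a a' b' "snd (z H)" b "snd (z H)"] a a' by auto
    qed
    show "z ` spanned_planes P \<subseteq> ordinary_lines P \<times> P"
    proof (rule image_subsetI)
      fix H assume "H \<in> spanned_planes P"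
      then obtain a b where a: "fst (z H) = line_of a b" "P \<inter> line_of a b = {a, b}"
        "cross3 (b - a) (snd (z H) - a) \<noteq> 0" "snd (z H) \<in> P"
        using z unfolding good_def by blast
      have "a \<noteq> b" using a(3) by auto
      then have "fst (z H) \<in> ordinary_lines P"
        using a is_line_line_of by (simp add: ordinary_lines_def)
      then show "z H \<in> ordinary_lines P \<times> P" using a(4) by (metis mem_Times_iff)
    qed
    show "finite (ordinary_lines P \<times> P)" using P finite_ordinary_lines by blast
  qed
  then show ?thesis by (simp add: card_cartesian_product mult.commute)
qed

text \<open>Stated for an arbitrary set of non-collinear triples, since the two cases use different
  ones: all triples in planes with few points, and triples with one point on a rich line and one in
  each of two planes through it.\<close>

corollary ordinary_lines_from_triples:
  fixes M :: nat
  assumes P: "finite P" and T: "finite T"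
    and tri: "\<And>a b c. (a, b, c) \<in> T \<Longrightarrow> a \<in> P \<and> b \<in> P \<and> c \<in> P \<and> cross3 (b - a) (c - a) \<noteq> 0"
    and fib: "\<And>H. H \<in> spanned_planes P \<Longrightarrow> card {(a, b, c) \<in> T. plane_of a b c = H} \<le> M"
  shows "card T \<le> M * (card P * card (ordinary_lines P))"
proof -
  have "T \<subseteq> (\<Union>H\<in>spanned_planes P. {(a, b, c) \<in> T. plane_of a b c = H})"
    using tri by (fastforce simp: spanned_planes_def)
  then have "card T \<le> card (\<Union>H\<in>spanned_planes P. {(a, b, c) \<in> T. plane_of a b c = H})"
    using T finite_spanned_planes[OF P] by (intro card_mono finite_UN_I) (auto intro: finite_subset[OF _ T])
  also have "\<dots> \<le> (\<Sum>H\<in>spanned_planes P. card {(a, b, c) \<in> T. plane_of a b c = H})"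
    by (rule card_UN_le[OF finite_spanned_planes[OF P]])
  also have "\<dots> \<le> card (spanned_planes P) * M" using fib sum_bounded_above[of "spanned_planes P" _ M] by simp
  also have "\<dots> \<le> M * (card P * card (ordinary_lines P))"
    using card_spanned_planes_le[OF P] by (simp add: mult.commute)
  finally show ?thesis .
qed

section \<open>Generic projections from space to the plane\<close>

text \<open>Finitely many planes through the origin have measure zero and cannot cover
  space.\<close>

lemma ex_generic_vector:
  fixes A :: "(real^3) set"
  assumes "finite A" "0 \<notin> A"
  shows "\<exists>f. \<forall>a\<in>A. f \<bullet> a \<noteq> 0"
proof -
  have "negligible (\<Union>a\<in>A. {x. a \<bullet> x = 0})"
    using assms by (intro negligible_Union) (auto intro!: negligible_hyperplane)
  then have "(\<Union>a\<in>A. {x. a \<bullet> x = 0}) \<noteq> UNIV" using non_negligible_UNIV by metis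
  then show ?thesis by (auto simp: inner_commute)
qed

text \<open>Since \<open>cross3 f g \<bullet> c\<close> equals
  \<open>g \<bullet> cross3 c f\<close>, a generic \<open>g\<close> works as soon as
  \<open>f\<close> is parallel to no \<open>c\<close>. This is arranged by keeping \<open>f\<close>
  from being orthogonal to some nonzero vector \<open>d c\<close> that is itself orthogonal to
  \<open>c\<close>.\<close>

lemma ex_generic_pair:
  fixes A C :: "(real^3) set"
  assumes "finite A" "0 \<notin> A" "finite C" "0 \<notin> C"
  shows "\<exists>f g. (\<forall>a\<in>A. f \<bullet> a \<noteq> 0) \<and> (\<forall>c\<in>C. cross3 f g \<bullet> c \<noteq> 0) \<and> cross3 f g \<noteq> 0"
proof -
  \<comment> \<open>The extra vector forces \<open>cross3 f g\<close> to be nonzero even when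
    \<open>C\<close> is empty.\<close>
  define C' where "C' = insert (axis 1 1) C"
  have C': "finite C'" "0 \<notin> C'" using assms by (auto simp: C'_def axis_eq_0_iff)
  have "\<exists>d. d \<noteq> 0 \<and> d \<bullet> c = 0" if "c \<in> C'" for c
  proof -
    have "c \<noteq> 0" using that C' by auto
    then obtain e where "cross3 c e \<noteq> 0" using cross_basis_nonzero by blast
    then show ?thesis using dot_cross_self(1)[of c e] by (metis inner_commute)
  qed
  then obtain d where d: "\<And>c. c \<in> C' \<Longrightarrow> d c \<noteq> 0 \<and> d c \<bullet> c = 0" by metis
  obtain f where f: "\<forall>a\<in>A \<union> d ` C'. f \<bullet> a \<noteq> 0"
    using ex_generic_vector[of "A \<union> d ` C'"] assms C' d by fastforce
  have cf: "cross3 c f \<noteq> 0" if "c \<in> C'" for c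
  proof
    assume "cross3 c f = 0"
    moreover have "c \<noteq> 0" using that C' by auto
    ultimately obtain t where "f = t *\<^sub>R c" using cross3_eq_0_iff by blast
    then show False using f d[OF that] that by (auto simp: inner_commute)
  qed
  obtain g where g: "\<forall>a\<in>(\<lambda>c. cross3 c f) ` C'. g \<bullet> a \<noteq> 0"
    using ex_generic_vector[of "(\<lambda>c. cross3 c f) ` C'"] C' cf by fastforce
  have fg: "cross3 f g \<bullet> c \<noteq> 0" if "c \<in> C'" for c
    using g that cross_triple[of c f g] by (auto simp: inner_commute)
  then have "cross3 f g \<noteq> 0" by (force simp: C'_def)
  then show ?thesis using f fg by (intro exI[of _ f] exI[of _ g]) (auto simp: C'_def)
qed

text \<open>For the map with coordinates \<open>f \<bullet> q\<close> and
  \<open>g \<bullet> q\<close>, the planar collinearity determinant is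
  \<open>cross3 f g \<bullet> cross3 (q - p) (r - p)\<close>. Genericity of \<open>f\<close> makes
  first coordinates distinct, and genericity of \<open>cross3 f g\<close> creates no new
  collinearities.\<close>

lemma linear_projection:
  assumes P: "finite P"
  obtains \<phi> :: "real^3 \<Rightarrow> real \<times> real" where "inj_on \<phi> P" "inj_on fst (\<phi> ` P)"
    "\<And>p q r. p \<in> P \<Longrightarrow> q \<in> P \<Longrightarrow> r \<in> P \<Longrightarrow> pcoll (\<phi> p) (\<phi> q) (\<phi> r) \<longleftrightarrow> r \<in> line_of p q"
proof -
  define A where "A = (\<lambda>(p, q). q - p) ` (P \<times> P) - {0}"
  define C where "C = (\<lambda>(p, q, r). cross3 (q - p) (r - p)) ` (P \<times> P \<times> P) - {0}"
  obtain f g where f: "\<forall>a\<in>A. f \<bullet> a \<noteq> 0" and fg: "\<forall>c\<in>C. cross3 f g \<bullet> c \<noteq> 0"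
  proof -
    have "finite A" "0 \<notin> A" "finite C" "0 \<notin> C" using P by (auto simp: A_def C_def)
    then show ?thesis using ex_generic_pair[of A C] that by blast
  qed
  define \<phi> where "\<phi> = (\<lambda>q. (f \<bullet> q, g \<bullet> q))"
  have inj: "p = q" if "p \<in> P" "q \<in> P" "f \<bullet> p = f \<bullet> q" for p q
  proof (rule ccontr)
    assume "p \<noteq> q"
    then have "q - p \<in> A" using that by (force simp: A_def)
    then show False using f that(3) by (auto simp: inner_diff_right)
  qed
  have "pcoll (\<phi> p) (\<phi> q) (\<phi> r) \<longleftrightarrow> r \<in> line_of p q" if "p \<in> P" "q \<in> P" "r \<in> P" for p q r
  proof -
    have "pcoll (\<phi> p) (\<phi> q) (\<phi> r) \<longleftrightarrow> cross3 f g \<bullet> cross3 (q - p) (r - p) = 0"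
      by (simp add: pcoll_def \<phi>_def dot_cross inner_diff_right algebra_simps)
    also have "\<dots> \<longleftrightarrow> cross3 (q - p) (r - p) = 0"
      using fg that by (force simp: C_def)
    finally show ?thesis by (simp add: line_of_def)
  qed
  moreover have "inj_on \<phi> P" "inj_on fst (\<phi> ` P)"
    using inj by (auto simp: inj_on_def \<phi>_def)
  ultimately show ?thesis using that by blast
qed

text \<open>The product rule for determinants: the left side expands the determinant of the inner
  products of \<open>f\<close>, \<open>g\<close>, \<open>h\<close> with \<open>a\<close>,
  \<open>b\<close>, \<open>c\<close> along the entries of \<open>a\<close>. The proof pairs Cramer's
  expansion of \<open>a\<close> with \<open>cross3 b c\<close>.\<close>

lemma cross3_triple_product:
  "(f \<bullet> a) * ((g \<bullet> b) * (h \<bullet> c) - (h \<bullet> b) * (g \<bullet> c)) - (g \<bullet> a) * ((f \<bullet> b) * (h \<bullet> c) - (h \<bullet> b) * (f \<bullet> c)) +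
   (h \<bullet> a) * ((f \<bullet> b) * (g \<bullet> c) - (g \<bullet> b) * (f \<bullet> c)) = (cross3 f g \<bullet> h) * (cross3 a b \<bullet> c)"
proof -
  have 1: "cross3 g h \<bullet> cross3 b c = (g \<bullet> b) * (h \<bullet> c) - (h \<bullet> b) * (g \<bullet> c)"
    by (simp add: dot_cross mult.commute)
  have 2: "cross3 f h \<bullet> cross3 b c = (f \<bullet> b) * (h \<bullet> c) - (h \<bullet> b) * (f \<bullet> c)"
    by (simp add: dot_cross mult.commute)
  have 3: "cross3 f g \<bullet> cross3 b c = (f \<bullet> b) * (g \<bullet> c) - (g \<bullet> b) * (f \<bullet> c)"
    by (simp add: dot_cross mult.commute)
  have "(f \<bullet> a) *\<^sub>R cross3 g h - (g \<bullet> a) *\<^sub>R cross3 f h + (h \<bullet> a) *\<^sub>R cross3 f g = (cross3 f g \<bullet> h) *\<^sub>R a"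
    by (simp add: vec_eq_iff forall_3 cross_components inner_vec_def sum_3 algebra_simps)
  then have "((f \<bullet> a) *\<^sub>R cross3 g h - (g \<bullet> a) *\<^sub>R cross3 f h + (h \<bullet> a) *\<^sub>R cross3 f g) \<bullet> cross3 b c =
     ((cross3 f g \<bullet> h) *\<^sub>R a) \<bullet> cross3 b c"
    by simp
  then show ?thesis
    by (simp add: inner_add_left inner_diff_left 1 2 3 cross_triple[of a b c] inner_commute[of a])
qed

text \<open>The quotients \<open>G q / F q\<close> and \<open>H q / F q\<close> are affine
  coordinates on the projective plane of directions at \<open>p\<close>. Collinearity of three
  images is the vanishing of a determinant, which by the product rule means that the three points
  are coplanar with \<open>p\<close>. Generic \<open>f\<close> and \<open>g\<close> make the first
  coordinate alone separate the lines through \<open>p\<close>.\<close>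

lemma central_projection:
  assumes P: "finite P" and p: "p \<notin> P"
  obtains \<phi> :: "real^3 \<Rightarrow> real \<times> real" where "inj_on fst (\<phi> ` P)"
    "\<And>q r. q \<in> P \<Longrightarrow> r \<in> P \<Longrightarrow> \<phi> q = \<phi> r \<longleftrightarrow> r \<in> line_of p q"
    "\<And>q r s. q \<in> P \<Longrightarrow> r \<in> P \<Longrightarrow> s \<in> P \<Longrightarrow> pcoll (\<phi> q) (\<phi> r) (\<phi> s) \<longleftrightarrow> s \<in> plane_of p q r"
proof -
  define A where "A = (\<lambda>q. q - p) ` P"
  define C where "C = (\<lambda>(q, r). cross3 (q - p) (r - p)) ` (P \<times> P) - {0}"
  obtain f g where f: "\<forall>a\<in>A. f \<bullet> a \<noteq> 0" and fg: "\<forall>c\<in>C. cross3 f g \<bullet> c \<noteq> 0" and fg0: "cross3 f g \<noteq> 0"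
  proof -
    have "0 \<notin> A" using p by (force simp: A_def)
    moreover have "finite A" "finite C" "0 \<notin> C" using P by (auto simp: A_def C_def)
    ultimately show ?thesis using ex_generic_pair[of A C] that by blast
  qed
  \<comment> \<open>With this choice the determinant of \<open>f\<close>, \<open>g\<close>,
    \<open>h\<close> is \<open>h \<bullet> h\<close>, which is positive.\<close>
  define h where "h = cross3 f g"
  define F where "F = (\<lambda>q. f \<bullet> (q - p))"
  define G where "G = (\<lambda>q. g \<bullet> (q - p))"
  define H where "H = (\<lambda>q. h \<bullet> (q - p))"
  have F0: "F q \<noteq> 0" if "q \<in> P" for q using f that by (auto simp: A_def F_def)
  define \<phi> where "\<phi> = (\<lambda>q. (G q / F q, H q / F q))"
  have fst_iff: "fst (\<phi> q) = fst (\<phi> r) \<longleftrightarrow> cross3 (q - p) (r - p) = 0" if "q \<in> P" "r \<in> P" for q r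
  proof -
    have "fst (\<phi> q) = fst (\<phi> r) \<longleftrightarrow> cross3 f g \<bullet> cross3 (q - p) (r - p) = 0"
      using F0[OF that(1)] F0[OF that(2)]
      by (auto simp: \<phi>_def field_simps dot_cross F_def G_def)
    also have "\<dots> \<longleftrightarrow> cross3 (q - p) (r - p) = 0"
      using fg that by (force simp: C_def)
    finally show ?thesis .
  qed
  have phi_eq: "\<phi> q = \<phi> r" if qr: "q \<in> P" "r \<in> P" "cross3 (q - p) (r - p) = 0" for q r
  proof -
    have "q - p \<noteq> 0" using qr p by auto
    then obtain t where t: "r - p = t *\<^sub>R (q - p)" using qr(3) cross3_eq_0_iff by blast
    have "t \<noteq> 0" using t qr p by auto
    then show ?thesis by (simp add: \<phi>_def F_def G_def H_def t)
  qed
  have coll: "pcoll (\<phi> q) (\<phi> r) (\<phi> s) \<longleftrightarrow> s \<in> plane_of p q r" if "q \<in> P" "r \<in> P" "s \<in> P" for q r s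
  proof -
    have nz: "F q \<noteq> 0" "F r \<noteq> 0" "F s \<noteq> 0" using F0 that by auto
    have "pcoll (\<phi> q) (\<phi> r) (\<phi> s) \<longleftrightarrow>
      F q * (G r * H s - H r * G s) - G q * (F r * H s - H r * F s) + H q * (F r * G s - G r * F s) = 0"
    proof -
      have "pcoll (\<phi> q) (\<phi> r) (\<phi> s) \<longleftrightarrow>
          (G r * F q - G q * F r) * (H s * F q - H q * F s) = (G s * F q - G q * F s) * (H r * F q - H q * F r)"
        using nz by (simp add: pcoll_def \<phi>_def diff_frac_eq frac_eq_eq)
      also have "\<dots> \<longleftrightarrow> F q * (F q * (G r * H s - H r * G s) - G q * (F r * H s - H r * F s) + H q * (F r * G s - G r * F s)) = 0"
        by (simp add: algebra_simps)
      finally show ?thesis using nz(1) by simp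
    qed
    also have "\<dots> \<longleftrightarrow> (cross3 f g \<bullet> h) * (cross3 (q - p) (r - p) \<bullet> (s - p)) = 0"
      unfolding F_def G_def H_def cross3_triple_product ..
    also have "\<dots> \<longleftrightarrow> s \<in> plane_of p q r" using fg0 by (simp add: h_def plane_of_def)
    finally show ?thesis .
  qed
  have "inj_on fst (\<phi> ` P)"
  proof (rule inj_onI)
    fix u v assume "u \<in> \<phi> ` P" "v \<in> \<phi> ` P" and uv: "fst u = fst v"
    then obtain q r where qr: "q \<in> P" "r \<in> P" "u = \<phi> q" "v = \<phi> r" by blast
    then show "u = v" using phi_eq[OF qr(1,2)] fst_iff[OF qr(1,2)] uv by simp
  qed
  moreover have "\<phi> q = \<phi> r \<longleftrightarrow> r \<in> line_of p q" if qr: "q \<in> P" "r \<in> P" for q r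
  proof
    assume "\<phi> q = \<phi> r"
    then show "r \<in> line_of p q" using fst_iff[OF qr] by (simp add: line_of_def)
  next
    assume "r \<in> line_of p q"
    then show "\<phi> q = \<phi> r" using phi_eq[OF qr] by (simp add: line_of_def)
  qed
  ultimately show ?thesis using coll that by blast
qed

theorem card_medium_line_pairs_le:
  fixes D :: real
  assumes P: "finite P" and k: "2 \<le> k" and D: "0 \<le> D"
  shows "real (card {(p, q) \<in> P \<times> P. p \<noteq> q \<and> k \<le> card (P \<inter> line_of p q) \<and> real (card (P \<inter> line_of p q)) \<le> D})
    \<le> 2304 * ((real (card P))\<^sup>2 / real k + real (card P) * D)"
proof -
  obtain \<phi> :: "real^3 \<Rightarrow> real \<times> real" where phi: "inj_on \<phi> P" "inj_on fst (\<phi> ` P)"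
    "\<And>p q r. p \<in> P \<Longrightarrow> q \<in> P \<Longrightarrow> r \<in> P \<Longrightarrow> pcoll (\<phi> p) (\<phi> q) (\<phi> r) \<longleftrightarrow> r \<in> line_of p q"
    using linear_projection[OF P] by blast
  define V where "V = \<phi> ` P"
  have c: "card {w\<in>V. pcoll (\<phi> p) (\<phi> q) w} = card (P \<inter> line_of p q)" if "p \<in> P" "q \<in> P" for p q
  proof -
    have "{w\<in>V. pcoll (\<phi> p) (\<phi> q) w} = \<phi> ` (P \<inter> line_of p q)" using phi(3)[OF that] by (auto simp: V_def)
    moreover have "inj_on \<phi> (P \<inter> line_of p q)" using phi(1) by (rule inj_on_subset) auto
    ultimately show ?thesis by (simp add: card_image)
  qed
  have "card {(p, q) \<in> P \<times> P. p \<noteq> q \<and> k \<le> card (P \<inter> line_of p q) \<and> real (card (P \<inter> line_of p q)) \<le> D} \<le>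
    card {(u, v) \<in> V \<times> V. u \<noteq> v \<and> k \<le> card {w\<in>V. pcoll u v w} \<and> real (card {w\<in>V. pcoll u v w}) \<le> D}"
  proof (rule card_inj_on_le[of "map_prod \<phi> \<phi>"])
    show "inj_on (map_prod \<phi> \<phi>) {(p, q) \<in> P \<times> P. p \<noteq> q \<and> k \<le> card (P \<inter> line_of p q) \<and> real (card (P \<inter> line_of p q)) \<le> D}"
      by (rule inj_on_subset[OF map_prod_inj_on[OF phi(1) phi(1)]]) auto
    show "map_prod \<phi> \<phi> ` {(p, q) \<in> P \<times> P. p \<noteq> q \<and> k \<le> card (P \<inter> line_of p q) \<and> real (card (P \<inter> line_of p q)) \<le> D} \<subseteq>
      {(u, v) \<in> V \<times> V. u \<noteq> v \<and> k \<le> card {w\<in>V. pcoll u v w} \<and> real (card {w\<in>V. pcoll u v w}) \<le> D}"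
    proof (rule image_subsetI)
      fix x assume "x \<in> {(p, q) \<in> P \<times> P. p \<noteq> q \<and> k \<le> card (P \<inter> line_of p q) \<and> real (card (P \<inter> line_of p q)) \<le> D}"
      then obtain p q where x: "x = (p, q)" "p \<in> P" "q \<in> P" "p \<noteq> q" "k \<le> card (P \<inter> line_of p q)" "real (card (P \<inter> line_of p q)) \<le> D"
        by auto
      have "\<phi> p \<noteq> \<phi> q" using x phi(1) by (auto dest: inj_onD)
      then show "map_prod \<phi> \<phi> x \<in> {(u, v) \<in> V \<times> V. u \<noteq> v \<and> k \<le> card {w\<in>V. pcoll u v w} \<and> real (card {w\<in>V. pcoll u v w}) \<le> D}"
        unfolding x(1) using x c[OF x(2,3)] by (simp add: V_def)
    qed
    show "finite {(u, v) \<in> V \<times> V. u \<noteq> v \<and> k \<le> card {w\<in>V. pcoll u v w} \<and> real (card {w\<in>V. pcoll u v w}) \<le> D}"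
      by (rule finite_subset[of _ "V \<times> V"]) (use P in \<open>auto simp: V_def\<close>)
  qed
  also have "real (card {(u, v) \<in> V \<times> V. u \<noteq> v \<and> k \<le> card {w\<in>V. pcoll u v w} \<and> real (card {w\<in>V. pcoll u v w}) \<le> D})
      \<le> 2304 * ((real (card V))\<^sup>2 / real k + real (card V) * D)"
    by (rule card_medium_pairs_le) (use P phi k D in \<open>auto simp: V_def\<close>)
  finally show ?thesis using phi(1) by (simp add: V_def card_image)
qed

section \<open>Point sets without rich lines\<close>

lemma card_Int_line_of_minus:
  assumes "finite P" "p \<in> P"
  shows "card {r\<in>P - {p}. r \<in> line_of p q} = card (P \<inter> line_of p q) - 1"
proof -
  have "{r\<in>P - {p}. r \<in> line_of p q} = (P \<inter> line_of p q) - {p}" by auto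
  then show ?thesis using assms by (simp add: card_Diff_singleton)
qed

text \<open>The weighted bound applied to the central projection from \<open>p\<close>. The
  thresholds \<open>K + 1\<close> and \<open>B + 1\<close> exceed \<open>K\<close> and
  \<open>B\<close> by one because \<open>p\<close> lies on all these lines and planes but is absent
  from the projected set.\<close>

lemma bad_pairs_at_point:
  fixes D \<alpha> :: real
  assumes P: "finite P" "p \<in> P" and k: "2 \<le> k" and D: "2 \<le> D" and \<alpha>: "0 \<le> \<alpha>" and B: "K < B"
    and planes: "\<And>H. is_plane H \<Longrightarrow> real (card (P \<inter> H)) \<le> \<alpha> * real (card P)"
  defines "n \<equiv> real (card P)"
  shows "real (card {(q, r) \<in> (P - {p}) \<times> (P - {p}). card (P \<inter> line_of p q) \<le> K + 1 \<and> card (P \<inter> line_of p r) \<le> K + 1 \<and>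
      (cross3 (q - p) (r - p) = 0 \<or> B + 1 < card (P \<inter> plane_of p q r))})
    \<le> n * real K + (real K)\<^sup>2 * (2304 * (n\<^sup>2 / real k + n * D)) +
      (\<alpha> * n\<^sup>2 + real K * (576 * n\<^sup>2 / D ^ 3 + 12 * n / D)\<^sup>2 * n) +
      n\<^sup>2 * real (k * K) / real (B - K)"
proof -
  define Q where "Q = P - {p}"
  have Q: "finite Q" "p \<notin> Q" "card Q \<le> card P" using P by (auto simp: Q_def card_Diff_subset)
  obtain \<phi> :: "real^3 \<Rightarrow> real \<times> real" where phi: "inj_on fst (\<phi> ` Q)"
    "\<And>q r. q \<in> Q \<Longrightarrow> r \<in> Q \<Longrightarrow> \<phi> q = \<phi> r \<longleftrightarrow> r \<in> line_of p q"
    "\<And>q r s. q \<in> Q \<Longrightarrow> r \<in> Q \<Longrightarrow> s \<in> Q \<Longrightarrow> pcoll (\<phi> q) (\<phi> r) (\<phi> s) \<longleftrightarrow> s \<in> plane_of p q r"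
    using central_projection[OF Q(1,2)] by blast
  have join: "on_join \<phi> Q q r = (P \<inter> plane_of p q r) - {p}" if "q \<in> Q" "r \<in> Q" for q r
    using phi(3)[OF that] by (auto simp: on_join_def Q_def)
  have cjoin: "card (on_join \<phi> Q q r) = card (P \<inter> plane_of p q r) - 1" if "q \<in> Q" "r \<in> Q" for q r
    using join[OF that] P by (simp add: card_Diff_singleton)
  have light: "q \<in> light \<phi> Q K" if "q \<in> Q" "card (P \<inter> line_of p q) \<le> K + 1" for q
  proof -
    have "{r\<in>Q. \<phi> r = \<phi> q} = {r\<in>P - {p}. r \<in> line_of p q}"
      using phi(2)[OF that(1)] unfolding Q_def by (metis (mono_tags, lifting))
    then show ?thesis using that card_Int_line_of_minus[OF P] by (simp add: light_def)
  qed
  have "card {(q, r) \<in> (P - {p}) \<times> (P - {p}). card (P \<inter> line_of p q) \<le> K + 1 \<and> card (P \<inter> line_of p r) \<le> K + 1 \<and>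
      (cross3 (q - p) (r - p) = 0 \<or> B + 1 < card (P \<inter> plane_of p q r))} \<le>
    card {(q, r) \<in> light \<phi> Q K \<times> light \<phi> Q K. \<phi> q = \<phi> r \<or> B < card (on_join \<phi> Q q r)}"
  proof (rule card_mono)
    show "finite {(q, r) \<in> light \<phi> Q K \<times> light \<phi> Q K. \<phi> q = \<phi> r \<or> B < card (on_join \<phi> Q q r)}"
      by (rule finite_subset[of _ "Q \<times> Q"]) (use Q in \<open>auto simp: light_def\<close>)
    show "{(q, r) \<in> (P - {p}) \<times> (P - {p}). card (P \<inter> line_of p q) \<le> K + 1 \<and> card (P \<inter> line_of p r) \<le> K + 1 \<and>
      (cross3 (q - p) (r - p) = 0 \<or> B + 1 < card (P \<inter> plane_of p q r))} \<subseteq>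
      {(q, r) \<in> light \<phi> Q K \<times> light \<phi> Q K. \<phi> q = \<phi> r \<or> B < card (on_join \<phi> Q q r)}"
    proof (rule subsetI)
      fix x assume "x \<in> {(q, r) \<in> (P - {p}) \<times> (P - {p}). card (P \<inter> line_of p q) \<le> K + 1 \<and> card (P \<inter> line_of p r) \<le> K + 1 \<and>
        (cross3 (q - p) (r - p) = 0 \<or> B + 1 < card (P \<inter> plane_of p q r))}"
      then obtain q r where x: "x = (q, r)" and
        a: "q \<in> P" "q \<noteq> p" "r \<in> P" "r \<noteq> p" "card (P \<inter> line_of p q) \<le> K + 1" "card (P \<inter> line_of p r) \<le> K + 1"
          "cross3 (q - p) (r - p) = 0 \<or> B + 1 < card (P \<inter> plane_of p q r)"
        by (cases x) simp
      have q: "q \<in> Q" "r \<in> Q" using a by (auto simp: Q_def)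
      have "\<phi> q = \<phi> r \<or> B < card (on_join \<phi> Q q r)"
        using a(7) phi(2)[OF q] cjoin[OF q] by (auto simp: line_of_def)
      then show "x \<in> {(q, r) \<in> light \<phi> Q K \<times> light \<phi> Q K. \<phi> q = \<phi> r \<or> B < card (on_join \<phi> Q q r)}"
        using light q a x by simp
    qed
  qed
  also have "real (card {(q, r) \<in> light \<phi> Q K \<times> light \<phi> Q K. \<phi> q = \<phi> r \<or> B < card (on_join \<phi> Q q r)})
    \<le> n * real K + (real K)\<^sup>2 * (2304 * (n\<^sup>2 / real k + n * D)) +
      (\<alpha> * n\<^sup>2 + real K * (576 * n\<^sup>2 / D ^ 3 + 12 * n / D)\<^sup>2 * n) +
      n\<^sup>2 * real (k * K) / real (B - K)"
    unfolding n_def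
  proof (rule weighted_beck[OF Q(1,3) refl phi(1) k D \<alpha> B])
    fix q r assume q: "q \<in> Q" "r \<in> Q" "\<phi> q \<noteq> \<phi> r"
    have "is_plane (plane_of p q r)" using phi(2)[OF q(1,2)] q(3) by (intro is_plane_plane_of) (auto simp: line_of_def)
    then have "real (card (P \<inter> plane_of p q r)) \<le> \<alpha> * real (card P)" by (rule planes)
    then show "real (card (on_join \<phi> Q q r)) \<le> \<alpha> * real (card P)" using cjoin[OF q(1,2)] by linarith
  qed
  finally show ?thesis by simp
qed

lemma card_image_Times_le:
  assumes "finite A" "finite B"
  shows "card (f ` (A \<times> B)) \<le> card A * card B"
  using assms by (metis card_cartesian_product finite_cartesian_product card_image_le)

text \<open>A triple outside the desired set has \<open>q\<close> or \<open>r\<close> equal to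
  \<open>p\<close> (\<open>X1\<close>, \<open>X2\<close>), or has \<open>q\<close> or
  \<open>r\<close> joined to \<open>p\<close> by a line with at least \<open>K + 2\<close> points
  (\<open>X3\<close>, \<open>X4\<close>), or forms a bad pair at \<open>p\<close>
  (\<open>X5\<close>); equal \<open>q\<close> and \<open>r\<close> fall under the latter two kinds.
  The upper bound \<open>D'\<close> for all lines turns the estimate for medium lines into one for
  all lines with at least \<open>K + 2\<close> points.\<close>

lemma card_poor_triples_ge:
  fixes D D' \<alpha> :: real
  assumes P: "finite P" and k: "2 \<le> k" and D: "2 \<le> D" and \<alpha>: "0 \<le> \<alpha>" and B: "K < B" and D': "0 \<le> D'"
    and planes: "\<And>H. is_plane H \<Longrightarrow> real (card (P \<inter> H)) \<le> \<alpha> * real (card P)"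
    and lines: "\<And>p q. p \<in> P \<Longrightarrow> q \<in> P \<Longrightarrow> p \<noteq> q \<Longrightarrow> real (card (P \<inter> line_of p q)) \<le> D'"
  defines "n \<equiv> real (card P)"
  shows "n ^ 3 \<le> real (card {(p, q, r) \<in> P \<times> P \<times> P. cross3 (q - p) (r - p) \<noteq> 0 \<and> card (P \<inter> plane_of p q r) \<le> B + 1})
    + 2 * n\<^sup>2 + 2 * (2304 * (n\<^sup>2 / real (K + 2) + n * D')) * n +
    n * (n * real K + (real K)\<^sup>2 * (2304 * (n\<^sup>2 / real k + n * D)) +
      (\<alpha> * n\<^sup>2 + real K * (576 * n\<^sup>2 / D ^ 3 + 12 * n / D)\<^sup>2 * n) +
      n\<^sup>2 * real (k * K) / real (B - K))"
    (is "_ \<le> real (card ?T) + _ + _ + n * ?bad")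
proof -
  define W where "W = {(p, q) \<in> P \<times> P. p \<noteq> q \<and> K + 2 \<le> card (P \<inter> line_of p q) \<and> real (card (P \<inter> line_of p q)) \<le> D'}"
  define bad where "bad = (\<lambda>p. {(q, r) \<in> (P - {p}) \<times> (P - {p}). card (P \<inter> line_of p q) \<le> K + 1 \<and> card (P \<inter> line_of p r) \<le> K + 1 \<and>
      (cross3 (q - p) (r - p) = 0 \<or> B + 1 < card (P \<inter> plane_of p q r))})"
  define X1 where "X1 = (\<lambda>(p, r). (p, p, r)) ` (P \<times> P)"
  define X2 where "X2 = (\<lambda>(p, q). (p, q, p)) ` (P \<times> P)"
  define X3 where "X3 = (\<lambda>((p, q), r). (p, q, r)) ` (W \<times> P)"
  define X4 where "X4 = (\<lambda>((p, r), q). (p, q, r)) ` (W \<times> P)"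
  define X5 where "X5 = (\<Union>p\<in>P. Pair p ` bad p)"
  have finW: "finite W" unfolding W_def by (rule finite_subset[of _ "P \<times> P"]) (use P in auto)
  have finbad: "finite (bad p)" for p unfolding bad_def by (rule finite_subset[of _ "P \<times> P"]) (use P in auto)
  have finT: "finite ?T" by (rule finite_subset[of _ "P \<times> P \<times> P"]) (use P in auto)
  have "P \<times> P \<times> P \<subseteq> ?T \<union> X1 \<union> X2 \<union> X3 \<union> X4 \<union> X5"
  proof
    fix x assume "x \<in> P \<times> P \<times> P"
    then obtain p q r where x: "x = (p, q, r)" and P': "p \<in> P" "q \<in> P" "r \<in> P" by auto
    consider "q = p" | "r = p" | "q \<noteq> p" "r \<noteq> p" "K + 2 \<le> card (P \<inter> line_of p q)"
      | "q \<noteq> p" "r \<noteq> p" "K + 2 \<le> card (P \<inter> line_of p r)"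
      | "q \<noteq> p" "r \<noteq> p" "card (P \<inter> line_of p q) \<le> K + 1" "card (P \<inter> line_of p r) \<le> K + 1" by linarith
    then show "x \<in> ?T \<union> X1 \<union> X2 \<union> X3 \<union> X4 \<union> X5"
    proof cases
      case 1
      then have "x \<in> X1" unfolding X1_def x using P' by force
      then show ?thesis by blast
    next
      case 2
      then have "x \<in> X2" unfolding X2_def x using P' by force
      then show ?thesis by blast
    next
      case 3
      then have "(p, q) \<in> W" using P' lines[of p q] by (simp add: W_def)
      then have "x \<in> X3" unfolding X3_def x using P' by force
      then show ?thesis by blast
    next
      case 4
      then have "(p, r) \<in> W" using P' lines[of p r] by (simp add: W_def)
      then have "x \<in> X4" unfolding X4_def x using P' by force
      then show ?thesis by blast
    next
      case 5
      show ?thesis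
      proof (cases "x \<in> ?T")
        case False
        then have "(q, r) \<in> bad p" using 5 P' unfolding x bad_def by (simp add: not_le)
        then have "x \<in> X5" unfolding X5_def x using P' by blast
        then show ?thesis by blast
      qed blast
    qed
  qed
  then have "card (P \<times> P \<times> P) \<le> card (?T \<union> X1 \<union> X2 \<union> X3 \<union> X4 \<union> X5)"
    using P finW finbad finT by (intro card_mono) (auto simp: X1_def X2_def X3_def X4_def X5_def)
  also have "\<dots> \<le> card ?T + card X1 + card X2 + card X3 + card X4 + card X5"
    by (meson add_le_mono card_Un_le le_refl order_trans)
  finally have "real (card (P \<times> P \<times> P)) \<le>
      real (card ?T) + real (card X1) + real (card X2) + real (card X3) + real (card X4) + real (card X5)"
    by linarith
  moreover have "real (card (P \<times> P \<times> P)) = n ^ 3"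
    by (simp add: card_cartesian_product n_def power3_eq_cube)
  moreover have "real (card X1) \<le> n\<^sup>2" "real (card X2) \<le> n\<^sup>2"
    unfolding X1_def X2_def n_def power2_eq_square of_nat_mult[symmetric] of_nat_le_iff
    by (rule card_image_Times_le[OF P P])+
  moreover have W: "real (card W) \<le> 2304 * (n\<^sup>2 / real (K + 2) + n * D')"
    unfolding W_def n_def by (rule card_medium_line_pairs_le) (use P D' in auto)
  have "real (card X3) \<le> real (card W) * n" "real (card X4) \<le> real (card W) * n"
    unfolding X3_def X4_def n_def of_nat_mult[symmetric] of_nat_le_iff
    by (rule card_image_Times_le[OF finW P])+
  moreover have "real (card W) * n \<le> (2304 * (n\<^sup>2 / real (K + 2) + n * D')) * n"
    using W by (rule mult_right_mono) (simp add: n_def)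
  moreover have "real (card X5) \<le> real (card P) * ?bad"
    unfolding X5_def
  proof (rule card_UN_le_mult[OF P])
    fix p assume p: "p \<in> P"
    have "card (Pair p ` bad p) \<le> card (bad p)" using finbad by (rule card_image_le)
    also have "real (card (bad p)) \<le> ?bad"
      unfolding bad_def n_def by (rule bad_pairs_at_point[OF P p k D \<alpha> B planes])
    finally show "real (card (Pair p ` bad p)) \<le> ?bad" by simp
  qed
  ultimately show ?thesis unfolding n_def by linarith
qed

lemma no_rich_line_case:
  fixes \<alpha> :: real
  assumes \<alpha>: "0 \<le> \<alpha>" "\<alpha> < 1"
  shows "\<exists>\<delta>>0. \<exists>c>0. \<exists>N::nat. \<forall>P::(real^3) set. finite P \<and> N \<le> card P \<and>
    (\<forall>H. is_plane H \<longrightarrow> real (card (P \<inter> H)) \<le> \<alpha> * real (card P)) \<and>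
    (\<forall>p\<in>P. \<forall>q\<in>P. p \<noteq> q \<longrightarrow> real (card (P \<inter> line_of p q)) \<le> \<delta> * real (card P)) \<longrightarrow>
    c * (real (card P))\<^sup>2 \<le> real (card (ordinary_lines P))"
proof -
  \<comment> \<open>The losses other than \<open>\<alpha> * n ^ 3\<close> will add up to ten times
    \<open>\<epsilon> * n ^ 3\<close>, which is half of
    \<open>(1 - \<alpha>) * n ^ 3\<close>.\<close>
  define \<epsilon> where "\<epsilon> = (1 - \<alpha>) / 20"
  have \<epsilon>: "0 < \<epsilon>" using \<alpha> by (simp add: \<epsilon>_def)
  \<comment> \<open>The order of choices matters: \<open>K\<close> depends on \<epsilon> only, then
    \<open>k\<close> and \<eta> must beat the factor \<open>K\<^sup>2\<close>, \<open>B\<close> must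
    beat \<open>k * K\<close>, and \<open>N\<close> comes last to absorb lower-order terms. The
    cutoff for rich planes through a point is \<eta> times the number of points, and
    \<open>h\<close> bounds how many there are.\<close>
  define K where "K = nat \<lceil>2304 / \<epsilon>\<rceil>"
  define k where "k = nat \<lceil>(real K)\<^sup>2 * 2304 / \<epsilon>\<rceil> + 2"
  define s where "s = (real K)\<^sup>2 + 1"
  have s: "0 < s" "(real K)\<^sup>2 \<le> s" by (simp_all add: s_def add_nonneg_pos)
  define \<eta> where "\<eta> = \<epsilon> / (2304 * s)"
  define B where "B = K + nat \<lceil>real (k * K) / \<epsilon>\<rceil> + 1"
  define \<delta> where "\<delta> = \<epsilon> / 2304"
  define h where "h = 576 / \<eta> ^ 3 + 12 / \<eta>"
  define N where "N = nat \<lceil>2 / \<eta> + real K / \<epsilon> + real K * h\<^sup>2 / \<epsilon> + 2 / \<epsilon>\<rceil> + 1"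
  have eta: "0 < \<eta>" using \<epsilon> s by (simp add: \<eta>_def)
  have delta: "0 < \<delta>" using \<epsilon> by (simp add: \<delta>_def)
  have "2304 / \<epsilon> \<le> real K" unfolding K_def by linarith
  then have cK: "2304 / real (K + 2) \<le> \<epsilon>" using \<epsilon> by (simp add: field_simps)
  have "(real K)\<^sup>2 * 2304 / \<epsilon> \<le> real k" "2 \<le> k" unfolding k_def by linarith+
  then have ck: "(real K)\<^sup>2 * 2304 / real k \<le> \<epsilon>" and k2: "2 \<le> k" using \<epsilon> by (simp_all add: field_simps)
  have "(real K)\<^sup>2 * 2304 * \<eta> \<le> s * 2304 * \<eta>" using s(2) eta by (intro mult_right_mono) simp_all
  also have "\<dots> = \<epsilon>" using s(1) by (simp add: \<eta>_def)
  finally have ceta: "(real K)\<^sup>2 * 2304 * \<eta> \<le> \<epsilon>" .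
  have KB: "K < B" by (simp add: B_def)
  have "real (k * K) / \<epsilon> \<le> real (B - K)" unfolding B_def by linarith
  then have cB: "real (k * K) / real (B - K) \<le> \<epsilon>"
    using \<epsilon> KB by (simp add: pos_divide_le_eq mult.commute)
  \<comment> \<open>A plane with at most \<open>B + 1\<close> points contains at most this many
    ordered triples.\<close>
  define M where "M = (B + 1) ^ 3"
  define c where "c = (1 - \<alpha>) / (2 * real M)"
  have c: "0 < c" using \<alpha> by (simp add: c_def M_def)
  have main: "c * (real (card P))\<^sup>2 \<le> real (card (ordinary_lines P))"
    if P: "finite P" "N \<le> card P" and planes: "\<And>H. is_plane H \<Longrightarrow> real (card (P \<inter> H)) \<le> \<alpha> * real (card P)"
      and lines: "\<And>p q. p \<in> P \<Longrightarrow> q \<in> P \<Longrightarrow> p \<noteq> q \<Longrightarrow> real (card (P \<inter> line_of p q)) \<le> \<delta> * real (card P)"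
    for P :: "(real^3) set"
  proof -
    define n where "n = real (card P)"
    have nN: "2 / \<eta> + real K / \<epsilon> + real K * h\<^sup>2 / \<epsilon> + 2 / \<epsilon> + 1 \<le> n"
      using P(2) unfolding n_def N_def by linarith
    have nn: "0 \<le> 2 / \<eta>" "0 \<le> real K / \<epsilon>" "0 \<le> real K * h\<^sup>2 / \<epsilon>" "0 \<le> 2 / \<epsilon>" using eta \<epsilon> by auto
    have n1: "1 \<le> n" using nN nn by linarith
    have n0: "0 < n" using n1 by simp
    have "2 / \<eta> \<le> n" using nN nn by linarith
    then have D: "2 \<le> \<eta> * n" using eta by (simp add: pos_divide_le_eq mult.commute)
    have "real K / \<epsilon> \<le> n" using nN nn by linarith
    then have nK: "real K \<le> \<epsilon> * n" using \<epsilon> by (simp add: pos_divide_le_eq mult.commute)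
    have "real K * h\<^sup>2 / \<epsilon> \<le> n" using nN nn by linarith
    then have nKh: "real K * h\<^sup>2 \<le> \<epsilon> * n" using \<epsilon> by (simp add: pos_divide_le_eq mult.commute)
    have "2 / \<epsilon> \<le> n" using nN nn by linarith
    then have n2: "2 \<le> \<epsilon> * n" using \<epsilon> by (simp add: pos_divide_le_eq mult.commute)
    define T where "T = {(p, q, r) \<in> P \<times> P \<times> P. cross3 (q - p) (r - p) \<noteq> 0 \<and> card (P \<inter> plane_of p q r) \<le> B + 1}"
    have t1: "2 * n\<^sup>2 \<le> \<epsilon> * n ^ 3"
      using mult_right_mono[OF n2, of "n\<^sup>2"] by (simp add: power2_eq_square power3_eq_cube mult.assoc)
    have t2: "2 * (2304 * (n\<^sup>2 / real (K + 2) + n * (\<delta> * n))) * n \<le> 4 * \<epsilon> * n ^ 3"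
    proof -
      have "2 * (2304 * (n\<^sup>2 / real (K + 2) + n * (\<delta> * n))) * n = 2 * (2304 / real (K + 2) + 2304 * \<delta>) * n ^ 3"
        by (simp add: algebra_simps power2_eq_square power3_eq_cube)
      also have "\<dots> \<le> 2 * (\<epsilon> + \<epsilon>) * n ^ 3"
        using cK n0 by (intro mult_right_mono) (auto simp: \<delta>_def)
      finally show ?thesis by simp
    qed
    have t3: "n * real K \<le> \<epsilon> * n\<^sup>2"
      using mult_left_mono[OF nK, of n] n0 by (simp add: power2_eq_square mult_ac)
    have t4: "(real K)\<^sup>2 * (2304 * (n\<^sup>2 / real k + n * (\<eta> * n))) \<le> 2 * \<epsilon> * n\<^sup>2"
    proof -
      have "(real K)\<^sup>2 * (2304 * (n\<^sup>2 / real k + n * (\<eta> * n))) = ((real K)\<^sup>2 * 2304 / real k + (real K)\<^sup>2 * 2304 * \<eta>) * n\<^sup>2"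
        by (simp add: algebra_simps power2_eq_square)
      also have "\<dots> \<le> (\<epsilon> + \<epsilon>) * n\<^sup>2" using ck ceta by (intro mult_right_mono add_mono) auto
      finally show ?thesis by simp
    qed
    have t5: "real K * (576 * n\<^sup>2 / (\<eta> * n) ^ 3 + 12 * n / (\<eta> * n))\<^sup>2 * n \<le> \<epsilon> * n\<^sup>2"
    proof -
      have "576 * n\<^sup>2 / (\<eta> * n) ^ 3 = 576 / (\<eta> ^ 3 * n)"
        using n0 by (simp add: power_mult_distrib power2_eq_square power3_eq_cube)
      also have "\<dots> \<le> 576 / \<eta> ^ 3" using n1 eta by (intro divide_left_mono) auto
      finally have "576 * n\<^sup>2 / (\<eta> * n) ^ 3 + 12 * n / (\<eta> * n) \<le> h"
        using n0 by (simp add: h_def)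
      moreover have "0 \<le> 576 * n\<^sup>2 / (\<eta> * n) ^ 3 + 12 * n / (\<eta> * n)" using n0 eta by simp
      ultimately have "(576 * n\<^sup>2 / (\<eta> * n) ^ 3 + 12 * n / (\<eta> * n))\<^sup>2 \<le> h\<^sup>2" by (rule power_mono)
      then have "real K * (576 * n\<^sup>2 / (\<eta> * n) ^ 3 + 12 * n / (\<eta> * n))\<^sup>2 \<le> real K * h\<^sup>2" by (rule mult_left_mono) simp
      then have "real K * (576 * n\<^sup>2 / (\<eta> * n) ^ 3 + 12 * n / (\<eta> * n))\<^sup>2 \<le> \<epsilon> * n" using nKh by linarith
      then have "real K * (576 * n\<^sup>2 / (\<eta> * n) ^ 3 + 12 * n / (\<eta> * n))\<^sup>2 * n \<le> \<epsilon> * n * n"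
        using n0 by (intro mult_right_mono) auto
      then show ?thesis by (simp add: power2_eq_square mult.assoc)
    qed
    have t6: "n\<^sup>2 * real (k * K) / real (B - K) \<le> \<epsilon> * n\<^sup>2"
      using mult_right_mono[OF cB, of "n\<^sup>2"] by (simp add: mult.commute)
    have "n * (n * real K + (real K)\<^sup>2 * (2304 * (n\<^sup>2 / real k + n * (\<eta> * n))) +
      (\<alpha> * n\<^sup>2 + real K * (576 * n\<^sup>2 / (\<eta> * n) ^ 3 + 12 * n / (\<eta> * n))\<^sup>2 * n) + n\<^sup>2 * real (k * K) / real (B - K))
      \<le> n * (\<epsilon> * n\<^sup>2 + 2 * \<epsilon> * n\<^sup>2 + (\<alpha> * n\<^sup>2 + \<epsilon> * n\<^sup>2) + \<epsilon> * n\<^sup>2)"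
      using t3 t4 t5 t6 n0 \<alpha>(1) by (intro mult_left_mono add_mono) simp_all
    also have "\<dots> = (\<alpha> + 5 * \<epsilon>) * n ^ 3" by (simp add: algebra_simps power2_eq_square power3_eq_cube)
    finally have t7: "n * (n * real K + (real K)\<^sup>2 * (2304 * (n\<^sup>2 / real k + n * (\<eta> * n))) +
      (\<alpha> * n\<^sup>2 + real K * (576 * n\<^sup>2 / (\<eta> * n) ^ 3 + 12 * n / (\<eta> * n))\<^sup>2 * n) + n\<^sup>2 * real (k * K) / real (B - K))
      \<le> (\<alpha> + 5 * \<epsilon>) * n ^ 3" .
    have "n ^ 3 \<le> real (card T) + 2 * n\<^sup>2 + 2 * (2304 * (n\<^sup>2 / real (K + 2) + n * (\<delta> * n))) * n +
      n * (n * real K + (real K)\<^sup>2 * (2304 * (n\<^sup>2 / real k + n * (\<eta> * n))) +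
      (\<alpha> * n\<^sup>2 + real K * (576 * n\<^sup>2 / (\<eta> * n) ^ 3 + 12 * n / (\<eta> * n))\<^sup>2 * n) +
      n\<^sup>2 * real (k * K) / real (B - K))"
      unfolding T_def n_def
      by (rule card_poor_triples_ge[OF P(1) k2 D[unfolded n_def] \<alpha>(1) KB _ planes lines]) (use delta in auto)
    \<comment> \<open>One \<epsilon> for repeated points, four for rich lines and five for bad
      pairs, besides the term with \<alpha>.\<close>
    then have "n ^ 3 \<le> real (card T) + \<epsilon> * n ^ 3 + 4 * \<epsilon> * n ^ 3 + (\<alpha> + 5 * \<epsilon>) * n ^ 3"
      using t1 t2 t7 by linarith
    then have T_ge: "(1 - \<alpha>) / 2 * n ^ 3 \<le> real (card T)" by (simp add: \<epsilon>_def field_simps)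
    have finT: "finite T" unfolding T_def by (rule finite_subset[of _ "P \<times> P \<times> P"]) (use P in auto)
    have "card T \<le> M * (card P * card (ordinary_lines P))"
    proof (rule ordinary_lines_from_triples[OF P(1) finT])
      fix H
      show "card {(a, b, c) \<in> T. plane_of a b c = H} \<le> M"
      proof (cases "{(a, b, c) \<in> T. plane_of a b c = H} = {}")
        case False
        then have "card (P \<inter> H) \<le> B + 1" by (auto simp: T_def)
        have "{(a, b, c) \<in> T. plane_of a b c = H} \<subseteq> (P \<inter> H) \<times> (P \<inter> H) \<times> (P \<inter> H)"
          by (auto simp: T_def)
        then have "card {(a, b, c) \<in> T. plane_of a b c = H} \<le> card ((P \<inter> H) \<times> (P \<inter> H) \<times> (P \<inter> H))"
          using P(1) by (intro card_mono) auto
        also have "\<dots> = card (P \<inter> H) ^ 3" by (simp add: card_cartesian_product power3_eq_cube)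
        also have "\<dots> \<le> M" unfolding M_def using \<open>card (P \<inter> H) \<le> B + 1\<close> by (rule power_mono) simp
        finally show ?thesis .
      qed (simp only: card.empty)
    qed (auto simp: T_def)
    then have "real (card T) \<le> real M * (n * real (card (ordinary_lines P)))"
      unfolding n_def by (simp flip: of_nat_mult)
    then have "(1 - \<alpha>) / 2 * n ^ 3 \<le> real M * (n * real (card (ordinary_lines P)))" using T_ge by linarith
    then have "n * ((1 - \<alpha>) / 2 * n\<^sup>2) \<le> n * (real M * real (card (ordinary_lines P)))"
      by (simp add: power2_eq_square power3_eq_cube mult_ac)
    then have "(1 - \<alpha>) / 2 * n\<^sup>2 \<le> real M * real (card (ordinary_lines P))" using n0 by simp
    moreover have "0 < real M" by (simp add: M_def)
    ultimately have "c * n\<^sup>2 \<le> real (card (ordinary_lines P))" by (simp add: c_def field_simps)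
    then show ?thesis by (simp add: n_def)
  qed
  show ?thesis
  proof (rule exI[of _ \<delta>], rule conjI[OF delta], rule exI[of _ c], rule conjI[OF c], rule exI[of _ N], intro allI impI)
    fix P :: "(real^3) set"
    assume "finite P \<and> N \<le> card P \<and> (\<forall>H. is_plane H \<longrightarrow> real (card (P \<inter> H)) \<le> \<alpha> * real (card P)) \<and>
      (\<forall>p\<in>P. \<forall>q\<in>P. p \<noteq> q \<longrightarrow> real (card (P \<inter> line_of p q)) \<le> \<delta> * real (card P))"
    then show "c * (real (card P))\<^sup>2 \<le> real (card (ordinary_lines P))" by (intro main) simp_all
  qed
qed

section \<open>Point sets with a rich line\<close>

text \<open>Double counting of triples \<open>x\<close>, \<open>y\<close>, \<open>y'\<close> with
  \<open>y'\<close> in \<open>A\<close> on the line \<open>xy\<close>. Those with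
  \<open>y' = y\<close> number at most \<open>(card P)\<^sup>2\<close>; in the others
  \<open>x\<close> is determined by \<open>y\<close> and \<open>y'\<close>, being the point where
  their line meets the line \<open>ab\<close>.\<close>

lemma bad_fan:
  assumes P: "finite P" and ab: "a \<noteq> b" and A: "A \<subseteq> P" "A \<inter> line_of a b = {}"
  shows "card {(x, y) \<in> (P \<inter> line_of a b) \<times> A. C < card (A \<inter> line_of x y)} * C \<le> 2 * (card P)\<^sup>2"
proof -
  define L where "L = P \<inter> line_of a b"
  define Z where "Z = {(x, y) \<in> L \<times> A. C < card (A \<inter> line_of x y)}"
  have finA: "finite A" using A P by (auto intro: finite_subset)
  have finL: "finite L" using P by (simp add: L_def)
  have finZ: "finite Z" unfolding Z_def by (rule finite_subset[of _ "L \<times> A"]) (use finL finA in auto)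
  define T where "T = {(z, y') \<in> Z \<times> A. y' \<in> line_of (fst z) (snd z)}"
  have "real (card Z) * real C \<le> real (card T)"
    unfolding T_def
  proof (rule card_pairs_ge[OF finZ finA])
    fix z assume "z \<in> Z"
    moreover have "{y \<in> A. y \<in> line_of (fst z) (snd z)} = A \<inter> line_of (fst z) (snd z)" by auto
    ultimately show "real C \<le> real (card {y \<in> A. y \<in> line_of (fst z) (snd z)})" by (auto simp: Z_def)
  qed
  then have "card Z * C \<le> card T" by (simp flip: of_nat_mult)
  also have "card T \<le> card ((\<lambda>(x, y). ((x, y), y)) ` (L \<times> A)) + card {t\<in>T. snd t \<noteq> snd (fst t)}"
  proof -
    have "T \<subseteq> (\<lambda>(x, y). ((x, y), y)) ` (L \<times> A) \<union> {t\<in>T. snd t \<noteq> snd (fst t)}"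
      unfolding T_def Z_def by force
    moreover have "finite T" unfolding T_def by (rule finite_subset[of _ "Z \<times> A"]) (use finZ finA in auto)
    ultimately have "card T \<le> card ((\<lambda>(x, y). ((x, y), y)) ` (L \<times> A) \<union> {t\<in>T. snd t \<noteq> snd (fst t)})"
      using finL finA by (intro card_mono) auto
    then show ?thesis using card_Un_le order_trans by blast
  qed
  also have "card ((\<lambda>(x, y). ((x, y), y)) ` (L \<times> A)) \<le> card P * card P"
    by (rule order_trans[OF card_image_Times_le[OF finL finA]])
      (use P A in \<open>auto simp: L_def intro!: mult_le_mono card_mono\<close>)
  also have "card {t\<in>T. snd t \<noteq> snd (fst t)} \<le> card (P \<times> P)"
  proof (rule card_inj_on_le[of "\<lambda>t. (snd (fst t), snd t)"])
    show "inj_on (\<lambda>t. (snd (fst t), snd t)) {t\<in>T. snd t \<noteq> snd (fst t)}"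
    proof (rule inj_onI)
      fix t t' assume t: "t \<in> {t\<in>T. snd t \<noteq> snd (fst t)}" and t': "t' \<in> {t\<in>T. snd t \<noteq> snd (fst t)}"
        and eq: "(snd (fst t), snd t) = (snd (fst t'), snd t')"
      obtain x y y' x' where tt: "t = ((x, y), y')" "t' = ((x', y), y')" using eq by (cases t; cases t') auto
      have m: "x \<in> line_of a b" "x' \<in> line_of a b" "y \<in> A" "y' \<noteq> y" "y' \<in> line_of x y" "y' \<in> line_of x' y"
        using t t' unfolding tt T_def Z_def L_def by auto
      have yab: "y \<notin> line_of a b" using m A by auto
      have xy: "x \<noteq> y" "x' \<noteq> y" using m yab by auto
      have "line_of y y' = line_of x y" "line_of y y' = line_of x' y" using line_of_eq[of y x y y'] line_of_eq[of y x' y y'] m xy by auto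
      then have "x \<in> line_of y y'" "x' \<in> line_of y y'" by auto
      then have "x = x'"
        using line_of_eq[of x y y' x'] line_of_eq[of x a b x'] m ab yab by (metis in_line_of(1))
      then show "t = t'" using tt by simp
    qed
    show "(\<lambda>t. (snd (fst t), snd t)) ` {t\<in>T. snd t \<noteq> snd (fst t)} \<subseteq> P \<times> P"
      using A unfolding T_def Z_def by auto
  qed (use P in auto)
  finally show ?thesis unfolding Z_def L_def by (simp add: card_cartesian_product power2_eq_square)
qed

lemma line_of_subset_of_two:
  assumes "x \<in> line_of a b" "x' \<in> line_of a b" "x \<noteq> x'" "a \<noteq> b" "x \<in> plane_of p q r" "x' \<in> plane_of p q r"
  shows "line_of a b \<subseteq> plane_of p q r"
  using line_of_subset_plane_of[OF assms(5,6,3)] line_of_eq[OF assms(1,2,4,3)] by simp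

lemma plane_of_through_line:
  assumes "a \<noteq> b" "q \<notin> line_of a b" "line_of a b \<subseteq> plane_of x y z" "q \<in> plane_of x y z" "cross3 (y - x) (z - x) \<noteq> 0"
  shows "plane_of a b q = plane_of x y z"
  using assms by (intro plane_of_eq) (auto simp: line_of_def)

text \<open>If the line joining \<open>q\<close> to \<open>x\<close> is not ordinary, it contains a
  further point, which lies in the plane through \<open>q\<close> but off the line
  \<open>ab\<close>. Different \<open>x\<close> give different further points, so at most half of
  the points on the line are spoiled.\<close>

lemma card_fan_ordinary_ge:
  fixes P :: "(real^3) set"
  assumes P: "finite P" and ab: "a \<noteq> b" and q: "q \<in> P" "q \<notin> line_of a b"
    and small: "2 * card ((P - line_of a b) \<inter> plane_of a b q) \<le> card (P \<inter> line_of a b)"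
  shows "card (P \<inter> line_of a b) \<le> 2 * card {x \<in> P \<inter> line_of a b. P \<inter> line_of q x = {q, x}}"
proof -
  define L where "L = P \<inter> line_of a b"
  define O' where "O' = (P - line_of a b) \<inter> plane_of a b q"
  have ex: "\<exists>r. r \<in> O' \<and> r \<noteq> q \<and> r \<in> line_of q x" if x: "x \<in> L" "P \<inter> line_of q x \<noteq> {q, x}" for x
  proof -
    have xP: "x \<in> P" "x \<in> line_of a b" using x by (auto simp: L_def)
    have qx: "q \<noteq> x" using xP q by auto
    obtain r where r: "r \<in> P" "r \<in> line_of q x" "r \<noteq> q" "r \<noteq> x" using x(2) q xP by auto
    have "r \<notin> line_of a b"
    proof
      assume "r \<in> line_of a b"
      then have "line_of r x = line_of a b" using line_of_eq xP ab r by blast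
      moreover have "line_of r x = line_of q x" using line_of_eq[of r q x x] r qx by auto
      ultimately show False using q by auto
    qed
    moreover have "x \<in> plane_of a b q" using line_of_subset_plane_of[of a a b q b] xP ab by auto
    then have "r \<in> plane_of a b q" using line_of_subset_plane_of[of q a b q x] qx r by auto
    ultimately show ?thesis using r by (auto simp: O'_def)
  qed
  define r where "r = (\<lambda>x. SOME r. r \<in> O' \<and> r \<noteq> q \<and> r \<in> line_of q x)"
  have r: "r x \<in> O' \<and> r x \<noteq> q \<and> r x \<in> line_of q x" if "x \<in> {x\<in>L. P \<inter> line_of q x \<noteq> {q, x}}" for x
  proof -
    have "\<exists>r. r \<in> O' \<and> r \<noteq> q \<and> r \<in> line_of q x" using ex that by blast
    then show ?thesis unfolding r_def by (rule someI_ex)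
  qed
  have "card {x\<in>L. P \<inter> line_of q x \<noteq> {q, x}} \<le> card O'"
  proof (rule card_inj_on_le[of r])
    show "inj_on r {x\<in>L. P \<inter> line_of q x \<noteq> {q, x}}"
    proof (rule inj_onI, rule ccontr)
      fix x x' assume x: "x \<in> {x\<in>L. P \<inter> line_of q x \<noteq> {q, x}}" and x': "x' \<in> {x\<in>L. P \<inter> line_of q x \<noteq> {q, x}}"
        and eq: "r x = r x'" and ne: "x \<noteq> x'"
      have xl: "x \<in> line_of a b" "x' \<in> line_of a b" using x x' by (auto simp: L_def)
      have "q \<noteq> x" "q \<noteq> x'" using xl q by auto
      then have "line_of q (r x) = line_of q x" "line_of q (r x) = line_of q x'"
        using line_of_eq[of q q x "r x"] line_of_eq[of q q x' "r x"] r[OF x] r[OF x'] eq by auto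
      then have "x \<in> line_of q x" "x' \<in> line_of q x" by auto
      then have "line_of x x' = line_of q x" using line_of_eq[of x q x x'] ne \<open>q \<noteq> x\<close> by auto
      moreover have "line_of x x' = line_of a b" using line_of_eq xl ne ab by blast
      ultimately show False using q by auto
    qed
    show "r ` {x\<in>L. P \<inter> line_of q x \<noteq> {q, x}} \<subseteq> O'" using r by blast
    show "finite O'" using P by (simp add: O'_def)
  qed
  moreover have "card L = card {x\<in>L. P \<inter> line_of q x = {q, x}} + card {x\<in>L. P \<inter> line_of q x \<noteq> {q, x}}"
  proof -
    have "card ({x\<in>L. P \<inter> line_of q x = {q, x}} \<union> {x\<in>L. P \<inter> line_of q x \<noteq> {q, x}}) =
        card {x\<in>L. P \<inter> line_of q x = {q, x}} + card {x\<in>L. P \<inter> line_of q x \<noteq> {q, x}}"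
      by (rule card_Un_disjoint) (use P in \<open>auto simp: L_def\<close>)
    moreover have "{x\<in>L. P \<inter> line_of q x = {q, x}} \<union> {x\<in>L. P \<inter> line_of q x \<noteq> {q, x}} = L" by blast
    ultimately show ?thesis by simp
  qed
  ultimately show ?thesis using small unfolding L_def O'_def by linarith
qed

text \<open>The two points of the ordinary line are told apart by membership in \<open>L\<close>, so
  the line determines the pair.\<close>

lemma ordinary_lines_from_pairs:
  assumes P: "finite P" and S: "S \<subseteq> P" "S \<inter> L = {}"
  shows "card {(q, x) \<in> S \<times> (P \<inter> L). P \<inter> line_of q x = {q, x}} \<le> card (ordinary_lines P)"
proof (rule card_inj_on_le[of "\<lambda>(q, x). line_of q x"])
  show "inj_on (\<lambda>(q, x). line_of q x) {(q, x) \<in> S \<times> (P \<inter> L). P \<inter> line_of q x = {q, x}}"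
  proof (rule inj_onI)
    fix y z assume y: "y \<in> {(q, x) \<in> S \<times> (P \<inter> L). P \<inter> line_of q x = {q, x}}"
      and z: "z \<in> {(q, x) \<in> S \<times> (P \<inter> L). P \<inter> line_of q x = {q, x}}"
      and eq: "(case y of (q, x) \<Rightarrow> line_of q x) = (case z of (q, x) \<Rightarrow> line_of q x)"
    obtain q x q' x' where yz: "y = (q, x)" "z = (q', x')" by (cases y, cases z)
    have "q \<in> S" "q' \<in> S" "x \<in> L" "x' \<in> L" "{q, x} = {q', x'}" using y z eq unfolding yz by auto
    then have "q = q' \<and> x = x'" using S(2) by (metis disjoint_iff doubleton_eq_iff)
    then show "y = z" unfolding yz by simp
  qed
  show "(\<lambda>(q, x). line_of q x) ` {(q, x) \<in> S \<times> (P \<inter> L). P \<inter> line_of q x = {q, x}} \<subseteq> ordinary_lines P"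
  proof (rule image_subsetI)
    fix y assume "y \<in> {(q, x) \<in> S \<times> (P \<inter> L). P \<inter> line_of q x = {q, x}}"
    then obtain q x where y: "y = (q, x)" "q \<in> S" "x \<in> L" "P \<inter> line_of q x = {q, x}" by (cases y) auto
    have "q \<noteq> x" using y S(2) by auto
    then show "(case y of (q, x) \<Rightarrow> line_of q x) \<in> ordinary_lines P"
      unfolding y(1) using y(4) by (simp add: ordinary_lines_def is_line_line_of)
  qed
qed (rule finite_ordinary_lines[OF P])

text \<open>A plane through \<open>x\<close>, \<open>y\<close>, \<open>z\<close> meets the line \<open>ab\<close> only in \<open>x\<close> and meets the two
  planes of \<open>A\<close> and \<open>B\<close> in the lines \<open>xy\<close> and \<open>xz\<close>, so it contains few of the triples.\<close>

lemma two_fans_triples: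
  fixes P :: "(real^3) set"
  assumes P: "finite P" and ab: "a \<noteq> b" and A: "A \<subseteq> P" "A \<inter> line_of a b = {}" "A \<subseteq> plane_of a b q1"
    and B: "B \<subseteq> P" "B \<inter> line_of a b = {}" "B \<subseteq> plane_of a b q2"
    and q: "q1 \<notin> line_of a b" "q2 \<notin> line_of a b" "plane_of a b q1 \<noteq> plane_of a b q2"
  shows "card {(x, y, z) \<in> (P \<inter> line_of a b) \<times> A \<times> B. card (A \<inter> line_of x y) \<le> C \<and> card (B \<inter> line_of x z) \<le> C}
    \<le> C * C * (card P * card (ordinary_lines P))"
proof -
  define T where "T = {(x, y, z) \<in> (P \<inter> line_of a b) \<times> A \<times> B. card (A \<inter> line_of x y) \<le> C \<and> card (B \<inter> line_of x z) \<le> C}"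
  have fin: "finite A" "finite B" using A B P by (auto intro: finite_subset)
  have finT: "finite T" unfolding T_def by (rule finite_subset[of _ "P \<times> A \<times> B"]) (use P fin in auto)
  have nc: "cross3 (b - a) (q1 - a) \<noteq> 0" "cross3 (b - a) (q2 - a) \<noteq> 0" using q by (auto simp: line_of_def)
  have lsub: "line_of a b \<subseteq> plane_of a b q1" "line_of a b \<subseteq> plane_of a b q2"
    by (rule line_of_subset_plane_of; use ab in simp)+
  have p1: "plane_of a b y = plane_of a b q1" if "y \<in> plane_of a b q1" "y \<notin> line_of a b" for y
    using plane_of_through_line[OF ab that(2) lsub(1) that(1) nc(1)] .
  have p2: "plane_of a b y = plane_of a b q2" if "y \<in> plane_of a b q2" "y \<notin> line_of a b" for y
    using plane_of_through_line[OF ab that(2) lsub(2) that(1) nc(2)] .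
  have disj: "y \<notin> plane_of a b q2" if "y \<in> A" for y
    using p1[of y] p2[of y] that A(2,3) q(3) by auto
  have disj': "z \<notin> plane_of a b q1" if "z \<in> B" for z
    using p1[of z] p2[of z] that B(2,3) q(3) by auto
  have tri: "cross3 (y - x) (z - x) \<noteq> 0" if "x \<in> line_of a b" "y \<in> A" "z \<in> B" for x y z
  proof
    assume "cross3 (y - x) (z - x) = 0"
    then have "z \<in> line_of x y" by (simp add: line_of_def)
    moreover have "x \<noteq> y" using that A(2) by auto
    ultimately have "z \<in> plane_of a b q1"
      using line_of_subset_plane_of[of x a b q1 y] that lsub A(3) by auto
    then show False using disj' that by auto
  qed
  have "card T \<le> (C * C) * (card P * card (ordinary_lines P))"
  proof (rule ordinary_lines_from_triples[OF P finT])
    fix H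
    show "card {(x, y, z) \<in> T. plane_of x y z = H} \<le> C * C"
    proof (cases "{(x, y, z) \<in> T. plane_of x y z = H} = {}")
      case False
      then obtain x0 y0 z0 where t0: "(x0, y0, z0) \<in> T" and H: "plane_of x0 y0 z0 = H" by auto
      have m0: "x0 \<in> line_of a b" "y0 \<in> A" "z0 \<in> B" using t0 by (auto simp: T_def)
      have nc0: "cross3 (y0 - x0) (z0 - x0) \<noteq> 0" using tri m0 .
      have H0: "x0 \<in> H" "y0 \<in> H" "z0 \<in> H" using H by auto
      \<comment> \<open>A plane containing the line \<open>ab\<close> together with
        \<open>y0\<close> and \<open>z0\<close> would equal both of the two different planes through
        that line.\<close>
      have nsub: "\<not> line_of a b \<subseteq> H"
      proof
        assume s: "line_of a b \<subseteq> H"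
        have "y0 \<notin> line_of a b" "z0 \<notin> line_of a b" using m0 A(2) B(2) by auto
        then have "plane_of a b y0 = H" "plane_of a b z0 = H"
          using plane_of_through_line[OF ab, of _ x0 y0 z0] s H0 nc0 unfolding H by auto
        moreover have "plane_of a b y0 = plane_of a b q1" "plane_of a b z0 = plane_of a b q2"
          using p1 p2 m0 A(2,3) B(2,3) by blast+
        ultimately show False using q(3) by simp
      qed
      have "{(x, y, z) \<in> T. plane_of x y z = H} \<subseteq> {x0} \<times> (A \<inter> line_of x0 y0) \<times> (B \<inter> line_of x0 z0)"
      proof (rule subsetI)
        fix t assume "t \<in> {(x, y, z) \<in> T. plane_of x y z = H}"
        then obtain x y z where t: "t = (x, y, z)" "(x, y, z) \<in> T" "plane_of x y z = H" by (cases t) auto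
        have m: "x \<in> line_of a b" "y \<in> A" "z \<in> B" using t by (auto simp: T_def)
        have tH: "x \<in> H" "y \<in> H" "z \<in> H" using t(3) by auto
        have "x = x0"
        proof (rule ccontr)
          assume "x \<noteq> x0"
          then have "line_of a b \<subseteq> plane_of x0 y0 z0"
            using line_of_subset_of_two[of x a b x0 x0 y0 z0] m m0 ab tH H0 H by auto
          then show False using nsub H by simp
        qed
        \<comment> \<open>Otherwise \<open>x0\<close>, \<open>y0\<close>, \<open>y\<close> would
          span both \<open>H\<close> and the plane of \<open>A\<close>, putting \<open>z0\<close>
          into the latter.\<close>
        moreover have "y \<in> line_of x0 y0"
        proof (rule ccontr)
          assume "y \<notin> line_of x0 y0"
          then have n: "cross3 (y0 - x0) (y - x0) \<noteq> 0" by (simp add: line_of_def)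
          have "plane_of x0 y0 y = plane_of x0 y0 z0"
            using H0 tH n nc0 H by (intro plane_of_eq) auto
          moreover have "plane_of x0 y0 y = plane_of a b q1"
            using m m0 lsub A(3) n nc by (intro plane_of_eq) auto
          ultimately show False using H0 H disj'[OF m0(3)] by auto
        qed
        moreover have "z \<in> line_of x0 z0"
        proof (rule ccontr)
          assume "z \<notin> line_of x0 z0"
          then have n: "cross3 (z0 - x0) (z - x0) \<noteq> 0" by (simp add: line_of_def)
          have "plane_of x0 z0 z = plane_of x0 y0 z0"
            using H0 tH n nc0 H by (intro plane_of_eq) auto
          moreover have "plane_of x0 z0 z = plane_of a b q2"
            using m m0 lsub B(3) n nc by (intro plane_of_eq) auto
          ultimately show False using H0 H disj[OF m0(2)] by auto
        qed
        ultimately show "t \<in> {x0} \<times> (A \<inter> line_of x0 y0) \<times> (B \<inter> line_of x0 z0)"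
          using t(1) m by auto
      qed
      then have "card {(x, y, z) \<in> T. plane_of x y z = H} \<le> card ({x0} \<times> (A \<inter> line_of x0 y0) \<times> (B \<inter> line_of x0 z0))"
        using fin by (intro card_mono) auto
      also have "\<dots> = card (A \<inter> line_of x0 y0) * card (B \<inter> line_of x0 z0)"
        by (simp add: card_cartesian_product)
      also have "\<dots> \<le> C * C" using t0 by (intro mult_le_mono) (auto simp: T_def)
      finally show ?thesis .
    qed (simp only: card.empty)
  qed (use A B tri in \<open>auto simp: T_def\<close>)
  then show ?thesis unfolding T_def .
qed

lemma rich_line_case:
  fixes P :: "(real^3) set" and \<alpha> \<delta> :: real
  assumes P: "finite P" and \<delta>: "0 < \<delta>" and \<alpha>: "\<alpha> < 1"
    and planes: "\<And>H. is_plane H \<Longrightarrow> real (card (P \<inter> H)) \<le> \<alpha> * real (card P)"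
    and ab: "a \<noteq> b" and rich: "\<delta> * real (card P) < real (card (P \<inter> line_of a b))"
    and C: "32 / \<delta> ^ 3 \<le> real C"
  shows "min ((1 - \<alpha>) * \<delta> / 4) (\<delta> ^ 3 / (8 * (real C)\<^sup>2)) * (real (card P))\<^sup>2 \<le> real (card (ordinary_lines P))"
proof -
  define n where "n = real (card P)"
  define L where "L = P \<inter> line_of a b"
  define k where "k = real (card L)"
  have kn: "\<delta> * n < k" using rich by (simp add: n_def k_def L_def)
  have finL: "finite L" using P by (simp add: L_def)
  have "k \<le> n" unfolding k_def n_def using P by (auto simp: L_def intro!: card_mono)
  then have n0: "0 < n" using kn \<delta> by (cases "n = 0") (auto simp: n_def)
  define fan where "fan = (\<lambda>q. (P - line_of a b) \<inter> plane_of a b q)"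
  \<comment> \<open>The points whose plane through the rich line has few points off that line; each
    of them is on at least \<open>card L / 2\<close> ordinary lines to \<open>L\<close>.\<close>
  define S where "S = {q \<in> P - line_of a b. 2 * card (fan q) \<le> card L}"
  have S: "S \<subseteq> P" "S \<inter> line_of a b = {}" "finite S" using P by (auto simp: S_def)
  show ?thesis
  proof (cases "(1 - \<alpha>) / 2 * n \<le> real (card S)")
    case True
    have "real (card S) * (k / 2) \<le> real (card {(q, x) \<in> S \<times> L. P \<inter> line_of q x = {q, x}})"
    proof (rule card_pairs_ge[OF S(3) finL])
      fix q assume q: "q \<in> S"
      have "card L \<le> 2 * card {x \<in> L. P \<inter> line_of q x = {q, x}}"
        unfolding L_def by (rule card_fan_ordinary_ge[OF P ab]) (use q in \<open>auto simp: S_def fan_def L_def\<close>)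
      then show "k / 2 \<le> real (card {x \<in> L. P \<inter> line_of q x = {q, x}})" by (simp add: k_def)
    qed
    also have "\<dots> \<le> real (card (ordinary_lines P))"
      unfolding L_def using ordinary_lines_from_pairs[OF P S(1,2)] by simp
    finally have "real (card S) * (k / 2) \<le> real (card (ordinary_lines P))" .
    moreover have "((1 - \<alpha>) / 2 * n) * (\<delta> * n / 2) \<le> real (card S) * (k / 2)"
      using True kn \<alpha> \<delta> n0 by (intro mult_mono) auto
    moreover have "((1 - \<alpha>) / 2 * n) * (\<delta> * n / 2) = (1 - \<alpha>) * \<delta> / 4 * n\<^sup>2" by (simp add: power2_eq_square)
    moreover have "min ((1 - \<alpha>) * \<delta> / 4) (\<delta> ^ 3 / (8 * (real C)\<^sup>2)) * n\<^sup>2 \<le> (1 - \<alpha>) * \<delta> / 4 * n\<^sup>2"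
      by (intro mult_right_mono) auto
    ultimately show ?thesis unfolding n_def by linarith
  next
    case False
    \<comment> \<open>A plane through the line misses at least \<open>(1 - \<alpha>) * n\<close>
      points, while \<open>S\<close> has fewer than half as many; so some missed point is outside
      \<open>S\<close>. This is applied to an arbitrary plane through the line and then to the plane
      of the point found.\<close>
    have big: "\<exists>q\<in>P. q \<notin> plane_of a b c \<and> q \<notin> line_of a b \<and> card L < 2 * card (fan q)"
      if c: "cross3 (b - a) (c - a) \<noteq> 0" for c
    proof (rule ccontr)
      assume no: "\<not> ?thesis"
      have lsub: "line_of a b \<subseteq> plane_of a b c" using ab by (intro line_of_subset_plane_of) auto
      have "P \<subseteq> (P \<inter> plane_of a b c) \<union> S"
        using no lsub by (force simp: S_def not_less)
      then have "card P \<le> card ((P \<inter> plane_of a b c) \<union> S)" using P S(3) by (intro card_mono) auto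
      also have "\<dots> \<le> card (P \<inter> plane_of a b c) + card S" by (rule card_Un_le)
      finally have "n \<le> real (card (P \<inter> plane_of a b c)) + real (card S)" by (simp add: n_def)
      moreover have "real (card (P \<inter> plane_of a b c)) \<le> \<alpha> * n"
        unfolding n_def by (rule planes[OF is_plane_plane_of[OF c]])
      ultimately have "n \<le> \<alpha> * n + real (card S)" by linarith
      then have "(1 - \<alpha>) * n < (1 - \<alpha>) / 2 * n" using False by (simp add: algebra_simps)
      moreover have "0 < (1 - \<alpha>) * n" using \<alpha> n0 by simp
      ultimately show False by (simp add: mult.commute)
    qed
    have "b - a \<noteq> 0" using ab by simp
    then obtain e where "cross3 (b - a) e \<noteq> 0" using cross_basis_nonzero by blast
    then have "cross3 (b - a) ((a + e) - a) \<noteq> 0" by simp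
    from big[OF this] obtain q1 where q1: "q1 \<in> P" "q1 \<notin> line_of a b" "card L < 2 * card (fan q1)" by blast
    have "cross3 (b - a) (q1 - a) \<noteq> 0" using q1 by (simp add: line_of_def)
    from big[OF this] obtain q2 where q2: "q2 \<in> P" "q2 \<notin> plane_of a b q1" "q2 \<notin> line_of a b" "card L < 2 * card (fan q2)" by blast
    define A where "A = fan q1"
    define B where "B = fan q2"
    have A: "A \<subseteq> P" "A \<inter> line_of a b = {}" "A \<subseteq> plane_of a b q1" by (auto simp: A_def fan_def)
    have B: "B \<subseteq> P" "B \<inter> line_of a b = {}" "B \<subseteq> plane_of a b q2" by (auto simp: B_def fan_def)
    have fin: "finite A" "finite B" using A B P by (auto intro: finite_subset)
    have cA: "\<delta> * n / 2 \<le> real (card A)" and cB: "\<delta> * n / 2 \<le> real (card B)"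
      using q1(3) q2(4) kn unfolding A_def B_def k_def by linarith+
    have An: "real (card A) \<le> n" "real (card B) \<le> n" using A(1) B(1) P by (auto simp: n_def card_mono)
    have C0: "0 < real C" using C \<delta> by (smt (verit) divide_pos_pos zero_less_power)
    define ZA where "ZA = {(x, y) \<in> L \<times> A. C < card (A \<inter> line_of x y)}"
    define ZB where "ZB = {(x, y) \<in> L \<times> B. C < card (B \<inter> line_of x y)}"
    have finZ: "finite ZA" "finite ZB"
      by (rule finite_subset[of _ "L \<times> A"], use finL fin in \<open>auto simp: ZA_def\<close>)
         (rule finite_subset[of _ "L \<times> B"], use finL fin in \<open>auto simp: ZB_def\<close>)
    have "card ZA * C \<le> 2 * (card P)\<^sup>2" "card ZB * C \<le> 2 * (card P)\<^sup>2"
      unfolding ZA_def ZB_def L_def by (rule bad_fan[OF P ab A(1,2)], rule bad_fan[OF P ab B(1,2)])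
    then have "real (card ZA * C) \<le> real (2 * (card P)\<^sup>2)" "real (card ZB * C) \<le> real (2 * (card P)\<^sup>2)"
      by (simp_all only: of_nat_le_iff)
    then have Z: "real (card ZA) \<le> 2 * n\<^sup>2 / real C" "real (card ZB) \<le> 2 * n\<^sup>2 / real C"
      using C0 by (simp_all add: n_def pos_le_divide_eq)
    define T where "T = {(x, y, z) \<in> L \<times> A \<times> B. card (A \<inter> line_of x y) \<le> C \<and> card (B \<inter> line_of x z) \<le> C}"
    have finT: "finite T" unfolding T_def by (rule finite_subset[of _ "L \<times> A \<times> B"]) (use finL fin in auto)
    have "L \<times> A \<times> B \<subseteq> T \<union> (\<lambda>((x, y), z). (x, y, z)) ` (ZA \<times> B) \<union> (\<lambda>((x, z), y). (x, y, z)) ` (ZB \<times> A)"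
    proof (rule subsetI)
      fix t assume "t \<in> L \<times> A \<times> B"
      then obtain x y z where t: "t = (x, y, z)" "x \<in> L" "y \<in> A" "z \<in> B" by auto
      consider "(x, y) \<in> ZA" | "(x, z) \<in> ZB" | "t \<in> T"
        using t unfolding ZA_def ZB_def T_def by force
      then show "t \<in> T \<union> (\<lambda>((x, y), z). (x, y, z)) ` (ZA \<times> B) \<union> (\<lambda>((x, z), y). (x, y, z)) ` (ZB \<times> A)"
      proof cases
        case 1
        then have "t \<in> (\<lambda>((x, y), z). (x, y, z)) ` (ZA \<times> B)" using t by force
        then show ?thesis by blast
      next
        case 2
        then have "t \<in> (\<lambda>((x, z), y). (x, y, z)) ` (ZB \<times> A)" using t by force
        then show ?thesis by blast
      qed blast
    qed
    then have "card (L \<times> A \<times> B) \<le> card (T \<union> (\<lambda>((x, y), z). (x, y, z)) ` (ZA \<times> B) \<union> (\<lambda>((x, z), y). (x, y, z)) ` (ZB \<times> A))"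
      using finT finZ fin by (intro card_mono) auto
    also have "\<dots> \<le> card T + card ((\<lambda>((x, y), z). (x, y, z)) ` (ZA \<times> B)) + card ((\<lambda>((x, z), y). (x, y, z)) ` (ZB \<times> A))"
      by (meson add_le_mono card_Un_le le_refl order_trans)
    also have "\<dots> \<le> card T + card ZA * card B + card ZB * card A"
      by (intro add_mono card_image_Times_le finZ fin le_refl)
    finally have "card L * (card A * card B) \<le> card T + card ZA * card B + card ZB * card A"
      by (simp add: card_cartesian_product)
    then have "real (card L * (card A * card B)) \<le> real (card T + card ZA * card B + card ZB * card A)"
      by (simp only: of_nat_le_iff)
    then have "k * (real (card A) * real (card B)) \<le>
        real (card T) + real (card ZA) * real (card B) + real (card ZB) * real (card A)"
      by (simp add: k_def)
    moreover have "real (card ZA) * real (card B) \<le> (2 * n\<^sup>2 / real C) * n"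
      using Z An C0 n0 by (intro mult_mono) auto
    moreover have "real (card ZB) * real (card A) \<le> (2 * n\<^sup>2 / real C) * n"
      using Z An C0 n0 by (intro mult_mono) auto
    \<comment> \<open>The bound 32 on \<open>C * \<delta> ^ 3\<close> makes the two bad sets
      together cost half of the \<open>\<delta> ^ 3 * n ^ 3 / 4\<close> available triples.\<close>
    moreover have "(2 * n\<^sup>2 / real C) * n \<le> \<delta> ^ 3 * n ^ 3 / 16"
    proof -
      have "32 \<le> real C * \<delta> ^ 3" using C \<delta> by (simp add: pos_divide_le_eq)
      then have "2 / real C \<le> \<delta> ^ 3 / 16" using C0 by (simp add: field_simps)
      then have "2 / real C * n ^ 3 \<le> \<delta> ^ 3 / 16 * n ^ 3" using n0 by (intro mult_right_mono) auto
      then show ?thesis by (simp add: power2_eq_square power3_eq_cube mult.assoc)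
    qed
    moreover have "(\<delta> * n) * ((\<delta> * n / 2) * (\<delta> * n / 2)) \<le> k * (real (card A) * real (card B))"
      using kn cA cB \<delta> n0 by (intro mult_mono) (auto simp: k_def)
    moreover have "(\<delta> * n) * ((\<delta> * n / 2) * (\<delta> * n / 2)) = \<delta> ^ 3 * n ^ 3 / 4"
      by (simp add: power3_eq_cube)
    ultimately have "\<delta> ^ 3 * n ^ 3 / 8 \<le> real (card T)" by linarith
    moreover have "card T \<le> C * C * (card P * card (ordinary_lines P))"
      unfolding T_def L_def
      by (rule two_fans_triples[OF P ab A B q1(2) q2(3)]) (use q2(2) in auto)
    then have "real (card T) \<le> real (C * C * (card P * card (ordinary_lines P)))"
      by (simp only: of_nat_le_iff)
    ultimately have "\<delta> ^ 3 * n ^ 3 / 8 \<le> (real C)\<^sup>2 * (n * real (card (ordinary_lines P)))"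
      by (simp add: n_def power2_eq_square)
    then have "n * (\<delta> ^ 3 * n\<^sup>2) \<le> n * (8 * (real C)\<^sup>2 * real (card (ordinary_lines P)))"
      by (simp add: power2_eq_square power3_eq_cube mult_ac)
    then have "\<delta> ^ 3 * n\<^sup>2 \<le> 8 * (real C)\<^sup>2 * real (card (ordinary_lines P))" using n0 by simp
    then have "\<delta> ^ 3 / (8 * (real C)\<^sup>2) * n\<^sup>2 \<le> real (card (ordinary_lines P))"
      using C0 by (simp add: field_simps)
    moreover have "min ((1 - \<alpha>) * \<delta> / 4) (\<delta> ^ 3 / (8 * (real C)\<^sup>2)) * n\<^sup>2 \<le> \<delta> ^ 3 / (8 * (real C)\<^sup>2) * n\<^sup>2"
      by (intro mult_right_mono) auto
    ultimately show ?thesis unfolding n_def by linarith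
  qed
qed

section \<open>Small sets and the final constant\<close>

text \<open>Covers the nonempty sets below the threshold \<open>N\<close>, for which one ordinary
  line is enough. The bound on planes keeps \<open>P\<close> from lying in a plane, so
  Sylvester--Gallai applies.\<close>

lemma ex_ordinary_line:
  fixes P :: "(real^3) set"
  assumes P: "finite P" "P \<noteq> {}" and \<alpha>: "\<alpha> < 1"
    and planes: "\<And>H. is_plane H \<Longrightarrow> real (card (P \<inter> H)) \<le> \<alpha> * real (card P)"
  shows "0 < card (ordinary_lines P)"
proof -
  have n0: "0 < real (card P)" using P by (simp add: card_gt_0_iff)
  have no: "\<not> P \<subseteq> plane_of a b c" if "cross3 (b - a) (c - a) \<noteq> 0" for a b c
  proof
    assume "P \<subseteq> plane_of a b c"
    then have "P \<inter> plane_of a b c = P" by blast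
    then have "real (card P) \<le> \<alpha> * real (card P)" using planes[OF is_plane_plane_of[OF that]] by simp
    then show False using mult_strict_right_mono[OF \<alpha> n0] by simp
  qed
  have no_line: "\<not> P \<subseteq> line_of a b" if "a \<noteq> b" for a b
  proof -
    have "b - a \<noteq> 0" using that by simp
    then obtain e where "cross3 (b - a) e \<noteq> 0" using cross_basis_nonzero by blast
    then have "cross3 (b - a) ((a + e) - a) \<noteq> 0" by simp
    then have "\<not> P \<subseteq> plane_of a b (a + e)" by (rule no)
    moreover have "line_of a b \<subseteq> plane_of a b (a + e)" using that by (intro line_of_subset_plane_of) auto
    ultimately show ?thesis by blast
  qed
  obtain a where a: "a \<in> P" using P by blast
  have "\<not> P \<subseteq> line_of a (a + axis 1 1)" by (rule no_line) (simp add: axis_eq_0_iff)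
  then obtain b where b: "b \<in> P" "b \<noteq> a" using in_line_of(1) by blast
  then obtain c where c: "c \<in> P" "c \<notin> line_of a b" using no_line[of a b] by blast
  obtain x y where xy: "x \<in> P" "y \<in> P" "x \<noteq> y" "P \<inter> line_of x y = {x, y}"
    using sylvester_gallai[of P a b c] P a b c by (auto simp: line_of_def)
  then have "line_of x y \<in> ordinary_lines P" by (simp add: ordinary_lines_def is_line_line_of)
  then show ?thesis using finite_ordinary_lines[OF P(1)] by (auto simp: card_gt_0_iff)
qed

theorem theorem1p3:
  fixes \<alpha> :: real
  assumes "\<alpha> < 1"
  shows "\<exists>c>0. \<forall>(n::nat) (P :: (real ^ 3) set).
    finite P \<and> card P = n \<and>
    (\<forall>H. is_plane H \<longrightarrow> real (card (P \<inter> H)) \<le> \<alpha> * real n)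
    \<longrightarrow> real (card (ordinary_lines P)) \<ge> c * (real n)\<^sup>2"
proof -
  \<comment> \<open>The case without rich lines expects a nonnegative bound; raising a negative
    \<alpha> to 0 only weakens the condition on planes.\<close>
  define \<beta> where "\<beta> = max \<alpha> 0"
  have \<beta>: "0 \<le> \<beta>" "\<beta> < 1" using assms by (auto simp: \<beta>_def)
  obtain \<delta> c1 :: real and N :: nat where \<delta>: "0 < \<delta>" and c1: "0 < c1"
    and no_rich: "\<And>P::(real^3) set. finite P \<and> N \<le> card P \<and>
      (\<forall>H. is_plane H \<longrightarrow> real (card (P \<inter> H)) \<le> \<beta> * real (card P)) \<and>
      (\<forall>p\<in>P. \<forall>q\<in>P. p \<noteq> q \<longrightarrow> real (card (P \<inter> line_of p q)) \<le> \<delta> * real (card P)) \<longrightarrow>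
      c1 * (real (card P))\<^sup>2 \<le> real (card (ordinary_lines P))"
    using no_rich_line_case[OF \<beta>] by blast
  define C where "C = nat \<lceil>32 / \<delta> ^ 3\<rceil>"
  have C: "32 / \<delta> ^ 3 \<le> real C" unfolding C_def by linarith
  then have C0: "0 < real C" using \<delta> by (smt (verit) divide_pos_pos zero_less_power)
  define c2 where "c2 = min ((1 - \<beta>) * \<delta> / 4) (\<delta> ^ 3 / (8 * (real C)\<^sup>2))"
  have c2: "0 < c2" using \<beta> \<delta> C0 by (simp add: c2_def)
  \<comment> \<open>For fewer than \<open>N\<close> points this makes the required number of
    ordinary lines at most 1.\<close>
  define c3 where "c3 = 1 / (real N + 1)\<^sup>2"
  have c3: "0 < c3" by (simp add: c3_def add_nonneg_pos)
  define c where "c = min c1 (min c2 c3)"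
  have c: "0 < c" "c \<le> c1" "c \<le> c2" "c \<le> c3" using c1 c2 c3 by (auto simp: c_def)
  have "c * (real (card P))\<^sup>2 \<le> real (card (ordinary_lines P))"
    if P: "finite P" and planes\<alpha>: "\<And>H. is_plane H \<Longrightarrow> real (card (P \<inter> H)) \<le> \<alpha> * real (card P)" for P :: "(real^3) set"
  proof -
    have planes: "real (card (P \<inter> H)) \<le> \<beta> * real (card P)" if "is_plane H" for H
      using planes\<alpha>[OF that] mult_right_mono[of \<alpha> \<beta> "real (card P)"] by (simp add: \<beta>_def)
    have mono: "c * (real (card P))\<^sup>2 \<le> d * (real (card P))\<^sup>2" if "c \<le> d" for d
      using that by (rule mult_right_mono) simp
    consider (empty) "P = {}" | (small) "P \<noteq> {}" "card P < N"
      | (rich) a b where "a \<in> P" "b \<in> P" "a \<noteq> b" "\<delta> * real (card P) < real (card (P \<inter> line_of a b))"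
      | (poor) "N \<le> card P" "\<forall>p\<in>P. \<forall>q\<in>P. p \<noteq> q \<longrightarrow> real (card (P \<inter> line_of p q)) \<le> \<delta> * real (card P)"
      by (meson not_le)
    then show ?thesis
    proof cases
      case small
      have "0 < card (ordinary_lines P)" by (rule ex_ordinary_line[OF P small(1) \<beta>(2) planes])
      then have "1 \<le> real (card (ordinary_lines P))" by linarith
      moreover have "c3 * (real (card P))\<^sup>2 \<le> 1"
      proof -
        have "(real (card P))\<^sup>2 \<le> (real N + 1)\<^sup>2" using small(2) by (intro power_mono) auto
        then show ?thesis by (simp add: c3_def add_nonneg_pos)
      qed
      ultimately show ?thesis using mono[OF c(4)] by linarith
    next
      case rich
      have "c2 * (real (card P))\<^sup>2 \<le> real (card (ordinary_lines P))"
        unfolding c2_def by (rule rich_line_case[OF P \<delta> \<beta>(2) planes rich(3,4) C])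
      then show ?thesis using mono[OF c(3)] by linarith
    next
      case poor
      then have "c1 * (real (card P))\<^sup>2 \<le> real (card (ordinary_lines P))"
        using no_rich[of P] P planes by blast
      then show ?thesis using mono[OF c(2)] by linarith
    qed simp
  qed
  then show ?thesis using c(1) by (intro exI[of _ c]) auto
qed

end
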